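(* Let $\mathbb X$ be a Cartesian join restriction category, $(G,m,u,\iota)$ a group object in $\mathbb X$ with $m,u,\iota$ total, and $(P,M,q,(\alpha_i)_{i\in I},(\tau_{ij})_{i,j\in I})$ a totally fibred principal $G$-bundle in $\mathbb X$ such that the restriction pullback $P\times_MP$ of $q$ along itself exists. Let $r=\bigvee_{i\in I}(\alpha_i\times1_G)(1_M\times m)\alpha_i^*:P\times G\to P$. Then $(P,q)$, with action $r$, is a total right $G$-torsor in the slice category $\mathbb X\downarrow M$; that is, $$\langle\pi_0,r\rangle:P\times G\cong P\times_M(M\times G)\to P\times_MP$$ is a total isomorphism, with inverse $$d^*=\bigvee_{i\in I}(\alpha_i\times_M\alpha_i)\langle\pi_0,\pi_1,\langle\pi_1\iota,\pi_2\rangle m\rangle(\alpha_i^*\times1_G):P\times_MP\to P\times G.$$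
   Context: Composition is written in diagrammatic order: $fg$ means first $f$, then $g$. A restriction category assigns to each $f:A\to B$ a map $\bar f:A\to A$ with $\bar ff=f$, $\bar g\bar f=\bar f\bar g$, $\overline{\bar gf}=\bar g\bar f$, $f\bar h=\overline{fh}f$. Write $f\le g$ if $\bar fg=f$, and $f\smile g$ (compatible) if $\bar fg=\bar gf$. $f$ is total if $\bar f=1$; $e$ is a restriction idempotent if $e=\bar e$; $f$ is a partial isomorphism with partial inverse $f^*$ if $ff^*=\bar f$, $f^*f=\overline{f^*}$. A join restriction category is one in which every set $S$ of pairwise compatible parallel maps has a supremum $\bigvee S$ for $\le$, with $\overline{\bigvee s}=\bigvee\bar s$ and $g\bigvee s=\bigvee gs$. It is Cartesian if it has a restriction terminal object $1$ and restriction products: total projections and unique pairings with $\langle f,g\rangle\pi_0=\bar gf$, $\langle f,g\rangle\pi_1=\bar fg$. The restriction pullback of total maps $f:A\to B\leftarrow C:g$ is an object $X$ with total $p_A,p_C$, $p_Af=p_Cg$, such that for all (possibly partial) $r_A,r_C$ with $r_Af=r_Cg$ there is a unique $h$ with $hp_A=r_A$, $hp_C=r_C$. A fibre bundle over $M$ with typical fibre $F$ is an object $E$ with a total map $q:E\to M$ and partial isomorphisms $\alpha_i:E\to M\times F$ ($i\in I$) with $\alpha_i\pi_0=\bar\alpha_iq$, $\bigvee_i\bar\alpha_i=1_E$, and for each $i$ a restriction idempotent $e_i:M\to M$ with $\overline{\alpha_i^*}=e_i\times1_F$. It is totally fibred if $\bar\alpha_i=\overline{qe_i}$ for all $i$.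 A $G$-atlas on $M$ is a family $\tau_{ij}:M\to G$ with $\langle\tau_{ij},\tau_{jk}\rangle m\le\tau_{ik}$, $\tau_{ii}\le\,!u$, $\tau_{ji}=\tau_{ij}\iota$. A principal $G$-bundle over $M$ is a fibre bundle $(P,M,q,(\alpha_i))$ with fibre $G$ and a $G$-atlas $(\tau_{ij})$ such that $\alpha_i^*\alpha_j=\langle\pi_0,\langle\pi_0\tau_{ji},\pi_1\rangle m\rangle:M\times G\to M\times G$. The restriction slice category $\mathbb X\downarrow M$ has objects $(A,f:A\to M)$, morphisms $(A,f)\to(B,g)$ the maps $\varphi:A\to B$ with $f\ge\varphi g$, and restriction, composition and identities as in $\mathbb X$. $(M\times G,\pi_0)$ is a group object in it, with operations $1_M\times m$, $1_M\times u$, $1_M\times\iota$; a torsor for it is called a $G$-torsor in $\mathbb X\downarrow M$. For a group object $H$ in a restriction category, a total right $H$-torsor is an object $T$ with right action $a:T\times H\to T$ such that $\langle\pi_0,a\rangle:T\times H\to T\times T$ is total with a total inverse. The map $\alpha_i\times_M\alpha_i:P\times_MP\to(M\times G)\times_M(M\times G)\cong M\times G\times G$ is $\alpha_i$ on each factor; $\pi_0,\pi_1,\pi_2$ in the formula for $d^*$ are the projections of $M\times G\times G$. The join defining $r$ exists and $r$ is a total right action. *)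

theory Defs
  imports Main
begin

section \<open>Restriction categories\<close>

text \<open>Composition is written in diagrammatic order: \<open>f \<Zsemi> g\<close> is first \<open>f\<close>, then \<open>g\<close>.
  The restriction of \<open>f\<close> is \<open>\<rho> f\<close>. The operations are only meaningful on arrows, and
  composition only on composable ones.\<close>

record ('o, 'a) rcat =
  Obj :: "'o set"
  Arr :: "'a set"
  Dom :: "'a \<Rightarrow> 'o"
  Cod :: "'a \<Rightarrow> 'o"
  Id :: "'o \<Rightarrow> 'a"
  Comp :: "'a \<Rightarrow> 'a \<Rightarrow> 'a"  (infixl "\<Zsemi>\<index>" 70)
  Rst :: "'a \<Rightarrow> 'a"  ("\<rho>\<index>")

definition hom :: "('o, 'a, 'z) rcat_scheme \<Rightarrow> 'o \<Rightarrow> 'o \<Rightarrow> 'a set" where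
  "hom C A B = {f \<in> Arr C. Dom C f = A \<and> Cod C f = B}"

locale restriction_category =
  fixes C :: "('o, 'a, 'z) rcat_scheme" (structure)
  assumes dom_obj: "f \<in> Arr C \<Longrightarrow> Dom C f \<in> Obj C"
    and cod_obj: "f \<in> Arr C \<Longrightarrow> Cod C f \<in> Obj C"
    and id_hom: "A \<in> Obj C \<Longrightarrow> Id C A \<in> hom C A A"
    and comp_hom: "f \<in> hom C A B \<Longrightarrow> g \<in> hom C B D \<Longrightarrow> f \<Zsemi> g \<in> hom C A D"
    and id_left: "f \<in> hom C A B \<Longrightarrow> Id C A \<Zsemi> f = f"
    and id_right: "f \<in> hom C A B \<Longrightarrow> f \<Zsemi> Id C B = f"
    and comp_assoc: "f \<in> hom C A B \<Longrightarrow> g \<in> hom C B D \<Longrightarrow> h \<in> hom C D E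
                      \<Longrightarrow> (f \<Zsemi> g) \<Zsemi> h = f \<Zsemi> (g \<Zsemi> h)"
    and rst_hom: "f \<in> hom C A B \<Longrightarrow> \<rho> f \<in> hom C A A"
    and R1: "f \<in> hom C A B \<Longrightarrow> \<rho> f \<Zsemi> f = f"
    and R2: "f \<in> hom C A B \<Longrightarrow> g \<in> hom C A D \<Longrightarrow> \<rho> g \<Zsemi> \<rho> f = \<rho> f \<Zsemi> \<rho> g"
    and R3: "f \<in> hom C A B \<Longrightarrow> g \<in> hom C A D \<Longrightarrow> \<rho> (\<rho> g \<Zsemi> f) = \<rho> g \<Zsemi> \<rho> f"
    and R4: "f \<in> hom C A B \<Longrightarrow> h \<in> hom C B D \<Longrightarrow> f \<Zsemi> \<rho> h = \<rho> (f \<Zsemi> h) \<Zsemi> f"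

text \<open>The next two relations are used for parallel maps only.\<close>

definition rle :: "('o, 'a, 'z) rcat_scheme \<Rightarrow> 'a \<Rightarrow> 'a \<Rightarrow> bool" where
  "rle C f g \<longleftrightarrow> Rst C f \<Zsemi>\<^bsub>C\<^esub> g = f"

definition compatible :: "('o, 'a, 'z) rcat_scheme \<Rightarrow> 'a \<Rightarrow> 'a \<Rightarrow> bool" where
  "compatible C f g \<longleftrightarrow> Rst C f \<Zsemi>\<^bsub>C\<^esub> g = Rst C g \<Zsemi>\<^bsub>C\<^esub> f"

definition total :: "('o, 'a, 'z) rcat_scheme \<Rightarrow> 'a \<Rightarrow> bool" where
  "total C f \<longleftrightarrow> Rst C f = Id C (Dom C f)"

definition restriction_idempotent :: "('o, 'a, 'z) rcat_scheme \<Rightarrow> 'a \<Rightarrow> bool" where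
  "restriction_idempotent C e \<longleftrightarrow> e = Rst C e"

definition partial_inverse :: "('o, 'a, 'z) rcat_scheme \<Rightarrow> 'a \<Rightarrow> 'a \<Rightarrow> bool" where
  "partial_inverse C f g \<longleftrightarrow> g \<in> hom C (Cod C f) (Dom C f)
     \<and> f \<Zsemi>\<^bsub>C\<^esub> g = Rst C f \<and> g \<Zsemi>\<^bsub>C\<^esub> f = Rst C g"

definition partial_iso :: "('o, 'a, 'z) rcat_scheme \<Rightarrow> 'a \<Rightarrow> bool" where
  "partial_iso C f \<longleftrightarrow> f \<in> Arr C \<and> (\<exists>g. partial_inverse C f g)"

definition pinv :: "('o, 'a, 'z) rcat_scheme \<Rightarrow> 'a \<Rightarrow> 'a" where
  "pinv C f = (THE g. partial_inverse C f g)"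

definition total_inverse :: "('o, 'a, 'z) rcat_scheme \<Rightarrow> 'a \<Rightarrow> 'a \<Rightarrow> bool" where
  "total_inverse C f g \<longleftrightarrow> f \<in> Arr C \<and> g \<in> hom C (Cod C f) (Dom C f)
     \<and> total C f \<and> total C g
     \<and> f \<Zsemi>\<^bsub>C\<^esub> g = Id C (Dom C f) \<and> g \<Zsemi>\<^bsub>C\<^esub> f = Id C (Cod C f)"

section \<open>Joins\<close>

text \<open>The hom-set is an argument because a set of parallel maps may be empty.\<close>

definition is_join :: "('o, 'a, 'z) rcat_scheme \<Rightarrow> 'o \<Rightarrow> 'o \<Rightarrow> 'a set \<Rightarrow> 'a \<Rightarrow> bool" where
  "is_join C A B S s \<longleftrightarrow> S \<subseteq> hom C A B \<and> s \<in> hom C A B \<and> (\<forall>x\<in>S. rle C x s)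
     \<and> (\<forall>t\<in>hom C A B. (\<forall>x\<in>S. rle C x t) \<longrightarrow> rle C s t)"

definition join :: "('o, 'a, 'z) rcat_scheme \<Rightarrow> 'o \<Rightarrow> 'o \<Rightarrow> 'a set \<Rightarrow> 'a" where
  "join C A B S = (THE s. is_join C A B S s)"

locale join_restriction_category = restriction_category +
  assumes join_exists: "A \<in> Obj C \<Longrightarrow> B \<in> Obj C \<Longrightarrow> S \<subseteq> hom C A B
            \<Longrightarrow> \<forall>f\<in>S. \<forall>g\<in>S. compatible C f g \<Longrightarrow> \<exists>s. is_join C A B S s"
    and join_rst: "is_join C A B S s \<Longrightarrow> is_join C A A (\<rho> ` S) (\<rho> s)"
    and join_comp: "g \<in> hom C D A \<Longrightarrow> is_join C A B S s
            \<Longrightarrow> is_join C D B ((\<lambda>x. g \<Zsemi> x) ` S) (g \<Zsemi> s)"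

section \<open>Restriction products, pullbacks and terminal objects\<close>

record ('o, 'a) span =
  apex :: 'o
  pr0 :: 'a
  pr1 :: 'a

definition is_pairing :: "('o, 'a, 'z) rcat_scheme \<Rightarrow> ('o, 'a) span \<Rightarrow> 'a \<Rightarrow> 'a \<Rightarrow> 'a \<Rightarrow> bool" where
  "is_pairing C K f g h \<longleftrightarrow> h \<in> hom C (Dom C f) (apex K)
     \<and> h \<Zsemi>\<^bsub>C\<^esub> pr0 K = Rst C g \<Zsemi>\<^bsub>C\<^esub> f \<and> h \<Zsemi>\<^bsub>C\<^esub> pr1 K = Rst C f \<Zsemi>\<^bsub>C\<^esub> g"

text \<open>The pairing of \<open>f\<close> and \<open>g\<close> into a product, or into a pullback when \<open>f\<close> and \<open>g\<close> agree over
  the base wherever both are defined.\<close>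

definition pair :: "('o, 'a, 'z) rcat_scheme \<Rightarrow> ('o, 'a) span \<Rightarrow> 'a \<Rightarrow> 'a \<Rightarrow> 'a" where
  "pair C K f g = (THE h. is_pairing C K f g h)"

definition restriction_product ::
    "('o, 'a, 'z) rcat_scheme \<Rightarrow> 'o \<Rightarrow> 'o \<Rightarrow> ('o, 'a) span \<Rightarrow> bool" where
  "restriction_product C A B K \<longleftrightarrow> apex K \<in> Obj C
     \<and> pr0 K \<in> hom C (apex K) A \<and> total C (pr0 K)
     \<and> pr1 K \<in> hom C (apex K) B \<and> total C (pr1 K)
     \<and> (\<forall>Z\<in>Obj C. \<forall>f\<in>hom C Z A. \<forall>g\<in>hom C Z B. \<exists>!h. is_pairing C K f g h)"

definition restriction_pullback ::
    "('o, 'a, 'z) rcat_scheme \<Rightarrow> 'a \<Rightarrow> 'a \<Rightarrow> ('o, 'a) span \<Rightarrow> bool" where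
  "restriction_pullback C f g K \<longleftrightarrow> f \<in> Arr C \<and> g \<in> Arr C \<and> Cod C f = Cod C g
     \<and> total C f \<and> total C g \<and> apex K \<in> Obj C
     \<and> pr0 K \<in> hom C (apex K) (Dom C f) \<and> total C (pr0 K)
     \<and> pr1 K \<in> hom C (apex K) (Dom C g) \<and> total C (pr1 K)
     \<and> pr0 K \<Zsemi>\<^bsub>C\<^esub> f = pr1 K \<Zsemi>\<^bsub>C\<^esub> g
     \<and> (\<forall>Z\<in>Obj C. \<forall>r\<in>hom C Z (Dom C f). \<forall>s\<in>hom C Z (Dom C g). r \<Zsemi>\<^bsub>C\<^esub> f = s \<Zsemi>\<^bsub>C\<^esub> g
          \<longrightarrow> (\<exists>!h. h \<in> hom C Z (apex K) \<and> h \<Zsemi>\<^bsub>C\<^esub> pr0 K = r \<and> h \<Zsemi>\<^bsub>C\<^esub> pr1 K = s))"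

definition bang :: "('o, 'a, 'z) rcat_scheme \<Rightarrow> 'o \<Rightarrow> 'o \<Rightarrow> 'a" where
  "bang C J A = (THE t. t \<in> hom C A J \<and> total C t)"

text \<open>\<open>J\<close> is restriction terminal in the full subcategory on the objects \<open>D\<close>.\<close>

definition restriction_terminal_on ::
    "('o, 'a, 'z) rcat_scheme \<Rightarrow> 'o set \<Rightarrow> 'o \<Rightarrow> bool" where
  "restriction_terminal_on C D J \<longleftrightarrow> D \<subseteq> Obj C \<and> J \<in> D
     \<and> (\<forall>A\<in>D. \<exists>!t. t \<in> hom C A J \<and> total C t)
     \<and> (\<forall>A\<in>D. \<forall>B\<in>D. \<forall>f\<in>hom C A B. f \<Zsemi>\<^bsub>C\<^esub> bang C J B = Rst C f \<Zsemi>\<^bsub>C\<^esub> bang C J A)"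

section \<open>Cartesian restriction categories\<close>

record ('o, 'a) crcat = "('o, 'a) rcat" +
  One :: 'o
  Prod :: "'o \<Rightarrow> 'o \<Rightarrow> 'o"  (infixr "\<otimes>\<index>" 75)
  Proj0 :: "'o \<Rightarrow> 'o \<Rightarrow> 'a"
  Proj1 :: "'o \<Rightarrow> 'o \<Rightarrow> 'a"

definition prod_span :: "('o, 'a, 'z) crcat_scheme \<Rightarrow> 'o \<Rightarrow> 'o \<Rightarrow> ('o, 'a) span" where
  "prod_span C A B = \<lparr>apex = Prod C A B, pr0 = Proj0 C A B, pr1 = Proj1 C A B\<rparr>"

locale cartesian_restriction_category = restriction_category C
  for C :: "('o, 'a, 'z) crcat_scheme" (structure) +
  assumes terminal: "restriction_terminal_on C (Obj C) (One C)"
    and products: "A \<in> Obj C \<Longrightarrow> B \<in> Obj C \<Longrightarrow> restriction_product C A B (prod_span C A B)"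

locale cartesian_join_restriction_category =
  cartesian_restriction_category C + join_restriction_category C
  for C :: "('o, 'a, 'z) crcat_scheme" (structure)

definition cpair :: "('o, 'a, 'z) crcat_scheme \<Rightarrow> 'a \<Rightarrow> 'a \<Rightarrow> 'a"  ("\<langle>_,/ _\<rangle>\<index>") where
  "cpair C f g = pair C (prod_span C (Cod C f) (Cod C g)) f g"

definition ctimes :: "('o, 'a, 'z) crcat_scheme \<Rightarrow> 'a \<Rightarrow> 'a \<Rightarrow> 'a"  (infixr "\<times>\<times>\<index>" 75) where
  "ctimes C f g = cpair C (Proj0 C (Dom C f) (Dom C g) \<Zsemi>\<^bsub>C\<^esub> f) (Proj1 C (Dom C f) (Dom C g) \<Zsemi>\<^bsub>C\<^esub> g)"

definition cassoc :: "('o, 'a, 'z) crcat_scheme \<Rightarrow> 'o \<Rightarrow> 'o \<Rightarrow> 'o \<Rightarrow> 'a" where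
  "cassoc C A B D =
     (let p = Proj0 C (Prod C A B) D in
      cpair C (p \<Zsemi>\<^bsub>C\<^esub> Proj0 C A B)
              (cpair C (p \<Zsemi>\<^bsub>C\<^esub> Proj1 C A B) (Proj1 C (Prod C A B) D)))"

section \<open>Group objects, actions and torsors in a restriction category\<close>

text \<open>The category need not have all products, so those that occur are arguments: \<open>HH\<close> and \<open>HHH\<close>
  are the products of \<open>H\<close> with \<open>H\<close> and of \<open>apex HH\<close> with \<open>H\<close>; \<open>J\<close> is the empty product.

  The object \<open>J\<close> is only required to be restriction terminal for the objects having a total map
  to it. In a category with a restriction terminal object \<open>J\<close> these are all the objects. In the
  slice over \<open>M\<close> they are the objects whose structure map is total; an object whose structure map
  is not total has no total map to \<open>(M, 1)\<close>, so the slice has no restriction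
  terminal object in the unrelativised sense.\<close>

definition supported :: "('o, 'a, 'z) rcat_scheme \<Rightarrow> 'o \<Rightarrow> 'o set" where
  "supported C J = {A \<in> Obj C. \<exists>t \<in> hom C A J. total C t}"

locale group_object = restriction_category C
  for C :: "('o, 'a, 'z) rcat_scheme" (structure) +
  fixes J :: 'o and H :: 'o and HH :: "('o, 'a) span" and HHH :: "('o, 'a) span"
    and m :: 'a and u :: 'a and \<iota> :: 'a
  assumes unit_terminal: "restriction_terminal_on C (supported C J) J"
    and H_supported: "H \<in> supported C J"
    and HH_product: "restriction_product C H H HH"
    and HHH_product: "restriction_product C (apex HH) H HHH"
    and m_hom: "m \<in> hom C (apex HH) H"
    and u_hom: "u \<in> hom C J H"
    and inv_hom: "\<iota> \<in> hom C H H"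
    and m_assoc:
      "pair C HH (pr0 HHH \<Zsemi> m) (pr1 HHH) \<Zsemi> m =
       pair C HH (pr0 HHH \<Zsemi> pr0 HH) (pair C HH (pr0 HHH \<Zsemi> pr1 HH) (pr1 HHH) \<Zsemi> m) \<Zsemi> m"
    and unit_left: "pair C HH (bang C J H \<Zsemi> u) (Id C H) \<Zsemi> m = Id C H"
    and unit_right: "pair C HH (Id C H) (bang C J H \<Zsemi> u) \<Zsemi> m = Id C H"
    and inv_left: "pair C HH \<iota> (Id C H) \<Zsemi> m = bang C J H \<Zsemi> u"
    and inv_right: "pair C HH (Id C H) \<iota> \<Zsemi> m = bang C J H \<Zsemi> u"

text \<open>\<open>TH\<close> and \<open>THH\<close> are the products of \<open>T\<close> with \<open>H\<close> and of \<open>apex TH\<close> with \<open>H\<close>.\<close>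

locale right_action = group_object +
  fixes T :: 'a and TH :: "('a, 'b) span" and THH :: "('a, 'b) span" and a :: 'b
  assumes T_supported: "T \<in> supported C J"
    and TH_product: "restriction_product C T H TH"
    and THH_product: "restriction_product C (apex TH) H THH"
    and act_hom: "a \<in> hom C (apex TH) T"
    and act_mult:
      "pair C TH (pr0 THH \<Zsemi> a) (pr1 THH) \<Zsemi> a =
       pair C TH (pr0 THH \<Zsemi> pr0 TH) (pair C HH (pr0 THH \<Zsemi> pr1 TH) (pr1 THH) \<Zsemi> m) \<Zsemi> a"
    and act_unit: "pair C TH (Id C T) (bang C J T \<Zsemi> u) \<Zsemi> a = Id C T"

locale total_right_torsor = right_action +
  fixes TT :: "('a, 'b) span"
  assumes TT_product: "restriction_product C T T TT"
    and torsor: "\<exists>d. total_inverse C (pair C TT (pr0 TH) a) d"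

abbreviation cgroup_object ::
    "('o, 'a, 'z) crcat_scheme \<Rightarrow> 'o \<Rightarrow> 'a \<Rightarrow> 'a \<Rightarrow> 'a \<Rightarrow> bool" where
  "cgroup_object C G m u \<iota> \<equiv>
     group_object C (One C) G (prod_span C G G) (prod_span C (Prod C G G) G) m u \<iota>"

section \<open>Fibre bundles and principal bundles\<close>

locale fibre_bundle = cartesian_join_restriction_category C
  for C :: "('o, 'a, 'z) crcat_scheme" (structure) +
  fixes F :: 'o and E :: 'o and M :: 'o and q :: 'a
    and I :: "'i set" and \<alpha> :: "'i \<Rightarrow> 'a" and e :: "'i \<Rightarrow> 'a"
  assumes F_obj: "F \<in> Obj C"
    and q_hom: "q \<in> hom C E M"
    and q_total: "total C q"
    and chart_hom: "i \<in> I \<Longrightarrow> \<alpha> i \<in> hom C E (M \<otimes> F)"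
    and chart_iso: "i \<in> I \<Longrightarrow> partial_iso C (\<alpha> i)"
    and chart_over: "i \<in> I \<Longrightarrow> \<alpha> i \<Zsemi> Proj0 C M F = \<rho> (\<alpha> i) \<Zsemi> q"
    and charts_cover: "is_join C E E ((\<lambda>i. \<rho> (\<alpha> i)) ` I) (Id C E)"
    and e_hom: "i \<in> I \<Longrightarrow> e i \<in> hom C M M"
    and e_idem: "i \<in> I \<Longrightarrow> restriction_idempotent C (e i)"
    and chart_range: "i \<in> I \<Longrightarrow> \<rho> (pinv C (\<alpha> i)) = e i \<times>\<times> Id C F"

locale totally_fibred = fibre_bundle +
  assumes total_fibres: "i \<in> I \<Longrightarrow> \<rho> (\<alpha> i) = \<rho> (q \<Zsemi> e i)"

locale group_atlas = cartesian_restriction_category C + group_object C "One C" G "prod_span C G G"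
    "prod_span C (G \<otimes> G) G" m u \<iota>
  for C :: "('o, 'a, 'z) crcat_scheme" (structure) and G m u \<iota> +
  fixes M :: 'o and I :: "'i set" and \<tau> :: "'i \<Rightarrow> 'i \<Rightarrow> 'a"
  assumes M_obj: "M \<in> Obj C"
    and atlas_hom: "i \<in> I \<Longrightarrow> j \<in> I \<Longrightarrow> \<tau> i j \<in> hom C M G"
    and atlas_comp: "i \<in> I \<Longrightarrow> j \<in> I \<Longrightarrow> k \<in> I \<Longrightarrow> rle C (\<langle>\<tau> i j, \<tau> j k\<rangle> \<Zsemi> m) (\<tau> i k)"
    and atlas_unit: "i \<in> I \<Longrightarrow> rle C (\<tau> i i) (bang C (One C) M \<Zsemi> u)"
    and atlas_inv: "i \<in> I \<Longrightarrow> j \<in> I \<Longrightarrow> \<tau> j i = \<tau> i j \<Zsemi> \<iota>"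

locale principal_bundle = fibre_bundle C G P M q I \<alpha> e + group_atlas C G m u \<iota> M I \<tau>
  for C :: "('o, 'a, 'z) crcat_scheme" (structure)
    and G m u \<iota> P M q and I :: "'i set" and \<alpha> e \<tau> +
  assumes transition: "i \<in> I \<Longrightarrow> j \<in> I \<Longrightarrow>
      pinv C (\<alpha> i) \<Zsemi> \<alpha> j
        = \<langle>Proj0 C M G, \<langle>Proj0 C M G \<Zsemi> \<tau> j i, Proj1 C M G\<rangle> \<Zsemi> m\<rangle>"

section \<open>The restriction slice category\<close>

text \<open>A morphism carries its source and target, since the same map of \<open>C\<close> may underlie several.
  Structure maps may be partial.\<close>

definition slice ::
    "('o, 'a, 'z) rcat_scheme \<Rightarrow> 'o \<Rightarrow> ('o \<times> 'a, ('o \<times> 'a) \<times> 'a \<times> ('o \<times> 'a)) rcat" where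
  "slice C M =
    \<lparr>Obj = {(A, f). f \<in> hom C A M},
     Arr = {((A, f), \<phi>, (B, g)) | A f \<phi> B g.
              f \<in> hom C A M \<and> g \<in> hom C B M \<and> \<phi> \<in> hom C A B \<and> rle C (\<phi> \<Zsemi>\<^bsub>C\<^esub> g) f},
     Dom = (\<lambda>(x, \<phi>, y). x),
     Cod = (\<lambda>(x, \<phi>, y). y),
     Id = (\<lambda>x. (x, Id C (fst x), x)),
     Comp = (\<lambda>(x, \<phi>, y) (y', \<psi>, z). (x, \<phi> \<Zsemi>\<^bsub>C\<^esub> \<psi>, z)),
     Rst = (\<lambda>(x, \<phi>, y). (x, Rst C \<phi>, x))\<rparr>"

text \<open>A span \<open>K\<close> in \<open>C\<close> on the objects underlying \<open>x\<close> and \<open>y\<close>, viewed in the slice: the structure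
  map of the apex is that of \<open>x\<close> composed with the first leg.\<close>

definition slice_span ::
    "('o, 'a, 'z) rcat_scheme \<Rightarrow> ('o, 'a) span \<Rightarrow> 'o \<times> 'a \<Rightarrow> 'o \<times> 'a
      \<Rightarrow> ('o \<times> 'a, ('o \<times> 'a) \<times> 'a \<times> ('o \<times> 'a)) span" where
  "slice_span C K x y =
     (let w = (apex K, pr0 K \<Zsemi>\<^bsub>C\<^esub> snd x) in \<lparr>apex = w, pr0 = (w, pr0 K, x), pr1 = (w, pr1 K, y)\<rparr>)"

text \<open>For an object \<open>A\<close>, the object \<open>(M \<otimes> A, \<pi>\<^sub>0)\<close> of the slice. On \<open>G\<close> this carries the group
  object with operations \<open>1 \<times> m\<close>, \<open>1 \<times> u\<close>, \<open>1 \<times> \<iota>\<close>; its powers are taken to be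
  \<open>M \<otimes> One\<close>, \<open>M \<otimes> (G \<otimes> G)\<close> and \<open>M \<otimes> ((G \<otimes> G) \<otimes> G)\<close>.\<close>

definition triv :: "('o, 'a, 'z) crcat_scheme \<Rightarrow> 'o \<Rightarrow> 'o \<Rightarrow> 'o \<times> 'a" where
  "triv C M A = (Prod C M A, Proj0 C M A)"

definition triv_map ::
    "('o, 'a, 'z) crcat_scheme \<Rightarrow> 'o \<Rightarrow> 'a \<Rightarrow> ('o \<times> 'a) \<times> 'a \<times> ('o \<times> 'a)" where
  "triv_map C M f = (triv C M (Dom C f), ctimes C (Id C M) f, triv C M (Cod C f))"

definition triv_span :: "('o, 'a, 'z) crcat_scheme \<Rightarrow> 'o \<Rightarrow> 'o \<Rightarrow> 'o
      \<Rightarrow> ('o \<times> 'a, ('o \<times> 'a) \<times> 'a \<times> ('o \<times> 'a)) span" where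
  "triv_span C M A B =
     \<lparr>apex = triv C M (Prod C A B),
      pr0 = triv_map C M (Proj0 C A B),
      pr1 = triv_map C M (Proj1 C A B)\<rparr>"

text \<open>The product of \<open>(A, f)\<close> with \<open>(M \<otimes> G, \<pi>\<^sub>0)\<close> in the slice is the pullback of \<open>f\<close> along
  \<open>\<pi>\<^sub>0\<close>, realised as \<open>A \<otimes> G\<close> with projections \<open>\<pi>\<^sub>0\<close> and \<open>f \<times> 1\<close>.\<close>

definition times_triv :: "('o, 'a, 'z) crcat_scheme \<Rightarrow> 'o \<Rightarrow> 'o \<Rightarrow> 'o \<times> 'a
      \<Rightarrow> ('o \<times> 'a, ('o \<times> 'a) \<times> 'a \<times> ('o \<times> 'a)) span" where
  "times_triv C M G x = slice_span C
     \<lparr>apex = Prod C (fst x) G, pr0 = Proj0 C (fst x) G, pr1 = ctimes C (snd x) (Id C G)\<rparr>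
     x (triv C M G)"

section \<open>The action of the group on a principal bundle, and the division map\<close>

text \<open>In the formulas for the \<open>i\<close>-th terms, \<open>M \<times> G \<times> G\<close> is \<open>(M \<otimes> G) \<otimes> G\<close>; an associator is
  inserted before \<open>1 \<times> m\<close>.\<close>

definition action_part :: "('o, 'a, 'z) crcat_scheme \<Rightarrow> 'o \<Rightarrow> 'a \<Rightarrow> 'o \<Rightarrow> 'a \<Rightarrow> 'a" where
  "action_part C G m M ai =
     ctimes C ai (Id C G) \<Zsemi>\<^bsub>C\<^esub> (cassoc C M G G \<Zsemi>\<^bsub>C\<^esub> ctimes C (Id C M) m) \<Zsemi>\<^bsub>C\<^esub> pinv C ai"

definition bundle_action ::
    "('o, 'a, 'z) crcat_scheme \<Rightarrow> 'o \<Rightarrow> 'a \<Rightarrow> 'o \<Rightarrow> 'o \<Rightarrow> 'i set \<Rightarrow> ('i \<Rightarrow> 'a) \<Rightarrow> 'a" where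
  "bundle_action C G m P M I \<alpha> =
     join C (Prod C P G) P ((\<lambda>i. action_part C G m M (\<alpha> i)) ` I)"

text \<open>The isomorphism \<open>(M \<otimes> G) \<otimes>\<^sub>M (M \<otimes> G) \<cong> (M \<otimes> G) \<otimes> G\<close>: the object on the right with its
  two projections to \<open>M \<otimes> G\<close>.\<close>

definition triv_pullback :: "('o, 'a, 'z) crcat_scheme \<Rightarrow> 'o \<Rightarrow> 'o \<Rightarrow> ('o, 'a) span" where
  "triv_pullback C M G =
     (let p = Proj0 C (Prod C M G) G in
      \<lparr>apex = Prod C (Prod C M G) G,
       pr0 = p,
       pr1 = cpair C (p \<Zsemi>\<^bsub>C\<^esub> Proj0 C M G) (Proj1 C (Prod C M G) G)\<rparr>)"

definition division_part ::
    "('o, 'a, 'z) crcat_scheme \<Rightarrow> 'o \<Rightarrow> 'a \<Rightarrow> 'a \<Rightarrow> 'o \<Rightarrow> ('o, 'a) span \<Rightarrow> 'a \<Rightarrow> 'a" where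
  "division_part C G m \<iota> M PP ai =
     (let \<pi>0 = Proj0 C (Prod C M G) G \<Zsemi>\<^bsub>C\<^esub> Proj0 C M G;
          \<pi>1 = Proj0 C (Prod C M G) G \<Zsemi>\<^bsub>C\<^esub> Proj1 C M G;
          \<pi>2 = Proj1 C (Prod C M G) G
      in pair C (triv_pullback C M G) (pr0 PP \<Zsemi>\<^bsub>C\<^esub> ai) (pr1 PP \<Zsemi>\<^bsub>C\<^esub> ai)
         \<Zsemi>\<^bsub>C\<^esub> cpair C (cpair C \<pi>0 \<pi>1) (cpair C (\<pi>1 \<Zsemi>\<^bsub>C\<^esub> \<iota>) \<pi>2 \<Zsemi>\<^bsub>C\<^esub> m)
         \<Zsemi>\<^bsub>C\<^esub> ctimes C (pinv C ai) (Id C G))"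

definition bundle_division :: "('o, 'a, 'z) crcat_scheme \<Rightarrow> 'o \<Rightarrow> 'a \<Rightarrow> 'a \<Rightarrow> 'o \<Rightarrow> 'o
      \<Rightarrow> ('o, 'a) span \<Rightarrow> 'i set \<Rightarrow> ('i \<Rightarrow> 'a) \<Rightarrow> 'a" where
  "bundle_division C G m \<iota> P M PP I \<alpha> =
     join C (apex PP) (Prod C P G) ((\<lambda>i. division_part C G m \<iota> M PP (\<alpha> i)) ` I)"

end

theory Submission
  imports Defs
begin

text \<open>Maps are studied through generalized elements. An element of \<open>A\<close> is a map \<open>x\<close> with codomain \<open>A\<close>;
  its domain of definition is \<open>\<rho> x\<close>, a map \<open>f\<close> is evaluated at it by \<open>x \<Zsemi> f\<close>, and \<open>f\<close> is defined at
  \<open>x\<close> if \<open>\<rho> (x \<Zsemi> f) = \<rho> x\<close>. Elements sharing one domain of definition behave like elements of sets: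
  their pairings have strict projections, and if a group object has total operations, its elements
  form an ordinary group. Equations about the bundle become computations with group elements.

  If the \<open>i\<close>-th chart is defined at a point \<open>p\<close> of \<open>P\<close>, it gives \<open>p\<close> a fibre coordinate \<open>h\<close> in \<open>G\<close>, and
  \<open>p\<close> is determined by \<open>h\<close> and its base point (\<open>fibre_eqI\<close>). The \<open>i\<close>-th part of the action replaces
  \<open>h\<close> by \<open>h g\<close> (\<open>action_part_chart\<close>). This is possible because the range of a chart is a product
  \<open>e i \<times>\<times> Id C G\<close>. Another chart replaces \<open>h\<close> by \<open>t h\<close>, with \<open>t\<close> depending on the base point only
  (\<open>chart_transition\<close>), and \<open>(t h) g = t (h g)\<close>, so the parts agree where both are defined and have a
  join. Since the bundle is totally fibred, a chart defined at \<open>p\<close> is also defined at every other point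
  \<open>p'\<close> of the same fibre (\<open>chart_domain\<close>). If \<open>h'\<close> is the fibre coordinate of \<open>p'\<close>, the \<open>i\<close>-th part of
  the division sends \<open>(p, p')\<close> to \<open>(p, h\<^sup>-\<^sup>1 h')\<close>, and the cancellation laws \<open>h (h\<^sup>-\<^sup>1 h') = h'\<close> and
  \<open>h\<^sup>-\<^sup>1 (h g) = g\<close> say that over the chart it is inverse to \<open>d\<close> (\<open>action_of_division\<close>,
  \<open>division_of_action\<close>).

  The domains of the charts cover \<open>P\<close>, and two maps that agree on the members of a cover are equal
  (\<open>local_equality\<close>). This makes the chartwise statements global (\<open>chartwise_equality\<close>): \<open>r\<close> is a total
  action preserving the fibres, and the join of the division parts is a total inverse of \<open>d\<close>.

  For objects with total structure maps, products in the slice over \<open>M\<close> are pullbacks over \<open>M\<close>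
  (\<open>slice_product\<close>). Thus the product of \<open>P\<close> with itself in the slice is the given pullback, and the
  laws of the group object, the action and the torsor in the slice are equations in \<open>C\<close> between the
  underlying maps.\<close>

section \<open>Generalized elements\<close>

context restriction_category
begin

lemma in_hom: "f \<in> Arr C \<Longrightarrow> f \<in> hom C (Dom C f) (Cod C f)"
  by (simp add: hom_def)

lemma comp_in_hom:
  assumes "f \<in> Arr C" "g \<in> Arr C" "Cod C f = Dom C g"
  shows "f \<Zsemi> g \<in> hom C (Dom C f) (Cod C g)"
  using comp_hom[of f "Dom C f" "Cod C f" g "Cod C g"] assms by (simp add: hom_def)

lemma comp_typing [simp]:
  assumes "f \<in> Arr C" "g \<in> Arr C" "Cod C f = Dom C g"
  shows "f \<Zsemi> g \<in> Arr C" "Dom C (f \<Zsemi> g) = Dom C f" "Cod C (f \<Zsemi> g) = Cod C g"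
  using comp_in_hom[OF assms] by (simp_all add: hom_def)

lemma rst_typing [simp]:
  assumes "f \<in> Arr C"
  shows "\<rho> f \<in> Arr C" "Dom C (\<rho> f) = Dom C f" "Cod C (\<rho> f) = Dom C f"
  using rst_hom[OF in_hom[OF assms]] by (simp_all add: hom_def)

lemma Id_typing [simp]:
  assumes "A \<in> Obj C"
  shows "Id C A \<in> Arr C" "Dom C (Id C A) = A" "Cod C (Id C A) = A"
  using id_hom[OF assms] by (simp_all add: hom_def)

lemma Dom_Obj [simp]: "f \<in> Arr C \<Longrightarrow> Dom C f \<in> Obj C"
  by (rule dom_obj)

lemma Cod_Obj [simp]: "f \<in> Arr C \<Longrightarrow> Cod C f \<in> Obj C"
  by (rule cod_obj)

lemma Id_left [simp]: "f \<in> Arr C \<Longrightarrow> Dom C f = A \<Longrightarrow> Id C A \<Zsemi> f = f"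
  using id_left in_hom by blast

lemma Id_right [simp]: "f \<in> Arr C \<Longrightarrow> Cod C f = A \<Longrightarrow> f \<Zsemi> Id C A = f"
  using id_right in_hom by blast

text \<open>The left-nested normal form: reading \<open>x\<close> as a generalized element, \<open>x \<Zsemi> f \<Zsemi> g\<close> is
  \<open>g (f x)\<close>, so that \<open>f\<close> meets its argument before \<open>g\<close> does.\<close>

lemma comp_left_nest [simp]:
  "f \<in> Arr C \<Longrightarrow> g \<in> Arr C \<Longrightarrow> h \<in> Arr C \<Longrightarrow> Cod C f = Dom C g \<Longrightarrow> Cod C g = Dom C h
    \<Longrightarrow> f \<Zsemi> (g \<Zsemi> h) = f \<Zsemi> g \<Zsemi> h"
  using comp_assoc in_hom by metis

lemma rst_self [simp]: "f \<in> Arr C \<Longrightarrow> \<rho> f \<Zsemi> f = f"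
  using R1 in_hom by blast

lemma rst_commute:
  "f \<in> Arr C \<Longrightarrow> g \<in> Arr C \<Longrightarrow> Dom C f = Dom C g \<Longrightarrow> \<rho> f \<Zsemi> \<rho> g = \<rho> g \<Zsemi> \<rho> f"
  using R2 in_hom by metis

lemma rst_rst_comp [simp]:
  "f \<in> Arr C \<Longrightarrow> g \<in> Arr C \<Longrightarrow> Dom C f = Dom C g \<Longrightarrow> \<rho> (\<rho> f \<Zsemi> g) = \<rho> f \<Zsemi> \<rho> g"
  using R3 in_hom by metis

lemma comp_rst:
  "f \<in> Arr C \<Longrightarrow> h \<in> Arr C \<Longrightarrow> Cod C f = Dom C h \<Longrightarrow> f \<Zsemi> \<rho> h = \<rho> (f \<Zsemi> h) \<Zsemi> f"
  using R4 in_hom by metis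

lemma rst_Id [simp]: "A \<in> Obj C \<Longrightarrow> \<rho> (Id C A) = Id C A"
  using rst_self[of "Id C A"] by simp

lemma rst_rst [simp]:
  assumes "f \<in> Arr C"
  shows "\<rho> (\<rho> f) = \<rho> f"
proof -
  have "\<rho> (\<rho> f \<Zsemi> Id C (Dom C f)) = \<rho> f \<Zsemi> \<rho> (Id C (Dom C f))"
    using assms by (intro rst_rst_comp) simp_all
  then show ?thesis using assms by simp
qed

lemma rst_idem [simp]: "f \<in> Arr C \<Longrightarrow> \<rho> f \<Zsemi> \<rho> f = \<rho> f"
  using rst_self[of "\<rho> f"] by simp

lemma rst_comp_le:
  assumes "f \<in> Arr C" "g \<in> Arr C" "Cod C f = Dom C g"
  shows "\<rho> f \<Zsemi> \<rho> (f \<Zsemi> g) = \<rho> (f \<Zsemi> g)"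
proof -
  have "\<rho> (\<rho> f \<Zsemi> (f \<Zsemi> g)) = \<rho> f \<Zsemi> \<rho> (f \<Zsemi> g)"
    using assms by (intro rst_rst_comp) simp_all
  then show ?thesis using assms by simp
qed

lemma rst_comp_rst [simp]:
  assumes "f \<in> Arr C" "g \<in> Arr C" "Cod C f = Dom C g"
  shows "\<rho> (f \<Zsemi> \<rho> g) = \<rho> (f \<Zsemi> g)"
proof -
  have "\<rho> (f \<Zsemi> \<rho> g) = \<rho> (f \<Zsemi> g) \<Zsemi> \<rho> f"
    using assms comp_rst[OF assms] by simp
  also have "\<dots> = \<rho> (f \<Zsemi> g)"
    using assms rst_comp_le[OF assms] rst_commute[of f "f \<Zsemi> g"] by simp
  finally show ?thesis .
qed

lemma rst_comp_total [simp]: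
  assumes "total C g" "f \<in> Arr C" "g \<in> Arr C" "Cod C f = Dom C g"
  shows "\<rho> (f \<Zsemi> g) = \<rho> f"
  using rst_comp_rst[OF assms(2-4)] assms by (metis total_def Id_right)

lemma total_comp [simp]:
  "total C f \<Longrightarrow> total C g \<Longrightarrow> f \<in> Arr C \<Longrightarrow> g \<in> Arr C \<Longrightarrow> Cod C f = Dom C g \<Longrightarrow> total C (f \<Zsemi> g)"
  using rst_comp_total[of g f] by (simp add: total_def)

lemma total_Id [simp]: "A \<in> Obj C \<Longrightarrow> total C (Id C A)"
  by (simp add: total_def)

lemma rst_total: "total C f \<Longrightarrow> \<rho> f = Id C (Dom C f)"
  by (simp add: total_def)

text \<open>The restrictions \<open>\<rho> f\<close> and \<open>\<rho> g\<close> commute, and each of \<open>f\<close> and \<open>g\<close> is fixed by both of them.\<close>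

lemma rle_antisym:
  assumes "rle C f g" "rle C g f" "f \<in> Arr C" "g \<in> Arr C" "Dom C f = Dom C g"
  shows "f = g"
proof -
  have "f = \<rho> f \<Zsemi> (\<rho> g \<Zsemi> f)" using assms(1,2) by (simp add: rle_def)
  also have "\<dots> = \<rho> f \<Zsemi> \<rho> g \<Zsemi> f" using assms by (intro comp_left_nest) simp_all
  also have "\<dots> = \<rho> g \<Zsemi> \<rho> f \<Zsemi> f" using assms rst_commute[of f g] by simp
  also have "\<dots> = \<rho> g \<Zsemi> (\<rho> f \<Zsemi> f)" using assms by (intro comp_left_nest[symmetric]) simp_all
  also have "\<dots> = g" using assms by (simp add: rle_def)
  finally show ?thesis .
qed

text \<open>Evaluating a join at an element where one of its members is defined amounts to evaluating that
  member.\<close>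

lemma rle_apply:
  assumes "rle C f g" "\<rho> (x \<Zsemi> f) = \<rho> x" "x \<in> Arr C" "f \<in> Arr C" "g \<in> Arr C"
    "Cod C x = Dom C f" "Dom C g = Dom C f"
  shows "x \<Zsemi> g = x \<Zsemi> f"
proof -
  have "x \<Zsemi> f = x \<Zsemi> (\<rho> f \<Zsemi> g)" using assms(1) by (simp add: rle_def)
  also have "\<dots> = x \<Zsemi> \<rho> f \<Zsemi> g" using assms by (intro comp_left_nest) simp_all
  also have "\<dots> = \<rho> x \<Zsemi> x \<Zsemi> g" using assms comp_rst[of x f] by simp
  also have "\<dots> = x \<Zsemi> g" using assms by simp
  finally show ?thesis by simp
qed

lemma rle_trans:
  assumes "rle C f g" "rle C g h" "f \<in> Arr C" "g \<in> Arr C" "h \<in> Arr C" "Dom C f = Dom C g" "Dom C h = Dom C g"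
  shows "rle C f h"
proof -
  have "f = \<rho> f \<Zsemi> (\<rho> g \<Zsemi> h)" using assms(1,2) by (simp add: rle_def)
  also have "\<dots> = \<rho> f \<Zsemi> \<rho> g \<Zsemi> h" using assms by (intro comp_left_nest) simp_all
  also have "\<rho> f \<Zsemi> \<rho> g = \<rho> f"
    using assms(1,3,4,6) by (metis rle_def rst_rst_comp)
  finally show ?thesis by (simp add: rle_def)
qed

lemma rle_precomp:
  assumes "rle C f g" "x \<in> Arr C" "f \<in> Arr C" "g \<in> Arr C" "Cod C x = Dom C f" "Dom C f = Dom C g"
  shows "rle C (x \<Zsemi> f) (x \<Zsemi> g)"
proof -
  have "x \<Zsemi> f = x \<Zsemi> (\<rho> f \<Zsemi> g)" using assms(1) by (simp add: rle_def)
  also have "\<dots> = x \<Zsemi> \<rho> f \<Zsemi> g" using assms by (intro comp_left_nest) simp_all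
  also have "\<dots> = \<rho> (x \<Zsemi> f) \<Zsemi> (x \<Zsemi> g)" using assms comp_rst[of x f] by simp
  finally show ?thesis by (simp add: rle_def)
qed

text \<open>To compare two maps on the part of their source where both are defined, take that part as
  the element at which to evaluate them.\<close>

lemma compatible_by_elements:
  assumes "f \<in> Arr C" "g \<in> Arr C" "Dom C f = Dom C g"
    and "\<And>z. z \<in> Arr C \<Longrightarrow> Dom C z = Dom C f \<Longrightarrow> Cod C z = Dom C f \<Longrightarrow>
           \<rho> (z \<Zsemi> f) = \<rho> z \<Longrightarrow> \<rho> (z \<Zsemi> g) = \<rho> z \<Longrightarrow> z \<Zsemi> f = z \<Zsemi> g"
  shows "compatible C f g"
proof -
  \<comment> \<open>The common domain of definition of \<open>f\<close> and \<open>g\<close>.\<close>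
  let ?z = "\<rho> f \<Zsemi> \<rho> g"
  have c: "?z = \<rho> g \<Zsemi> \<rho> f" using assms rst_commute by metis
  have zg: "?z \<Zsemi> g = \<rho> f \<Zsemi> g"
    using assms comp_left_nest[of "\<rho> f" "\<rho> g" g] by simp
  have zf: "?z \<Zsemi> f = \<rho> g \<Zsemi> f"
    using assms c comp_left_nest[of "\<rho> g" "\<rho> f" f] by simp
  have z: "\<rho> ?z = ?z" using assms by simp
  have "?z \<Zsemi> f = ?z \<Zsemi> g"
  proof (rule assms(4))
    show "\<rho> (?z \<Zsemi> f) = \<rho> ?z" unfolding zf z using assms c by simp
    show "\<rho> (?z \<Zsemi> g) = \<rho> ?z" unfolding zg z using assms by simp
  qed (use assms in simp_all)
  then show ?thesis using zf zg by (simp add: compatible_def)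
qed

lemma partial_inverse_unique:
  assumes "partial_inverse C f g" "partial_inverse C f h" "f \<in> Arr C"
  shows "g = h"
proof -
  have t: "g \<in> Arr C" "Dom C g = Cod C f" "Cod C g = Dom C f"
       "h \<in> Arr C" "Dom C h = Cod C f" "Cod C h = Dom C f"
    and e: "f \<Zsemi> g = \<rho> f" "g \<Zsemi> f = \<rho> g" "f \<Zsemi> h = \<rho> f" "h \<Zsemi> f = \<rho> h"
    using assms by (simp_all add: partial_inverse_def hom_def)
  have gh: "rle C g' h'" if "g' \<Zsemi> f = \<rho> g'" "f \<Zsemi> h' = \<rho> f" "f \<Zsemi> g' = \<rho> f"
    "g' \<in> Arr C" "Dom C g' = Cod C f" "Cod C g' = Dom C f"
    "h' \<in> Arr C" "Dom C h' = Cod C f" "Cod C h' = Dom C f" for g' h'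
  proof -
    have "\<rho> g' \<Zsemi> h' = g' \<Zsemi> f \<Zsemi> h'" using that by simp
    also have "\<dots> = g' \<Zsemi> (f \<Zsemi> h')" using that assms(3) by (intro comp_left_nest[symmetric]) simp_all
    also have "\<dots> = g' \<Zsemi> (f \<Zsemi> g')" using that by simp
    also have "\<dots> = g' \<Zsemi> f \<Zsemi> g'" using that assms(3) by (intro comp_left_nest) simp_all
    also have "\<dots> = g'" using that by simp
    finally show ?thesis by (simp add: rle_def)
  qed
  show ?thesis
    by (rule rle_antisym) (use gh[of g h] gh[of h g] t e in auto)
qed

lemma pinv_inverse:
  assumes "partial_iso C f"
  shows "partial_inverse C f (pinv C f)"
  using assms partial_inverse_unique unfolding partial_iso_def pinv_def
  by (metis (mono_tags, lifting) theI)

lemma pinv_typing [simp]: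
  assumes "partial_iso C f"
  shows "pinv C f \<in> Arr C" "Dom C (pinv C f) = Cod C f" "Cod C (pinv C f) = Dom C f"
  using pinv_inverse[OF assms] by (simp_all add: partial_inverse_def hom_def)

lemma comp_pinv_cancel:
  assumes "partial_iso C f" "x \<in> Arr C" "Cod C x = Dom C f" "\<rho> (x \<Zsemi> f) = \<rho> x"
  shows "x \<Zsemi> f \<Zsemi> pinv C f = x"
proof -
  have f: "f \<in> Arr C" using assms by (simp add: partial_iso_def)
  have "x \<Zsemi> f \<Zsemi> pinv C f = x \<Zsemi> (f \<Zsemi> pinv C f)"
    using assms f by simp
  also have "\<dots> = x \<Zsemi> \<rho> f" using pinv_inverse[OF assms(1)] by (simp add: partial_inverse_def)
  also have "\<dots> = x" using assms f comp_rst[of x f] by simp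
  finally show ?thesis .
qed

lemma comp_pinv_cancel':
  assumes "partial_iso C f" "x \<in> Arr C" "Cod C x = Cod C f" "\<rho> (x \<Zsemi> pinv C f) = \<rho> x"
  shows "x \<Zsemi> pinv C f \<Zsemi> f = x"
proof -
  have f: "f \<in> Arr C" using assms by (simp add: partial_iso_def)
  have "x \<Zsemi> pinv C f \<Zsemi> f = x \<Zsemi> (pinv C f \<Zsemi> f)"
    using assms f by simp
  also have "\<dots> = x \<Zsemi> \<rho> (pinv C f)" using pinv_inverse[OF assms(1)] by (simp add: partial_inverse_def)
  also have "\<dots> = x" using assms f comp_rst[of x "pinv C f"] by simp
  finally show ?thesis .
qed

lemma partial_iso_cancel:
  assumes "partial_iso C f" "x \<Zsemi> f = y \<Zsemi> f" "\<rho> (x \<Zsemi> f) = \<rho> x" "\<rho> (y \<Zsemi> f) = \<rho> y"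
    "x \<in> Arr C" "y \<in> Arr C" "Cod C x = Dom C f" "Cod C y = Dom C f"
  shows "x = y"
  using comp_pinv_cancel[OF assms(1,5,7,3)] comp_pinv_cancel[OF assms(1,6,8,4)] assms(2) by metis

lemma rst_comp_le' [simp]:
  assumes "f \<in> Arr C" "g \<in> Arr C" "Cod C f = Dom C g"
  shows "\<rho> (f \<Zsemi> g) \<Zsemi> \<rho> f = \<rho> (f \<Zsemi> g)"
  using rst_comp_le[OF assms] rst_commute[of f "f \<Zsemi> g"] assms by simp

text \<open>A composite can only be defined where its initial part is defined.\<close>

lemma defined_prefix:
  assumes "\<rho> (x \<Zsemi> f \<Zsemi> g) = \<rho> x" "x \<in> Arr C" "f \<in> Arr C" "g \<in> Arr C"
    "Cod C x = Dom C f" "Cod C f = Dom C g"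
  shows "\<rho> (x \<Zsemi> f) = \<rho> x"
  using rst_comp_le'[of x f] rst_comp_le[of "x \<Zsemi> f" g] assms by simp

lemma pullback_ex1:
  assumes "restriction_pullback C f g K" "x \<in> Arr C" "y \<in> Arr C" "Dom C x = Dom C y"
    "Cod C x = Dom C f" "Cod C y = Dom C g" "x \<Zsemi> f = y \<Zsemi> g"
  shows "\<exists>!h. h \<in> hom C (Dom C x) (apex K) \<and> h \<Zsemi> pr0 K = x \<and> h \<Zsemi> pr1 K = y"
proof -
  have *: "\<forall>Z\<in>Obj C. \<forall>r\<in>hom C Z (Dom C f). \<forall>s\<in>hom C Z (Dom C g). r \<Zsemi> f = s \<Zsemi> g
          \<longrightarrow> (\<exists>!h. h \<in> hom C Z (apex K) \<and> h \<Zsemi> pr0 K = r \<and> h \<Zsemi> pr1 K = s)"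
    using assms(1) by (simp add: restriction_pullback_def)
  have "x \<in> hom C (Dom C x) (Dom C f)" "y \<in> hom C (Dom C x) (Dom C g)"
    using assms by (simp_all add: hom_def)
  from *[rule_format, OF Dom_Obj[OF assms(2)] this assms(7)] show ?thesis .
qed

lemma pullback_typing:
  assumes "restriction_pullback C f g K"
  shows "f \<in> Arr C" "g \<in> Arr C" "Cod C g = Cod C f" "total C f" "total C g" "apex K \<in> Obj C"
    "pr0 K \<in> Arr C" "Dom C (pr0 K) = apex K" "Cod C (pr0 K) = Dom C f" "total C (pr0 K)"
    "pr1 K \<in> Arr C" "Dom C (pr1 K) = apex K" "Cod C (pr1 K) = Dom C g" "total C (pr1 K)"
    "pr0 K \<Zsemi> f = pr1 K \<Zsemi> g"
  using assms by (simp_all add: restriction_pullback_def hom_def)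

lemma pullback_eqI:
  assumes "restriction_pullback C f g K" "x \<in> Arr C" "y \<in> Arr C" "Dom C x = Dom C y"
    "Cod C x = apex K" "Cod C y = apex K" "x \<Zsemi> pr0 K = y \<Zsemi> pr0 K" "x \<Zsemi> pr1 K = y \<Zsemi> pr1 K"
  shows "x = y"
proof -
  note pt = pullback_typing[OF assms(1)]
  have "y \<Zsemi> pr0 K \<Zsemi> f = y \<Zsemi> pr1 K \<Zsemi> g"
    using arg_cong[OF pt(15), of "\<lambda>t. y \<Zsemi> t"] pt(1-14) assms(2-6) by simp
  then have "\<exists>!h. h \<in> hom C (Dom C (y \<Zsemi> pr0 K)) (apex K) \<and> h \<Zsemi> pr0 K = y \<Zsemi> pr0 K \<and> h \<Zsemi> pr1 K = y \<Zsemi> pr1 K"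
    using pt(1-14) assms(2-6) by (intro pullback_ex1[OF assms(1)]) simp_all
  moreover have "x \<in> hom C (Dom C y) (apex K)" "y \<in> hom C (Dom C y) (apex K)"
    using assms by (simp_all add: hom_def)
  ultimately show ?thesis using pt(1-14) assms by auto
qed

text \<open>Pairings of partial maps into a pullback reduce to its universal property after both maps have
  been cut down to their common domain.\<close>

lemma pullback_pairing_ex1:
  assumes "restriction_pullback C f g K" "x \<in> Arr C" "y \<in> Arr C" "Dom C x = Dom C y"
    "Cod C x = Dom C f" "Cod C y = Dom C g"
    and agree: "\<rho> y \<Zsemi> x \<Zsemi> f = \<rho> x \<Zsemi> y \<Zsemi> g"
  shows "\<exists>!h. is_pairing C K x y h"
  using pullback_ex1[of f g K "\<rho> y \<Zsemi> x" "\<rho> x \<Zsemi> y"] assms by (simp add: is_pairing_def)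

lemma pullback_pair_eq:
  assumes "restriction_pullback C f g K" "x \<in> Arr C" "y \<in> Arr C" "Dom C x = Dom C y"
    "Cod C x = Dom C f" "Cod C y = Dom C g" "\<rho> x = \<rho> y" "x \<Zsemi> f = y \<Zsemi> g"
    "h \<in> hom C (Dom C x) (apex K)" "h \<Zsemi> pr0 K = x" "h \<Zsemi> pr1 K = y"
  shows "pair C K x y = h"
  unfolding pair_def
proof (rule the1_equality)
  have s: "\<rho> y \<Zsemi> x = x" "\<rho> x \<Zsemi> y = y" using rst_self[of x] rst_self[of y] assms by simp_all
  show "\<exists>!h. is_pairing C K x y h" by (rule pullback_pairing_ex1[OF assms(1-6)]) (use s assms in simp)
  show "is_pairing C K x y h" using assms s by (simp add: is_pairing_def)
qed

end

section \<open>Joins and local equality\<close>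

context join_restriction_category
begin

lemma is_join_unique:
  "is_join C A B S s \<Longrightarrow> is_join C A B S t \<Longrightarrow> s = t"
  by (rule rle_antisym) (auto simp: is_join_def hom_def)

lemma join_eq: "is_join C A B S s \<Longrightarrow> join C A B S = s"
  unfolding join_def using is_join_unique by blast

lemma is_join_join:
  assumes "A \<in> Obj C" "B \<in> Obj C" "S \<subseteq> hom C A B"
    "\<And>f g. f \<in> S \<Longrightarrow> g \<in> S \<Longrightarrow> compatible C f g"
  shows "is_join C A B S (join C A B S)"
proof -
  have "\<forall>f\<in>S. \<forall>g\<in>S. compatible C f g" using assms(4) by blast
  from join_exists[OF assms(1-3) this] show ?thesis using join_eq by blast
qed

lemma local_restriction:
  assumes "is_join C A A E (Id C A)" "f \<in> hom C A B"
  shows "is_join C A A ((\<lambda>c. \<rho> f \<Zsemi> c) ` E) (\<rho> f)"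
  using join_comp[of "\<rho> f" A A A E "Id C A"] assms by (simp add: hom_def)

text \<open>The axioms say that joins are preserved when another map is composed in front of them, while
  here \<open>f\<close> is composed behind. The restrictions of \<open>f\<close> to the cover are compatible, so they have a
  join \<open>j\<close>; it is below \<open>f\<close>, and it equals \<open>f\<close> because its domain is the join of the domains
  \<open>\<rho> f \<Zsemi> c\<close>, which is \<open>\<rho> f\<close>.\<close>

lemma is_join_of_restrictions:
  assumes E: "is_join C A A E (Id C A)" "\<And>c. c \<in> E \<Longrightarrow> \<rho> c = c" and f: "f \<in> hom C A B"
  shows "is_join C A B ((\<lambda>c. c \<Zsemi> f) ` E) f"
proof -
  have f': "f \<in> Arr C" "Dom C f = A" "Cod C f = B" using f by (simp_all add: hom_def)
  have c: "c \<in> Arr C" "Dom C c = A" "Cod C c = A" "\<rho> c = c" if "c \<in> E" for c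
    using E that by (auto simp: is_join_def hom_def)
  have rc: "\<rho> (c \<Zsemi> f) = c \<Zsemi> \<rho> f" if "c \<in> E" for c
    using rst_rst_comp[of c f] c[OF that] f' by simp
  have le: "rle C (c \<Zsemi> f) f" if "c \<in> E" for c
  proof -
    have "\<rho> (c \<Zsemi> f) \<Zsemi> f = c \<Zsemi> (\<rho> f \<Zsemi> f)"
      unfolding rc[OF that] using c[OF that] f' by (intro comp_left_nest[symmetric]) simp_all
    then show ?thesis using f' by (simp add: rle_def)
  qed
  have "is_join C A B ((\<lambda>c. c \<Zsemi> f) ` E) (join C A B ((\<lambda>c. c \<Zsemi> f) ` E))"
  proof (rule is_join_join)
    show "A \<in> Obj C" "B \<in> Obj C" using f' by auto
    show "(\<lambda>c. c \<Zsemi> f) ` E \<subseteq> hom C A B" using c f' by (auto simp: hom_def)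
    fix x y assume "x \<in> (\<lambda>c. c \<Zsemi> f) ` E" "y \<in> (\<lambda>c. c \<Zsemi> f) ` E"
    then obtain c1 c2 where x: "x = c1 \<Zsemi> f" "y = c2 \<Zsemi> f" "c1 \<in> E" "c2 \<in> E" by blast
    note C = c[OF x(3)] c[OF x(4)]
    have "\<rho> (x' \<Zsemi> f) \<Zsemi> (y' \<Zsemi> f) = x' \<Zsemi> y' \<Zsemi> f" if "x' \<in> E" "y' \<in> E" for x' y'
    proof -
      note C = c[OF that(1)] c[OF that(2)]
      have "\<rho> (x' \<Zsemi> f) \<Zsemi> (y' \<Zsemi> f) = x' \<Zsemi> (\<rho> f \<Zsemi> \<rho> y') \<Zsemi> f" unfolding rc[OF that(1)] using C f' by simp
      also have "\<rho> f \<Zsemi> \<rho> y' = y' \<Zsemi> \<rho> f" using rst_commute[of f y'] C f' by simp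
      also have "x' \<Zsemi> (y' \<Zsemi> \<rho> f) \<Zsemi> f = x' \<Zsemi> y' \<Zsemi> (\<rho> f \<Zsemi> f)"
        using C f' by (simp del: rst_self)
      finally show ?thesis using f' by simp
    qed
    from this[OF x(3,4)] this[OF x(4,3)] show "compatible C x y"
      using rst_commute[of c1 c2] C by (simp add: compatible_def x)
  qed
  then obtain j where j: "is_join C A B ((\<lambda>c. c \<Zsemi> f) ` E) j" by blast
  then have jt: "j \<in> Arr C" "Dom C j = A" "Cod C j = B" by (auto simp: is_join_def hom_def)
  have "rle C j f" using j f le by (auto simp: is_join_def)
  have "is_join C A A (\<rho> ` (\<lambda>c. c \<Zsemi> f) ` E) (\<rho> j)" by (rule join_rst[OF j])
  moreover have "\<rho> ` (\<lambda>c. c \<Zsemi> f) ` E = (\<lambda>c. \<rho> f \<Zsemi> c) ` E"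
    unfolding image_image
  proof (rule image_cong[OF refl])
    fix c' assume "c' \<in> E"
    from rc[OF this] c[OF this] rst_commute[of c' f] f'
    show "\<rho> (c' \<Zsemi> f) = \<rho> f \<Zsemi> c'" by simp
  qed
  ultimately have "\<rho> j = \<rho> f"
    using is_join_unique local_restriction[OF E(1) f] by metis
  with \<open>rle C j f\<close> f' have "j = f" by (simp add: rle_def)
  with j show ?thesis by simp
qed

text \<open>By \<open>is_join_of_restrictions\<close> both maps are the join of one and the same family.\<close>

lemma local_equality:
  assumes "is_join C A A E (Id C A)" "\<And>c. c \<in> E \<Longrightarrow> \<rho> c = c" "f \<in> hom C A B" "g \<in> hom C A B"
    and "\<And>c. c \<in> E \<Longrightarrow> c \<Zsemi> f = c \<Zsemi> g"
  shows "f = g"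
proof -
  have "(\<lambda>c. c \<Zsemi> f) ` E = (\<lambda>c. c \<Zsemi> g) ` E" using assms(5) by (rule image_cong[OF refl])
  then show ?thesis
    using is_join_of_restrictions[OF assms(1-3)] is_join_of_restrictions[OF assms(1,2,4)]
      is_join_unique by metis
qed

end

section \<open>Pairing of elements\<close>

context cartesian_restriction_category
begin

lemma proj_typing [simp]:
  assumes "A \<in> Obj C" "B \<in> Obj C"
  shows "Proj0 C A B \<in> Arr C" "Dom C (Proj0 C A B) = A \<otimes> B" "Cod C (Proj0 C A B) = A"
    "Proj1 C A B \<in> Arr C" "Dom C (Proj1 C A B) = A \<otimes> B" "Cod C (Proj1 C A B) = B"
    "total C (Proj0 C A B)" "total C (Proj1 C A B)" "A \<otimes> B \<in> Obj C"
  using products[OF assms] by (simp_all add: restriction_product_def prod_span_def hom_def)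

lemma pairing_unique:
  assumes "f \<in> Arr C" "g \<in> Arr C" "Dom C f = Dom C g" "Cod C f = A" "Cod C g = B"
  shows "\<exists>!h. is_pairing C (prod_span C A B) f g h"
  using products[of A B] assms unfolding restriction_product_def
  by (metis cod_obj dom_obj in_hom)

lemma cpair_is_pairing:
  assumes "f \<in> Arr C" "g \<in> Arr C" "Dom C f = Dom C g"
  shows "is_pairing C (prod_span C (Cod C f) (Cod C g)) f g \<langle>f, g\<rangle>"
  unfolding cpair_def pair_def
  by (rule theI') (rule pairing_unique[OF assms refl refl])

lemma cpair_typing [simp]:
  assumes "f \<in> Arr C" "g \<in> Arr C" "Dom C f = Dom C g"
  shows "\<langle>f, g\<rangle> \<in> Arr C" "Dom C \<langle>f, g\<rangle> = Dom C f" "Cod C \<langle>f, g\<rangle> = Cod C f \<otimes> Cod C g"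
  using cpair_is_pairing[OF assms] by (simp_all add: is_pairing_def hom_def prod_span_def)

lemma cpair_proj:
  assumes "f \<in> Arr C" "g \<in> Arr C" "Dom C f = Dom C g" "Cod C f = A" "Cod C g = B"
  shows "\<langle>f, g\<rangle> \<Zsemi> Proj0 C A B = \<rho> g \<Zsemi> f" "\<langle>f, g\<rangle> \<Zsemi> Proj1 C A B = \<rho> f \<Zsemi> g"
  using cpair_is_pairing[of f g] assms by (auto simp: is_pairing_def prod_span_def)

text \<open>For elements with the same domain of definition the projections of a pair are strict,
  so that pairs of such elements compute like pairs in sets.\<close>

lemma cpair_proj_same [simp]:
  assumes "f \<in> Arr C" "g \<in> Arr C" "Dom C f = Dom C g" "\<rho> f = \<rho> g" "Cod C f = A" "Cod C g = B"
  shows "\<langle>f, g\<rangle> \<Zsemi> Proj0 C A B = f" "\<langle>f, g\<rangle> \<Zsemi> Proj1 C A B = g"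
  using cpair_proj[OF assms(1,2,3,5,6)] assms rst_self by metis+

lemma cpair_eqI:
  assumes "f \<in> Arr C" "g \<in> Arr C" "Dom C f = Dom C g" "Cod C f = A" "Cod C g = B"
    and "h \<in> Arr C" "Dom C h = Dom C f" "Cod C h = A \<otimes> B"
    and "h \<Zsemi> Proj0 C A B = \<rho> g \<Zsemi> f" "h \<Zsemi> Proj1 C A B = \<rho> f \<Zsemi> g"
  shows "h = \<langle>f, g\<rangle>"
proof -
  have "is_pairing C (prod_span C A B) f g h"
    using assms by (simp add: is_pairing_def prod_span_def hom_def)
  then show ?thesis
    using pairing_unique[OF assms(1-5)] cpair_is_pairing[OF assms(1-3)] assms(4,5) by metis
qed

lemma rst_cpair [simp]:
  assumes "f \<in> Arr C" "g \<in> Arr C" "Dom C f = Dom C g"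
  shows "\<rho> \<langle>f, g\<rangle> = \<rho> f \<Zsemi> \<rho> g"
proof -
  have "\<rho> \<langle>f, g\<rangle> = \<rho> (\<langle>f, g\<rangle> \<Zsemi> Proj0 C (Cod C f) (Cod C g))"
    using assms by (subst rst_comp_total) simp_all
  also have "\<dots> = \<rho> g \<Zsemi> \<rho> f" using assms by (simp add: cpair_proj)
  finally show ?thesis using assms rst_commute by metis
qed

lemma comp_cpair [simp]:
  assumes "f \<in> Arr C" "g \<in> Arr C" "Dom C f = Dom C g" "x \<in> Arr C" "Cod C x = Dom C g"
  shows "x \<Zsemi> \<langle>f, g\<rangle> = \<langle>x \<Zsemi> f, x \<Zsemi> g\<rangle>"
proof (rule cpair_eqI)
  show "x \<Zsemi> \<langle>f, g\<rangle> \<Zsemi> Proj0 C (Cod C f) (Cod C g) = \<rho> (x \<Zsemi> g) \<Zsemi> (x \<Zsemi> f)"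
  proof -
    have "x \<Zsemi> \<langle>f, g\<rangle> \<Zsemi> Proj0 C (Cod C f) (Cod C g) = x \<Zsemi> (\<langle>f, g\<rangle> \<Zsemi> Proj0 C (Cod C f) (Cod C g))"
      using assms by (intro comp_left_nest[symmetric]) simp_all
    also have "\<dots> = x \<Zsemi> \<rho> g \<Zsemi> f" using assms by (simp add: cpair_proj)
    finally show ?thesis using assms by (simp add: comp_rst)
  qed
  show "x \<Zsemi> \<langle>f, g\<rangle> \<Zsemi> Proj1 C (Cod C f) (Cod C g) = \<rho> (x \<Zsemi> f) \<Zsemi> (x \<Zsemi> g)"
  proof -
    have "x \<Zsemi> \<langle>f, g\<rangle> \<Zsemi> Proj1 C (Cod C f) (Cod C g) = x \<Zsemi> (\<langle>f, g\<rangle> \<Zsemi> Proj1 C (Cod C f) (Cod C g))"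
      using assms by (intro comp_left_nest[symmetric]) simp_all
    also have "\<dots> = x \<Zsemi> \<rho> f \<Zsemi> g" using assms by (simp add: cpair_proj)
    finally show ?thesis using assms by (simp add: comp_rst)
  qed
qed (use assms in simp_all)

lemma cpair_eta:
  assumes "x \<in> Arr C" "Cod C x = A \<otimes> B" "A \<in> Obj C" "B \<in> Obj C"
  shows "\<langle>x \<Zsemi> Proj0 C A B, x \<Zsemi> Proj1 C A B\<rangle> = x"
  by (rule cpair_eqI[symmetric]) (use assms in simp_all)

lemma total_cpair [simp]:
  assumes "total C f" "total C g" "f \<in> Arr C" "g \<in> Arr C" "Dom C f = Dom C g"
  shows "total C \<langle>f, g\<rangle>"
  using assms by (simp add: total_def)

lemma bang_props:
  assumes "A \<in> Obj C"
  shows "bang C (One C) A \<in> hom C A (One C) \<and> total C (bang C (One C) A)"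
  unfolding bang_def
  by (rule theI') (use terminal assms in \<open>simp add: restriction_terminal_on_def\<close>)

lemma bang_typing [simp]:
  assumes "A \<in> Obj C"
  shows "bang C (One C) A \<in> Arr C" "Dom C (bang C (One C) A) = A"
    "Cod C (bang C (One C) A) = One C" "total C (bang C (One C) A)"
  using bang_props[OF assms] by (simp_all add: hom_def)

lemma One_Obj [simp]: "One C \<in> Obj C"
  using terminal by (simp add: restriction_terminal_on_def)

text \<open>All constant elements with a given domain of definition coincide; \<open>unit_element_eq\<close> below uses
  this to let the neutral element be written with the help of any element of that domain.\<close>

lemma comp_bang:
  assumes "x \<in> Arr C" "Cod C x = A"
  shows "x \<Zsemi> bang C (One C) A = \<rho> x \<Zsemi> bang C (One C) (Dom C x)"
  using terminal assms unfolding restriction_terminal_on_def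
  by (metis cod_obj dom_obj in_hom)

lemma to_One_eq:
  assumes "x \<in> Arr C" "y \<in> Arr C" "Cod C x = One C" "Cod C y = One C" "Dom C x = Dom C y" "\<rho> x = \<rho> y"
  shows "x = y"
proof -
  have "bang C (One C) (One C) = Id C (One C)"
    using terminal bang_props[of "One C"] id_hom[of "One C"] total_Id[of "One C"]
    unfolding restriction_terminal_on_def by (metis One_Obj)
  then show ?thesis
    using comp_bang[OF assms(1,3)] comp_bang[OF assms(2,4)] assms by simp
qed

lemma prod_span_sel [simp]:
  "apex (prod_span C A B) = A \<otimes> B" "pr0 (prod_span C A B) = Proj0 C A B"
  "pr1 (prod_span C A B) = Proj1 C A B"
  by (simp_all add: prod_span_def)

lemma pair_prod_span [simp]:
  "Cod C f = A \<Longrightarrow> Cod C g = B \<Longrightarrow> pair C (prod_span C A B) f g = \<langle>f, g\<rangle>"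
  by (auto simp: cpair_def)

lemma ctimes_typing [simp]:
  assumes "f \<in> Arr C" "g \<in> Arr C"
  shows "f \<times>\<times> g \<in> Arr C" "Dom C (f \<times>\<times> g) = Dom C f \<otimes> Dom C g" "Cod C (f \<times>\<times> g) = Cod C f \<otimes> Cod C g"
  using assms by (simp_all add: ctimes_def)

lemma pair_ctimes:
  assumes "x \<in> Arr C" "y \<in> Arr C" "Dom C x = Dom C y" "\<rho> x = \<rho> y"
    "f \<in> Arr C" "g \<in> Arr C" "Cod C x = Dom C f" "Cod C y = Dom C g"
  shows "\<langle>x, y\<rangle> \<Zsemi> (f \<times>\<times> g) = \<langle>x \<Zsemi> f, y \<Zsemi> g\<rangle>"
  using assms by (simp add: ctimes_def)

lemma cassoc_typing [simp]:
  assumes "A \<in> Obj C" "B \<in> Obj C" "D \<in> Obj C"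
  shows "cassoc C A B D \<in> Arr C" "Dom C (cassoc C A B D) = (A \<otimes> B) \<otimes> D"
    "Cod C (cassoc C A B D) = A \<otimes> B \<otimes> D"
  using assms by (simp_all add: cassoc_def Let_def)

lemma pair_cassoc:
  assumes "x \<in> Arr C" "y \<in> Arr C" "z \<in> Arr C" "Dom C x = Dom C y" "Dom C y = Dom C z"
    "\<rho> x = \<rho> y" "\<rho> y = \<rho> z" "Cod C x = A" "Cod C y = B" "Cod C z = D"
  shows "\<langle>\<langle>x, y\<rangle>, z\<rangle> \<Zsemi> cassoc C A B D = \<langle>x, \<langle>y, z\<rangle>\<rangle>"
proof -
  have "A \<in> Obj C" "B \<in> Obj C" "D \<in> Obj C" using assms by auto
  then show ?thesis using assms by (simp add: cassoc_def Let_def)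
qed

end

section \<open>The group of elements of a group object\<close>

text \<open>When the operations are total, elements of \<open>G\<close> with a fixed domain of definition \<open>e\<close> form an
  ordinary group: the product of \<open>x\<close> and \<open>y\<close> is \<open>\<langle>x, y\<rangle> \<Zsemi> m\<close>, the inverse of \<open>x\<close> is \<open>x \<Zsemi> \<iota>\<close>, and
  the neutral element is \<open>x \<Zsemi> bang C (One C) G \<Zsemi> u\<close> for any element \<open>x\<close> of this group. The laws
  follow by evaluating the diagrams of the group object at suitable elements.\<close>

locale total_group_object = cartesian_restriction_category C +
    group_object C "One C" G "prod_span C G G" "prod_span C (G \<otimes> G) G" m u \<iota>
  for C :: "('o, 'a, 'z) crcat_scheme" (structure) and G m u \<iota> +
  assumes m_total [simp]: "total C m" and u_total [simp]: "total C u"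
    and inv_total [simp]: "total C \<iota>"
begin

lemma op_typing [simp]:
  "m \<in> Arr C" "Dom C m = G \<otimes> G" "Cod C m = G" "u \<in> Arr C" "Dom C u = One C" "Cod C u = G"
  "\<iota> \<in> Arr C" "Dom C \<iota> = G" "Cod C \<iota> = G"
  using m_hom u_hom inv_hom by (simp_all add: hom_def)

lemma G_Obj [simp]: "G \<in> Obj C"
  using H_supported by (simp add: supported_def)

lemma mult_assoc:
  assumes "x \<in> Arr C" "y \<in> Arr C" "z \<in> Arr C" "Dom C x = Dom C y" "Dom C y = Dom C z"
    "Cod C x = G" "Cod C y = G" "Cod C z = G" "\<rho> x = \<rho> y" "\<rho> y = \<rho> z"
  shows "\<langle>\<langle>x, y\<rangle> \<Zsemi> m, z\<rangle> \<Zsemi> m = \<langle>x, \<langle>y, z\<rangle> \<Zsemi> m\<rangle> \<Zsemi> m"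
proof -
  let ?w = "\<langle>\<langle>x, y\<rangle>, z\<rangle>"
  have "\<langle>Proj0 C (G \<otimes> G) G \<Zsemi> m, Proj1 C (G \<otimes> G) G\<rangle> \<Zsemi> m =
    \<langle>Proj0 C (G \<otimes> G) G \<Zsemi> Proj0 C G G, \<langle>Proj0 C (G \<otimes> G) G \<Zsemi> Proj1 C G G, Proj1 C (G \<otimes> G) G\<rangle> \<Zsemi> m\<rangle> \<Zsemi> m"
    using m_assoc by simp
  from arg_cong[OF this, of "\<lambda>t. ?w \<Zsemi> t"] show ?thesis using assms by simp
qed

lemma mult_unit_left:
  assumes "x \<in> Arr C" "Cod C x = G"
  shows "\<langle>x \<Zsemi> bang C (One C) G \<Zsemi> u, x\<rangle> \<Zsemi> m = x"
proof -
  from unit_left have "\<langle>bang C (One C) G \<Zsemi> u, Id C G\<rangle> \<Zsemi> m = Id C G" by simp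
  from arg_cong[OF this, of "\<lambda>t. x \<Zsemi> t"] show ?thesis using assms by simp
qed

lemma mult_unit_right:
  assumes "x \<in> Arr C" "Cod C x = G"
  shows "\<langle>x, x \<Zsemi> bang C (One C) G \<Zsemi> u\<rangle> \<Zsemi> m = x"
proof -
  from unit_right have "\<langle>Id C G, bang C (One C) G \<Zsemi> u\<rangle> \<Zsemi> m = Id C G" by simp
  from arg_cong[OF this, of "\<lambda>t. x \<Zsemi> t"] show ?thesis using assms by simp
qed

lemma mult_inv_left:
  assumes "x \<in> Arr C" "Cod C x = G"
  shows "\<langle>x \<Zsemi> \<iota>, x\<rangle> \<Zsemi> m = x \<Zsemi> bang C (One C) G \<Zsemi> u"
proof -
  from inv_left have "\<langle>\<iota>, Id C G\<rangle> \<Zsemi> m = bang C (One C) G \<Zsemi> u" by simp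
  from arg_cong[OF this, of "\<lambda>t. x \<Zsemi> t"] show ?thesis using assms by simp
qed

lemma mult_inv_right:
  assumes "x \<in> Arr C" "Cod C x = G"
  shows "\<langle>x, x \<Zsemi> \<iota>\<rangle> \<Zsemi> m = x \<Zsemi> bang C (One C) G \<Zsemi> u"
proof -
  from inv_right have "\<langle>Id C G, \<iota>\<rangle> \<Zsemi> m = bang C (One C) G \<Zsemi> u" by simp
  from arg_cong[OF this, of "\<lambda>t. x \<Zsemi> t"] show ?thesis using assms by simp
qed

lemma unit_element_eq:
  assumes "x \<in> Arr C" "Cod C x = A" "y \<in> Arr C" "Cod C y = B" "\<rho> x = \<rho> y" "Dom C x = Dom C y"
  shows "x \<Zsemi> bang C (One C) A \<Zsemi> u = y \<Zsemi> bang C (One C) B \<Zsemi> u"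
  using comp_bang[of x A] comp_bang[of y B] assms by simp

text \<open>These two laws are what makes division inverse to the action in each chart.\<close>

lemma mult_inv_cancel [simp]:
  assumes "x \<in> Arr C" "y \<in> Arr C" "Dom C x = Dom C y" "Cod C x = G" "Cod C y = G" "\<rho> x = \<rho> y"
  shows "\<langle>x \<Zsemi> \<iota>, \<langle>x, y\<rangle> \<Zsemi> m\<rangle> \<Zsemi> m = y" "\<langle>x, \<langle>x \<Zsemi> \<iota>, y\<rangle> \<Zsemi> m\<rangle> \<Zsemi> m = y"
  using mult_assoc[of "x \<Zsemi> \<iota>" x y] mult_assoc[of x "x \<Zsemi> \<iota>" y] mult_inv_left[of x]
    mult_inv_right[of x] unit_element_eq[of x G y G] mult_unit_left[of y] assms by simp_all

end

section \<open>Charts of a totally fibred principal bundle\<close>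

locale principal_bundle_pullback =
  principal_bundle C G m u \<iota> P M q I \<alpha> e \<tau> + totally_fibred C G P M q I \<alpha> e +
  total_group_object C G m u \<iota>
  for C :: "('o, 'a, 'z) crcat_scheme" (structure)
    and G m u \<iota> P M q and I :: "'i set" and \<alpha> e \<tau> +
  fixes PP :: "('o, 'a) span"
  assumes pullback: "restriction_pullback C q q PP"
begin

lemma bundle_typing [simp]:
  "M \<in> Obj C" "q \<in> Arr C" "Dom C q = P" "Cod C q = M" "total C q" "P \<in> Obj C"
proof -
  show q: "q \<in> Arr C" "Dom C q = P" "Cod C q = M" "total C q"
    using q_hom q_total by (simp_all add: hom_def)
  then show "M \<in> Obj C" "P \<in> Obj C" using Cod_Obj[OF q(1)] Dom_Obj[OF q(1)] by simp_all
qed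

lemma chart_typing [simp]:
  assumes "i \<in> I"
  shows "\<alpha> i \<in> Arr C" "Dom C (\<alpha> i) = P" "Cod C (\<alpha> i) = M \<otimes> G" "partial_iso C (\<alpha> i)"
    "e i \<in> Arr C" "Dom C (e i) = M" "Cod C (e i) = M"
  using chart_hom[OF assms] e_hom[OF assms] chart_iso[OF assms] by (simp_all add: hom_def)

lemma transition_typing [simp]:
  assumes "i \<in> I" "j \<in> I"
  shows "\<tau> i j \<in> Arr C" "Dom C (\<tau> i j) = M" "Cod C (\<tau> i j) = G"
  using atlas_hom[OF assms] by (simp_all add: hom_def)

text \<open>The domain of a chart is a union of fibres of \<open>q\<close>: if two points lie over the same point of \<open>M\<close>,
  a chart is defined at both or at neither. This is where total fibredness enters.\<close>

lemma chart_domain: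
  assumes "i \<in> I" "p \<in> Arr C" "Cod C p = P"
  shows "\<rho> (p \<Zsemi> \<alpha> i) = \<rho> (p \<Zsemi> q \<Zsemi> e i)"
proof -
  have "\<rho> (p \<Zsemi> \<alpha> i) = \<rho> (p \<Zsemi> \<rho> (\<alpha> i))" using assms by simp
  also have "\<dots> = \<rho> (p \<Zsemi> \<rho> (q \<Zsemi> e i))" using total_fibres[OF assms(1)] by simp
  also have "\<dots> = \<rho> (p \<Zsemi> (q \<Zsemi> e i))" using assms by (intro rst_comp_rst) simp_all
  finally show ?thesis using assms by simp
qed

text \<open>In a chart a point \<open>p\<close> has two coordinates: its base point \<open>p \<Zsemi> q\<close>, and the fibre coordinate
  \<open>p \<Zsemi> \<alpha> i \<Zsemi> Proj1 C M G\<close>.\<close>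

lemma chart_base_restricted:
  assumes "i \<in> I" "p \<in> Arr C" "Cod C p = P"
  shows "p \<Zsemi> \<alpha> i \<Zsemi> Proj0 C M G = \<rho> (p \<Zsemi> \<alpha> i) \<Zsemi> (p \<Zsemi> q)"
proof -
  have "p \<Zsemi> \<alpha> i \<Zsemi> Proj0 C M G = p \<Zsemi> (\<alpha> i \<Zsemi> Proj0 C M G)" using assms by simp
  also have "\<dots> = p \<Zsemi> \<rho> (\<alpha> i) \<Zsemi> q" using assms chart_over[of i] by simp
  also have "p \<Zsemi> \<rho> (\<alpha> i) = \<rho> (p \<Zsemi> \<alpha> i) \<Zsemi> p" using assms by (intro comp_rst) simp_all
  finally show ?thesis using assms by simp
qed

lemma chart_base:
  assumes "i \<in> I" "p \<in> Arr C" "Cod C p = P" "\<rho> (p \<Zsemi> \<alpha> i) = \<rho> p"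
  shows "p \<Zsemi> \<alpha> i \<Zsemi> Proj0 C M G = p \<Zsemi> q"
  using chart_base_restricted[OF assms(1-3)] assms by simp

lemma chart_eta:
  assumes "i \<in> I" "p \<in> Arr C" "Cod C p = P" "\<rho> (p \<Zsemi> \<alpha> i) = \<rho> p"
  shows "p \<Zsemi> \<alpha> i = \<langle>p \<Zsemi> q, p \<Zsemi> \<alpha> i \<Zsemi> Proj1 C M G\<rangle>"
  using cpair_eta[of "p \<Zsemi> \<alpha> i" M G] chart_base[OF assms] assms by simp

text \<open>The range of the \<open>i\<close>-th chart is \<open>e i \<times>\<times> Id C G\<close>, so whether a pair of coordinates comes from a
  point depends on the base coordinate only. In particular the fibre coordinate of a point may be
  replaced by any other element of \<open>G\<close>.\<close>

lemma pinv_chart_defined: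
  assumes "i \<in> I" "x \<in> Arr C" "Cod C x = M" "\<rho> (x \<Zsemi> e i) = \<rho> x"
    "g \<in> Arr C" "Cod C g = G" "\<rho> g = \<rho> x" "Dom C g = Dom C x"
  shows "\<rho> (\<langle>x, g\<rangle> \<Zsemi> pinv C (\<alpha> i)) = \<rho> x"
proof -
  have "\<rho> (\<langle>x, g\<rangle> \<Zsemi> pinv C (\<alpha> i)) = \<rho> (\<langle>x, g\<rangle> \<Zsemi> \<rho> (pinv C (\<alpha> i)))" using assms by simp
  also have "\<dots> = \<rho> (\<langle>x, g\<rangle> \<Zsemi> (e i \<times>\<times> Id C G))" using chart_range[OF assms(1)] by simp
  also have "\<dots> = \<rho> x" using assms by (simp add: ctimes_def)
  finally show ?thesis .
qed

lemma pinv_chart_value: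
  assumes "i \<in> I" "x \<in> Arr C" "Cod C x = M" "\<rho> (x \<Zsemi> e i) = \<rho> x"
    "g \<in> Arr C" "Cod C g = G" "\<rho> g = \<rho> x" "Dom C g = Dom C x"
  shows "\<langle>x, g\<rangle> \<Zsemi> pinv C (\<alpha> i) \<Zsemi> \<alpha> i = \<langle>x, g\<rangle>"
  by (rule comp_pinv_cancel') (use assms pinv_chart_defined[OF assms] in simp_all)

text \<open>Charts are partial isomorphisms, hence injective where they are defined. The chart need only be
  known to be defined at one of the two points, since they lie in the same fibre.\<close>

lemma fibre_eqI:
  assumes "i \<in> I" "p \<in> Arr C" "Cod C p = P" "p' \<in> Arr C" "Cod C p' = P" "Dom C p' = Dom C p"
    "\<rho> p' = \<rho> p" "\<rho> (p \<Zsemi> \<alpha> i) = \<rho> p" "p' \<Zsemi> q = p \<Zsemi> q"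
    "p' \<Zsemi> \<alpha> i \<Zsemi> Proj1 C M G = p \<Zsemi> \<alpha> i \<Zsemi> Proj1 C M G"
  shows "p' = p"
proof -
  have d: "\<rho> (p' \<Zsemi> \<alpha> i) = \<rho> p'"
    using chart_domain[of i p] chart_domain[of i p'] assms by simp
  show ?thesis
  proof (rule partial_iso_cancel)
    show "p' \<Zsemi> \<alpha> i = p \<Zsemi> \<alpha> i"
      using chart_eta[of i p] chart_eta[of i p'] assms d by metis
    show "partial_iso C (\<alpha> i)" using assms by simp
  qed (use assms d in simp_all)
qed

text \<open>A change of chart multiplies the fibre coordinate on the left, by an element of \<open>G\<close> that depends on
  the base point only.\<close>

lemma chart_transition:
  assumes "i \<in> I" "j \<in> I" "p \<in> Arr C" "Cod C p = P"
    "\<rho> (p \<Zsemi> \<alpha> i) = \<rho> p" "\<rho> (p \<Zsemi> \<alpha> j) = \<rho> p"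
  shows "\<rho> (p \<Zsemi> q \<Zsemi> \<tau> j i) = \<rho> p"
    and "p \<Zsemi> \<alpha> j \<Zsemi> Proj1 C M G = \<langle>p \<Zsemi> q \<Zsemi> \<tau> j i, p \<Zsemi> \<alpha> i \<Zsemi> Proj1 C M G\<rangle> \<Zsemi> m"
proof -
  let ?x = "p \<Zsemi> q" and ?h = "p \<Zsemi> \<alpha> i \<Zsemi> Proj1 C M G"
  have "p \<Zsemi> \<alpha> j = p \<Zsemi> \<alpha> i \<Zsemi> pinv C (\<alpha> i) \<Zsemi> \<alpha> j"
    using comp_pinv_cancel[of "\<alpha> i" p] assms by simp
  also have "\<dots> = \<langle>?x, ?h\<rangle> \<Zsemi> pinv C (\<alpha> i) \<Zsemi> \<alpha> j"
    using chart_eta[of i p] assms by simp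
  also have "\<dots> = \<langle>?x, ?h\<rangle> \<Zsemi> (pinv C (\<alpha> i) \<Zsemi> \<alpha> j)" using assms by simp
  also have "\<dots> = \<langle>?x, \<langle>?x \<Zsemi> \<tau> j i, ?h\<rangle> \<Zsemi> m\<rangle>"
    unfolding transition[OF assms(1,2)] using assms by simp
  finally have eq: "p \<Zsemi> \<alpha> j = \<langle>?x, \<langle>?x \<Zsemi> \<tau> j i, ?h\<rangle> \<Zsemi> m\<rangle>" .
  have le: "\<rho> (?x \<Zsemi> \<tau> j i) \<Zsemi> \<rho> p = \<rho> (?x \<Zsemi> \<tau> j i)" "\<rho> p \<Zsemi> \<rho> (?x \<Zsemi> \<tau> j i) = \<rho> (?x \<Zsemi> \<tau> j i)"
    using rst_comp_le'[of ?x "\<tau> j i"] rst_comp_le[of ?x "\<tau> j i"] assms by simp_all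
  show t: "\<rho> (?x \<Zsemi> \<tau> j i) = \<rho> p"
    using arg_cong[OF eq, of "Rst C"] assms le by simp
  show "p \<Zsemi> \<alpha> j \<Zsemi> Proj1 C M G = \<langle>?x \<Zsemi> \<tau> j i, ?h\<rangle> \<Zsemi> m"
    unfolding eq using assms t by simp
qed

text \<open>Composition with \<open>p\<close> and restriction both preserve the join of the chart domains, so the cover of
  \<open>P\<close> by charts pulls back along \<open>p\<close>.\<close>

lemma cover:
  assumes "p \<in> Arr C" "Cod C p = P" "total C p"
  shows "is_join C (Dom C p) (Dom C p) ((\<lambda>i. \<rho> (p \<Zsemi> \<alpha> i)) ` I) (Id C (Dom C p))"
proof -
  have "is_join C (Dom C p) P ((\<lambda>x. p \<Zsemi> x) ` (\<lambda>i. \<rho> (\<alpha> i)) ` I) (p \<Zsemi> Id C P)"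
    by (rule join_comp[OF _ charts_cover]) (use assms in \<open>simp add: hom_def\<close>)
  from join_rst[OF this]
  have "is_join C (Dom C p) (Dom C p) ((\<lambda>i. \<rho> (p \<Zsemi> \<rho> (\<alpha> i))) ` I) (\<rho> p)"
    using assms by (simp add: image_image)
  moreover have "(\<lambda>i. \<rho> (p \<Zsemi> \<rho> (\<alpha> i))) ` I = (\<lambda>i. \<rho> (p \<Zsemi> \<alpha> i)) ` I"
    using assms by (intro image_cong) simp_all
  ultimately show ?thesis using assms by (simp add: total_def)
qed

text \<open>An equation needs to be checked only at the elements \<open>c\<close> of a cover by chart domains. Being
  restriction idempotents, these are elements with \<open>\<rho> c = c\<close>.\<close>

lemma chartwise_equality:
  assumes "p \<in> Arr C" "Cod C p = P" "total C p"
    "f \<in> Arr C" "g \<in> Arr C" "Dom C f = Dom C p" "Dom C g = Dom C p" "Cod C f = Cod C g"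
    and "\<And>i c. i \<in> I \<Longrightarrow> c \<in> Arr C \<Longrightarrow> Dom C c = Dom C p \<Longrightarrow> Cod C c = Dom C p \<Longrightarrow> \<rho> c = c \<Longrightarrow>
           \<rho> (c \<Zsemi> p \<Zsemi> \<alpha> i) = c \<Longrightarrow> c \<Zsemi> f = c \<Zsemi> g"
  shows "f = g"
proof (rule local_equality[OF cover[OF assms(1-3)]])
  show "f \<in> hom C (Dom C p) (Cod C f)" "g \<in> hom C (Dom C p) (Cod C f)"
    using assms by (simp_all add: hom_def)
  fix c assume "c \<in> (\<lambda>i. \<rho> (p \<Zsemi> \<alpha> i)) ` I"
  then obtain i where i: "i \<in> I" and c: "c = \<rho> (p \<Zsemi> \<alpha> i)" by blast
  show "\<rho> c = c" using i assms by (simp add: c)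
  have "c \<Zsemi> p \<Zsemi> \<alpha> i = p \<Zsemi> \<alpha> i"
    using rst_self[of "p \<Zsemi> \<alpha> i"] i assms by (simp add: c)
  then show "c \<Zsemi> f = c \<Zsemi> g"
    using i assms by (intro assms(9)[of i]) (simp_all add: c)
qed

lemma chartwise_total:
  assumes "p \<in> Arr C" "Cod C p = P" "total C p" "f \<in> Arr C" "Dom C f = Dom C p"
    and "\<And>i c. i \<in> I \<Longrightarrow> c \<in> Arr C \<Longrightarrow> Dom C c = Dom C p \<Longrightarrow> Cod C c = Dom C p \<Longrightarrow> \<rho> c = c \<Longrightarrow>
           \<rho> (c \<Zsemi> p \<Zsemi> \<alpha> i) = c \<Longrightarrow> \<rho> (c \<Zsemi> f) = c"
  shows "total C f"
proof -
  have "\<rho> f = Id C (Dom C p)"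
  proof (rule chartwise_equality[OF assms(1-3)])
    fix i c assume c: "i \<in> I" "c \<in> Arr C" "Dom C c = Dom C p" "Cod C c = Dom C p" "\<rho> c = c"
      "\<rho> (c \<Zsemi> p \<Zsemi> \<alpha> i) = c"
    from assms(6)[OF this] comp_rst[of c f] rst_self[of c] c assms(4,5)
    show "c \<Zsemi> \<rho> f = c \<Zsemi> Id C (Dom C p)" by simp
  qed (use assms in simp_all)
  then show ?thesis using assms by (simp add: total_def)
qed

section \<open>The action\<close>

abbreviation r where "r \<equiv> bundle_action C G m P M I \<alpha>"

lemma action_part_typing [simp]:
  assumes "i \<in> I"
  shows "action_part C G m M (\<alpha> i) \<in> Arr C" "Dom C (action_part C G m M (\<alpha> i)) = P \<otimes> G"
    "Cod C (action_part C G m M (\<alpha> i)) = P"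
  using assms by (simp_all add: action_part_def)

lemma action_part_value:
  assumes "i \<in> I" "p \<in> Arr C" "Cod C p = P" "\<rho> (p \<Zsemi> \<alpha> i) = \<rho> p"
    "g \<in> Arr C" "Cod C g = G" "\<rho> g = \<rho> p" "Dom C g = Dom C p"
  shows "\<langle>p, g\<rangle> \<Zsemi> action_part C G m M (\<alpha> i) =
    \<langle>p \<Zsemi> q, \<langle>p \<Zsemi> \<alpha> i \<Zsemi> Proj1 C M G, g\<rangle> \<Zsemi> m\<rangle> \<Zsemi> pinv C (\<alpha> i)"
proof -
  let ?h = "p \<Zsemi> \<alpha> i \<Zsemi> Proj1 C M G"
  have "\<langle>p, g\<rangle> \<Zsemi> action_part C G m M (\<alpha> i) = \<langle>p, g\<rangle> \<Zsemi> (\<alpha> i \<times>\<times> Id C G) \<Zsemi>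
      cassoc C M G G \<Zsemi> (Id C M \<times>\<times> m) \<Zsemi> pinv C (\<alpha> i)"
    using assms by (simp add: action_part_def)
  also have "\<langle>p, g\<rangle> \<Zsemi> (\<alpha> i \<times>\<times> Id C G) = \<langle>p \<Zsemi> \<alpha> i, g\<rangle>"
    using assms by (simp add: pair_ctimes)
  also have "\<dots> = \<langle>\<langle>p \<Zsemi> q, ?h\<rangle>, g\<rangle>" using chart_eta[OF assms(1-4)] by simp
  also have "\<dots> \<Zsemi> cassoc C M G G = \<langle>p \<Zsemi> q, \<langle>?h, g\<rangle>\<rangle>"
    using assms by (simp add: pair_cassoc)
  also have "\<dots> \<Zsemi> (Id C M \<times>\<times> m) = \<langle>p \<Zsemi> q, \<langle>?h, g\<rangle> \<Zsemi> m\<rangle>"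
    using assms by (simp add: pair_ctimes)
  finally show ?thesis .
qed

lemma action_part_defined:
  assumes "i \<in> I" "z \<in> Arr C" "Cod C z = P \<otimes> G" "\<rho> (z \<Zsemi> action_part C G m M (\<alpha> i)) = \<rho> z"
  shows "\<rho> (z \<Zsemi> Proj0 C P G \<Zsemi> \<alpha> i) = \<rho> z"
proof -
  let ?a = "\<alpha> i \<times>\<times> Id C G" and ?b = "cassoc C M G G \<Zsemi> (Id C M \<times>\<times> m)"
  have b: "?b \<in> Arr C" "Dom C ?b = (M \<otimes> G) \<otimes> G" "Cod C ?b = M \<otimes> G"
    by simp_all
  have z: "z \<Zsemi> action_part C G m M (\<alpha> i) = z \<Zsemi> ?a \<Zsemi> (?b \<Zsemi> pinv C (\<alpha> i))"
    unfolding action_part_def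
    using assms b comp_left_nest[of ?a ?b "pinv C (\<alpha> i)"] comp_left_nest[of z ?a "?b \<Zsemi> pinv C (\<alpha> i)"]
    by (simp del: comp_left_nest)
  have "\<rho> (z \<Zsemi> ?a) = \<rho> z"
    by (rule defined_prefix[where g = "?b \<Zsemi> pinv C (\<alpha> i)"]) (use assms b z[symmetric] in \<open>simp_all del: comp_left_nest\<close>)
  moreover have "\<rho> (z \<Zsemi> ?a) = \<rho> (z \<Zsemi> Proj0 C P G \<Zsemi> \<alpha> i)"
    using assms rst_comp_le'[of "z \<Zsemi> Proj0 C P G" "\<alpha> i"] by (simp add: ctimes_def)
  ultimately show ?thesis by simp
qed

text \<open>In the \<open>i\<close>-th chart the action is right multiplication on the fibre coordinate, and it keeps the
  base point.\<close>

lemma action_part_chart: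
  assumes "i \<in> I" "p \<in> Arr C" "Cod C p = P" "\<rho> (p \<Zsemi> \<alpha> i) = \<rho> p"
    "g \<in> Arr C" "Cod C g = G" "\<rho> g = \<rho> p" "Dom C g = Dom C p"
  shows "\<langle>p, g\<rangle> \<Zsemi> action_part C G m M (\<alpha> i) \<Zsemi> \<alpha> i =
          \<langle>p \<Zsemi> q, \<langle>p \<Zsemi> \<alpha> i \<Zsemi> Proj1 C M G, g\<rangle> \<Zsemi> m\<rangle>" (is ?value)
    and "\<rho> (\<langle>p, g\<rangle> \<Zsemi> action_part C G m M (\<alpha> i)) = \<rho> p" (is ?rst)
    and "\<langle>p, g\<rangle> \<Zsemi> action_part C G m M (\<alpha> i) \<Zsemi> q = p \<Zsemi> q" (is ?base)
proof -
  let ?y = "\<langle>p \<Zsemi> \<alpha> i \<Zsemi> Proj1 C M G, g\<rangle> \<Zsemi> m"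
  have c: "\<rho> (p \<Zsemi> q \<Zsemi> e i) = \<rho> p" using chart_domain[of i p] assms by simp
  show v: ?value unfolding action_part_value[OF assms]
    by (rule pinv_chart_value) (use assms c in simp_all)
  show d: ?rst unfolding action_part_value[OF assms]
    using pinv_chart_defined[of i "p \<Zsemi> q" ?y] assms c by simp
  have "\<langle>p, g\<rangle> \<Zsemi> action_part C G m M (\<alpha> i) \<Zsemi> \<alpha> i \<Zsemi> Proj0 C M G =
    \<langle>p, g\<rangle> \<Zsemi> action_part C G m M (\<alpha> i) \<Zsemi> q"
    by (rule chart_base) (use assms in \<open>simp_all add: v d\<close>)
  then show ?base unfolding v using assms by simp
qed

text \<open>Transition functions multiply the fibre coordinate on the left and the action multiplies it on
  the right, so by associativity the two parts give points with the same coordinates in the chart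
  \<open>\<alpha> j\<close>.\<close>

lemma action_parts_compatible:
  assumes "i \<in> I" "j \<in> I"
  shows "compatible C (action_part C G m M (\<alpha> i)) (action_part C G m M (\<alpha> j))"
proof (rule compatible_by_elements)
  fix z assume z: "z \<in> Arr C" "Cod C z = Dom C (action_part C G m M (\<alpha> i))"
    "\<rho> (z \<Zsemi> action_part C G m M (\<alpha> i)) = \<rho> z" "\<rho> (z \<Zsemi> action_part C G m M (\<alpha> j)) = \<rho> z"
  let ?p = "z \<Zsemi> Proj0 C P G" and ?g = "z \<Zsemi> Proj1 C P G"
  let ?h = "\<lambda>i. ?p \<Zsemi> \<alpha> i \<Zsemi> Proj1 C M G" and ?t = "?p \<Zsemi> q \<Zsemi> \<tau> j i"
  let ?y = "z \<Zsemi> action_part C G m M (\<alpha> i)" and ?y' = "z \<Zsemi> action_part C G m M (\<alpha> j)"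
  have zt: "Cod C z = P \<otimes> G" using z assms by simp
  have di: "\<rho> (?p \<Zsemi> \<alpha> i) = \<rho> z" and dj: "\<rho> (?p \<Zsemi> \<alpha> j) = \<rho> z"
    using action_part_defined[of _ z] assms z zt by simp_all
  have zz: "\<langle>?p, ?g\<rangle> = z" using z zt by (intro cpair_eta) simp_all
  note Ci = action_part_chart[of i ?p ?g, unfolded zz] and Cj = action_part_chart[of j ?p ?g, unfolded zz]
  note T = chart_transition[of i j ?p]
  have i: "?y \<Zsemi> \<alpha> i = \<langle>?p \<Zsemi> q, \<langle>?h i, ?g\<rangle> \<Zsemi> m\<rangle>" "\<rho> ?y = \<rho> z" "?y \<Zsemi> q = ?p \<Zsemi> q"
    using Ci assms z zt di by simp_all
  have j: "?y' \<Zsemi> \<alpha> j = \<langle>?p \<Zsemi> q, \<langle>?h j, ?g\<rangle> \<Zsemi> m\<rangle>" "\<rho> ?y' = \<rho> z" "?y' \<Zsemi> q = ?p \<Zsemi> q"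
    using Cj assms z zt dj by simp_all
  have t: "\<rho> ?t = \<rho> z" "?h j = \<langle>?t, ?h i\<rangle> \<Zsemi> m"
    using T assms z zt di dj by simp_all
  have yi: "\<rho> (?y \<Zsemi> \<alpha> i) = \<rho> ?y" unfolding i(1) using assms z zt di by simp
  have yj: "\<rho> (?y \<Zsemi> \<alpha> j) = \<rho> ?y"
    using chart_domain[of j ?y] chart_domain[of j ?p] i(2,3) dj assms z zt by simp
  show "?y = ?y'"
  proof (rule fibre_eqI[OF assms(2)])
    have "?y \<Zsemi> \<alpha> j \<Zsemi> Proj1 C M G = \<langle>?t, \<langle>?h i, ?g\<rangle> \<Zsemi> m\<rangle> \<Zsemi> m"
      using chart_transition(2)[of i j ?y] assms z zt yi yj i di by simp
    also have "\<dots> = \<langle>\<langle>?t, ?h i\<rangle> \<Zsemi> m, ?g\<rangle> \<Zsemi> m"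
      by (rule mult_assoc[symmetric]) (use assms z zt di t in simp_all)
    also have "\<dots> = \<langle>?h j, ?g\<rangle> \<Zsemi> m" unfolding t(2) ..
    finally show "?y \<Zsemi> \<alpha> j \<Zsemi> Proj1 C M G = ?y' \<Zsemi> \<alpha> j \<Zsemi> Proj1 C M G"
      unfolding j(1) using assms z zt dj by simp
    show "\<rho> (?y' \<Zsemi> \<alpha> j) = \<rho> ?y'" unfolding j(1) using assms z zt dj by simp
  qed (use assms z zt i j in simp_all)
qed (use assms in simp_all)

lemma action_is_join:
  "is_join C (P \<otimes> G) P ((\<lambda>i. action_part C G m M (\<alpha> i)) ` I) r"
  unfolding bundle_action_def
  by (rule is_join_join) (auto simp: hom_def intro: action_parts_compatible)

lemma action_typing [simp]: "r \<in> Arr C" "Dom C r = P \<otimes> G" "Cod C r = P"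
  using action_is_join by (simp_all add: is_join_def hom_def)

lemma action_value:
  assumes "i \<in> I" "p \<in> Arr C" "Cod C p = P" "\<rho> (p \<Zsemi> \<alpha> i) = \<rho> p"
    "g \<in> Arr C" "Cod C g = G" "\<rho> g = \<rho> p" "Dom C g = Dom C p"
  shows "\<langle>p, g\<rangle> \<Zsemi> r \<Zsemi> \<alpha> i \<Zsemi> Proj1 C M G = \<langle>p \<Zsemi> \<alpha> i \<Zsemi> Proj1 C M G, g\<rangle> \<Zsemi> m"
    and "\<rho> (\<langle>p, g\<rangle> \<Zsemi> r) = \<rho> p" and "\<rho> (\<langle>p, g\<rangle> \<Zsemi> r \<Zsemi> \<alpha> i) = \<rho> p"
    and "\<langle>p, g\<rangle> \<Zsemi> r \<Zsemi> q = p \<Zsemi> q"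
proof -
  note V = action_part_chart[OF assms]
  have "rle C (action_part C G m M (\<alpha> i)) r"
    using action_is_join assms(1) by (simp add: is_join_def)
  then have eq: "\<langle>p, g\<rangle> \<Zsemi> r = \<langle>p, g\<rangle> \<Zsemi> action_part C G m M (\<alpha> i)"
    by (rule rle_apply) (use V(2) assms in simp_all)
  show "\<langle>p, g\<rangle> \<Zsemi> r \<Zsemi> \<alpha> i \<Zsemi> Proj1 C M G = \<langle>p \<Zsemi> \<alpha> i \<Zsemi> Proj1 C M G, g\<rangle> \<Zsemi> m"
    "\<rho> (\<langle>p, g\<rangle> \<Zsemi> r) = \<rho> p" "\<rho> (\<langle>p, g\<rangle> \<Zsemi> r \<Zsemi> \<alpha> i) = \<rho> p" "\<langle>p, g\<rangle> \<Zsemi> r \<Zsemi> q = p \<Zsemi> q"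
    unfolding eq V using assms by simp_all
qed

lemma action_total: "total C r"
proof (rule chartwise_total[where p = "Proj0 C P G"])
  fix i c assume c: "i \<in> I" "c \<in> Arr C" "Dom C c = Dom C (Proj0 C P G)" "Cod C c = Dom C (Proj0 C P G)"
    "\<rho> c = c" "\<rho> (c \<Zsemi> Proj0 C P G \<Zsemi> \<alpha> i) = c"
  then have "\<langle>c \<Zsemi> Proj0 C P G, c \<Zsemi> Proj1 C P G\<rangle> = c" by (intro cpair_eta) simp_all
  then show "\<rho> (c \<Zsemi> r) = c"
    using action_value(2)[of i "c \<Zsemi> Proj0 C P G" "c \<Zsemi> Proj1 C P G"] c by simp
qed simp_all

lemma action_over_base: "r \<Zsemi> q = Proj0 C P G \<Zsemi> q"
proof (rule chartwise_equality[where p = "Proj0 C P G"])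
  fix i c assume c: "i \<in> I" "c \<in> Arr C" "Dom C c = Dom C (Proj0 C P G)" "Cod C c = Dom C (Proj0 C P G)"
    "\<rho> c = c" "\<rho> (c \<Zsemi> Proj0 C P G \<Zsemi> \<alpha> i) = c"
  then have "\<langle>c \<Zsemi> Proj0 C P G, c \<Zsemi> Proj1 C P G\<rangle> = c" by (intro cpair_eta) simp_all
  then show "c \<Zsemi> (r \<Zsemi> q) = c \<Zsemi> (Proj0 C P G \<Zsemi> q)"
    using action_value(4)[of i "c \<Zsemi> Proj0 C P G" "c \<Zsemi> Proj1 C P G"] c by simp
qed simp_all

lemma action_unit: "\<langle>Id C P, bang C (One C) P \<Zsemi> u\<rangle> \<Zsemi> r = Id C P"
proof (rule chartwise_equality[where p = "Id C P"])
  fix i c assume c: "i \<in> I" "c \<in> Arr C" "Dom C c = Dom C (Id C P)" "Cod C c = Dom C (Id C P)"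
    "\<rho> c = c" "\<rho> (c \<Zsemi> Id C P \<Zsemi> \<alpha> i) = c"
  let ?g = "c \<Zsemi> bang C (One C) P \<Zsemi> u" and ?h = "c \<Zsemi> \<alpha> i \<Zsemi> Proj1 C M G"
  have g: "?g = ?h \<Zsemi> bang C (One C) G \<Zsemi> u" using c by (intro unit_element_eq) simp_all
  have h: "\<langle>?h, ?g\<rangle> \<Zsemi> m = ?h" unfolding g using c by (intro mult_unit_right) simp_all
  note V = action_value[of i c ?g]
  have "\<langle>c, ?g\<rangle> \<Zsemi> r = c"
    by (rule fibre_eqI[of i]) (use V h c in simp_all)
  then show "c \<Zsemi> (\<langle>Id C P, bang C (One C) P \<Zsemi> u\<rangle> \<Zsemi> r) = c \<Zsemi> Id C P"
    using c by simp
qed simp_all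

text \<open>In a chart this is associativity of the multiplication, applied to the fibre coordinate of \<open>p\<close>, to
  \<open>g\<close> and to \<open>k\<close>.\<close>

lemma action_mult:
  "\<langle>Proj0 C (P \<otimes> G) G \<Zsemi> r, Proj1 C (P \<otimes> G) G\<rangle> \<Zsemi> r =
   \<langle>Proj0 C (P \<otimes> G) G \<Zsemi> Proj0 C P G,
     \<langle>Proj0 C (P \<otimes> G) G \<Zsemi> Proj1 C P G, Proj1 C (P \<otimes> G) G\<rangle> \<Zsemi> m\<rangle> \<Zsemi> r" (is "?L = ?R")
proof (rule chartwise_equality[where p = "Proj0 C (P \<otimes> G) G \<Zsemi> Proj0 C P G"])
  note action_total [simp]
  let ?pi = "Proj0 C (P \<otimes> G) G"
  fix i c assume "i \<in> I" "c \<in> Arr C" "Dom C c = Dom C (?pi \<Zsemi> Proj0 C P G)"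
    "Cod C c = Dom C (?pi \<Zsemi> Proj0 C P G)" "\<rho> c = c" "\<rho> (c \<Zsemi> (?pi \<Zsemi> Proj0 C P G) \<Zsemi> \<alpha> i) = c"
  then have c: "i \<in> I" "c \<in> Arr C" "Dom C c = (P \<otimes> G) \<otimes> G" "Cod C c = (P \<otimes> G) \<otimes> G" "\<rho> c = c"
    "\<rho> (c \<Zsemi> ?pi \<Zsemi> Proj0 C P G \<Zsemi> \<alpha> i) = c" by simp_all
  \<comment> \<open>A generic element \<open>((p, g), k)\<close> of \<open>(P \<otimes> G) \<otimes> G\<close> with \<open>p\<close> in the domain of the chart.\<close>
  define p where "p = c \<Zsemi> ?pi \<Zsemi> Proj0 C P G"
  define g where "g = c \<Zsemi> ?pi \<Zsemi> Proj1 C P G"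
  define k where "k = c \<Zsemi> Proj1 C (P \<otimes> G) G"
  have t: "p \<in> Arr C" "Dom C p = (P \<otimes> G) \<otimes> G" "Cod C p = P" "\<rho> p = c" "\<rho> (p \<Zsemi> \<alpha> i) = c"
    "g \<in> Arr C" "Dom C g = (P \<otimes> G) \<otimes> G" "Cod C g = G" "\<rho> g = c"
    "k \<in> Arr C" "Dom C k = (P \<otimes> G) \<otimes> G" "Cod C k = G" "\<rho> k = c"
    unfolding p_def g_def k_def using c by simp_all
  have cc: "c \<Zsemi> c = c" using rst_self[OF c(2)] c(5) by simp
  have pg: "\<langle>p, g\<rangle> = c \<Zsemi> ?pi" unfolding p_def g_def using c by (intro cpair_eta) simp_all
  let ?h = "p \<Zsemi> \<alpha> i \<Zsemi> Proj1 C M G"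
  note V1 = action_value[of i p g]
  note V2 = action_value[of i "\<langle>p, g\<rangle> \<Zsemi> r" k]
  note V3 = action_value[of i p "\<langle>g, k\<rangle> \<Zsemi> m"]
  have eq: "\<langle>\<langle>p, g\<rangle> \<Zsemi> r, k\<rangle> \<Zsemi> r = \<langle>p, \<langle>g, k\<rangle> \<Zsemi> m\<rangle> \<Zsemi> r"
  proof (rule fibre_eqI[of i])
    have "\<langle>\<langle>p, g\<rangle> \<Zsemi> r, k\<rangle> \<Zsemi> r \<Zsemi> \<alpha> i \<Zsemi> Proj1 C M G = \<langle>\<langle>?h, g\<rangle> \<Zsemi> m, k\<rangle> \<Zsemi> m"
      using V1 V2 t c cc by simp
    also have "\<dots> = \<langle>?h, \<langle>g, k\<rangle> \<Zsemi> m\<rangle> \<Zsemi> m" using t c by (intro mult_assoc) simp_all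
    also have "\<dots> = \<langle>p, \<langle>g, k\<rangle> \<Zsemi> m\<rangle> \<Zsemi> r \<Zsemi> \<alpha> i \<Zsemi> Proj1 C M G"
      using V3 t c cc by simp
    finally show "\<langle>\<langle>p, g\<rangle> \<Zsemi> r, k\<rangle> \<Zsemi> r \<Zsemi> \<alpha> i \<Zsemi> Proj1 C M G =
      \<langle>p, \<langle>g, k\<rangle> \<Zsemi> m\<rangle> \<Zsemi> r \<Zsemi> \<alpha> i \<Zsemi> Proj1 C M G" .
  qed (use V1 V2 V3 t c cc in simp_all)
  have "c \<Zsemi> ?L = \<langle>\<langle>p, g\<rangle> \<Zsemi> r, k\<rangle> \<Zsemi> r" unfolding pg k_def using c by simp
  moreover have "c \<Zsemi> ?R = \<langle>p, \<langle>g, k\<rangle> \<Zsemi> m\<rangle> \<Zsemi> r" unfolding p_def g_def k_def using c by simp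
  ultimately show "c \<Zsemi> ?L = c \<Zsemi> ?R" using eq by simp
qed (simp_all add: action_total)

section \<open>Division\<close>

lemma PP_typing [simp]:
  "apex PP \<in> Obj C" "pr0 PP \<in> Arr C" "Dom C (pr0 PP) = apex PP" "Cod C (pr0 PP) = P" "total C (pr0 PP)"
  "pr1 PP \<in> Arr C" "Dom C (pr1 PP) = apex PP" "Cod C (pr1 PP) = P" "total C (pr1 PP)"
  using pullback by (simp_all add: restriction_pullback_def hom_def)

lemma PP_square: "pr0 PP \<Zsemi> q = pr1 PP \<Zsemi> q"
  using pullback by (simp add: restriction_pullback_def)

lemma PP_square_apply:
  assumes "z \<in> Arr C" "Cod C z = apex PP"
  shows "z \<Zsemi> pr1 PP \<Zsemi> q = z \<Zsemi> pr0 PP \<Zsemi> q"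
  using arg_cong[OF PP_square, of "\<lambda>t. z \<Zsemi> t"] assms by simp

abbreviation d where "d \<equiv> pair C PP (Proj0 C P G) r"

text \<open>The pairing exists because the action preserves the fibres of \<open>q\<close>.\<close>

lemma division_map_is_pairing: "is_pairing C PP (Proj0 C P G) r d"
  unfolding pair_def
  by (rule theI', rule pullback_pairing_ex1[OF pullback]) (simp_all add: action_over_base action_total rst_total)

lemma d_typing [simp]: "d \<in> Arr C" "Dom C d = P \<otimes> G" "Cod C d = apex PP"
  using division_map_is_pairing by (simp_all add: is_pairing_def hom_def)

lemma d_proj: "d \<Zsemi> pr0 PP = Proj0 C P G" "d \<Zsemi> pr1 PP = r"
  using division_map_is_pairing by (simp_all add: is_pairing_def rst_total action_total)

lemma d_apply:
  assumes "z \<in> Arr C" "Cod C z = P \<otimes> G"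
  shows "z \<Zsemi> d \<Zsemi> pr0 PP = z \<Zsemi> Proj0 C P G" "z \<Zsemi> d \<Zsemi> pr1 PP = z \<Zsemi> r"
  using d_proj[THEN arg_cong, of "\<lambda>t. z \<Zsemi> t"] assms by simp_all

lemma d_total [simp]: "total C d"
proof -
  have "\<rho> d = \<rho> (d \<Zsemi> pr0 PP)" by simp
  also have "\<dots> = Id C (P \<otimes> G)" unfolding d_proj by (simp add: rst_total)
  finally show ?thesis by (simp add: total_def)
qed

text \<open>A pair of points of \<open>M \<otimes> G\<close> over one point of \<open>M\<close> is stored as the first point and the fibre
  coordinate of the second.\<close>

lemma triv_pullback_pair:
  assumes "f \<in> Arr C" "g \<in> Arr C" "Dom C f = Dom C g" "Cod C f = M \<otimes> G" "Cod C g = M \<otimes> G"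
    "\<rho> f = \<rho> g" "f \<Zsemi> Proj0 C M G = g \<Zsemi> Proj0 C M G"
  shows "pair C (triv_pullback C M G) f g = \<langle>f, g \<Zsemi> Proj1 C M G\<rangle>"
proof -
  have s: "\<rho> g \<Zsemi> f = f" "\<rho> f \<Zsemi> g = g" using rst_self[of f] rst_self[of g] assms by simp_all
  have g: "\<langle>g \<Zsemi> Proj0 C M G, g \<Zsemi> Proj1 C M G\<rangle> = g" using assms by (intro cpair_eta) simp_all
  show ?thesis unfolding pair_def
  proof (rule the_equality)
    show "is_pairing C (triv_pullback C M G) f g \<langle>f, g \<Zsemi> Proj1 C M G\<rangle>"
      using assms s g by (simp add: is_pairing_def triv_pullback_def Let_def hom_def)
    fix h assume "is_pairing C (triv_pullback C M G) f g h"
    then have h: "h \<in> Arr C" "Dom C h = Dom C f" "Cod C h = (M \<otimes> G) \<otimes> G"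
      "h \<Zsemi> Proj0 C (M \<otimes> G) G = f"
      and h1: "h \<Zsemi> \<langle>Proj0 C (M \<otimes> G) G \<Zsemi> Proj0 C M G, Proj1 C (M \<otimes> G) G\<rangle> = g"
      using s by (simp_all add: is_pairing_def triv_pullback_def Let_def hom_def)
    have "\<rho> (h \<Zsemi> Proj0 C (M \<otimes> G) G) = \<rho> h" using h by (intro rst_comp_total) simp_all
    then have rf: "\<rho> f = \<rho> h" using h by simp
    have "g \<Zsemi> Proj1 C M G = h \<Zsemi> Proj1 C (M \<otimes> G) G"
      unfolding h1[symmetric] using h rf assms(1,4) by simp
    then show "h = \<langle>f, g \<Zsemi> Proj1 C M G\<rangle>"
      using cpair_eta[of h "M \<otimes> G" G] h by simp
  qed
qed

abbreviation chart_division where "chart_division i \<equiv> division_part C G m \<iota> M PP (\<alpha> i)"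

lemma chart_domain_PP:
  assumes "i \<in> I" "z \<in> Arr C" "Cod C z = apex PP"
  shows "\<rho> (z \<Zsemi> pr1 PP \<Zsemi> \<alpha> i) = \<rho> (z \<Zsemi> pr0 PP \<Zsemi> \<alpha> i)"
  using assms chart_domain[of i "z \<Zsemi> pr0 PP"] chart_domain[of i "z \<Zsemi> pr1 PP"] PP_square_apply[of z]
  by simp

text \<open>The map sending \<open>(x, h, h')\<close> to \<open>(x, h, h\<^sup>-\<^sup>1 h')\<close>.\<close>

definition fibre_difference where
  "fibre_difference =
     \<langle>\<langle>Proj0 C (M \<otimes> G) G \<Zsemi> Proj0 C M G, Proj0 C (M \<otimes> G) G \<Zsemi> Proj1 C M G\<rangle>,
       \<langle>Proj0 C (M \<otimes> G) G \<Zsemi> Proj1 C M G \<Zsemi> \<iota>, Proj1 C (M \<otimes> G) G\<rangle> \<Zsemi> m\<rangle>"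

lemma fibre_difference_typing [simp]:
  "fibre_difference \<in> Arr C" "Dom C fibre_difference = (M \<otimes> G) \<otimes> G"
  "Cod C fibre_difference = (M \<otimes> G) \<otimes> G"
  by (simp_all add: fibre_difference_def)

lemma fibre_difference_value:
  assumes "a \<in> Arr C" "Cod C a = M \<otimes> G" "k \<in> Arr C" "Cod C k = G" "Dom C k = Dom C a" "\<rho> k = \<rho> a"
  shows "\<langle>a, k\<rangle> \<Zsemi> fibre_difference = \<langle>a, \<langle>a \<Zsemi> Proj1 C M G \<Zsemi> \<iota>, k\<rangle> \<Zsemi> m\<rangle>"
  using assms cpair_eta[of a M G] by (simp add: fibre_difference_def)

lemma division_part_unfold:
  assumes "i \<in> I"
  shows "chart_division i = \<langle>pr0 PP \<Zsemi> \<alpha> i, pr1 PP \<Zsemi> \<alpha> i \<Zsemi> Proj1 C M G\<rangle> \<Zsemi>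

     fibre_difference \<Zsemi> (pinv C (\<alpha> i) \<times>\<times> Id C G)"
proof -
  have d: "\<rho> (pr1 PP \<Zsemi> \<alpha> i) = \<rho> (pr0 PP \<Zsemi> \<alpha> i)"
    using chart_domain_PP[of i "Id C (apex PP)"] assms by simp
  have "pair C (triv_pullback C M G) (pr0 PP \<Zsemi> \<alpha> i) (pr1 PP \<Zsemi> \<alpha> i) =
      \<langle>pr0 PP \<Zsemi> \<alpha> i, pr1 PP \<Zsemi> \<alpha> i \<Zsemi> Proj1 C M G\<rangle>"
    using assms d chart_base_restricted[of i "pr0 PP"] chart_base_restricted[of i "pr1 PP"] PP_square
    by (intro triv_pullback_pair) simp_all
  then show ?thesis using assms by (simp add: division_part_def Let_def fibre_difference_def)
qed

lemma division_part_typing [simp]: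
  assumes "i \<in> I"
  shows "chart_division i \<in> Arr C" "Dom C (chart_division i) = apex PP" "Cod C (chart_division i) = P \<otimes> G"
  using assms by (simp_all add: division_part_unfold)

text \<open>If \<open>p\<close> and \<open>p'\<close> are two points of one fibre with fibre coordinates \<open>h\<close> and \<open>h'\<close> in the \<open>i\<close>-th
  chart, their quotient is \<open>h\<^sup>-\<^sup>1 h'\<close>.\<close>

lemma division_part_value:
  assumes "i \<in> I" "z \<in> Arr C" "Cod C z = apex PP" "\<rho> (z \<Zsemi> pr0 PP \<Zsemi> \<alpha> i) = \<rho> z"
  shows "z \<Zsemi> chart_division i = \<langle>z \<Zsemi> pr0 PP,
     \<langle>z \<Zsemi> pr0 PP \<Zsemi> \<alpha> i \<Zsemi> Proj1 C M G \<Zsemi> \<iota>, z \<Zsemi> pr1 PP \<Zsemi> \<alpha> i \<Zsemi> Proj1 C M G\<rangle> \<Zsemi> m\<rangle>"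
proof -
  define a where "a = z \<Zsemi> pr0 PP \<Zsemi> \<alpha> i"
  define k where "k = z \<Zsemi> pr1 PP \<Zsemi> \<alpha> i \<Zsemi> Proj1 C M G"
  have t: "a \<in> Arr C" "Dom C a = Dom C z" "Cod C a = M \<otimes> G" "\<rho> a = \<rho> z"
    "k \<in> Arr C" "Dom C k = Dom C z" "Cod C k = G" "\<rho> k = \<rho> z"
    unfolding a_def k_def using assms chart_domain_PP[of i z] by simp_all
  have "z \<Zsemi> chart_division i = \<langle>a, k\<rangle> \<Zsemi> fibre_difference \<Zsemi> (pinv C (\<alpha> i) \<times>\<times> Id C G)"
    unfolding division_part_unfold[OF assms(1)] a_def k_def using assms by simp
  also have "\<langle>a, k\<rangle> \<Zsemi> fibre_difference = \<langle>a, \<langle>a \<Zsemi> Proj1 C M G \<Zsemi> \<iota>, k\<rangle> \<Zsemi> m\<rangle>"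
    using t by (intro fibre_difference_value) simp_all
  also have "\<dots> \<Zsemi> (pinv C (\<alpha> i) \<times>\<times> Id C G) = \<langle>a \<Zsemi> pinv C (\<alpha> i), \<langle>a \<Zsemi> Proj1 C M G \<Zsemi> \<iota>, k\<rangle> \<Zsemi> m\<rangle>"
    using t assms by (simp add: pair_ctimes)
  also have "a \<Zsemi> pinv C (\<alpha> i) = z \<Zsemi> pr0 PP"
    unfolding a_def using assms by (intro comp_pinv_cancel) simp_all
  finally show ?thesis unfolding a_def k_def .
qed

lemma division_part_defined:
  assumes "i \<in> I" "z \<in> Arr C" "Cod C z = apex PP" "\<rho> (z \<Zsemi> chart_division i) = \<rho> z"
  shows "\<rho> (z \<Zsemi> pr0 PP \<Zsemi> \<alpha> i) = \<rho> z"
proof -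
  let ?a = "\<langle>pr0 PP \<Zsemi> \<alpha> i, pr1 PP \<Zsemi> \<alpha> i \<Zsemi> Proj1 C M G\<rangle>" and
    ?b = fibre_difference
  let ?c = "pinv C (\<alpha> i) \<times>\<times> Id C G"
  define a where "a = ?a"
  define b where "b = ?b \<Zsemi> ?c"
  have a: "a \<in> Arr C" "Dom C a = apex PP" "Cod C a = (M \<otimes> G) \<otimes> G" using assms by (simp_all add: a_def)
  have b: "b \<in> Arr C" "Dom C b = (M \<otimes> G) \<otimes> G" using assms by (simp_all add: b_def)
  have "chart_division i = a \<Zsemi> b"
    unfolding division_part_unfold[OF assms(1)] a_def b_def
    using assms by (intro comp_left_nest[symmetric]) simp_all
  then have "\<rho> (z \<Zsemi> a \<Zsemi> b) = \<rho> z" using assms a b by simp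
  then have "\<rho> (z \<Zsemi> a) = \<rho> z" by (rule defined_prefix) (use assms a b in simp_all)
  then show ?thesis unfolding a_def using assms chart_domain_PP[of i z] by simp
qed

text \<open>Acting on \<open>p\<close> by \<open>h\<^sup>-\<^sup>1 h'\<close> turns the fibre coordinate \<open>h\<close> into \<open>h'\<close>, which gives \<open>p'\<close>.\<close>

lemma action_of_division:
  assumes "i \<in> I" "z \<in> Arr C" "Cod C z = apex PP" "\<rho> (z \<Zsemi> pr0 PP \<Zsemi> \<alpha> i) = \<rho> z"
  shows "z \<Zsemi> chart_division i \<Zsemi> d = z"
proof -
  define p where "p = z \<Zsemi> pr0 PP"
  define p' where "p' = z \<Zsemi> pr1 PP"
  define g where "g = \<langle>p \<Zsemi> \<alpha> i \<Zsemi> Proj1 C M G \<Zsemi> \<iota>, p' \<Zsemi> \<alpha> i \<Zsemi> Proj1 C M G\<rangle> \<Zsemi> m"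
  have t: "p \<in> Arr C" "Dom C p = Dom C z" "Cod C p = P" "\<rho> p = \<rho> z" "\<rho> (p \<Zsemi> \<alpha> i) = \<rho> z"
    "p' \<in> Arr C" "Dom C p' = Dom C z" "Cod C p' = P" "\<rho> p' = \<rho> z" "\<rho> (p' \<Zsemi> \<alpha> i) = \<rho> z" "p' \<Zsemi> q = p \<Zsemi> q"
    unfolding p_def p'_def using assms chart_domain_PP[of i z] PP_square_apply[of z] by simp_all
  have g: "g \<in> Arr C" "Dom C g = Dom C z" "Cod C g = G" "\<rho> g = \<rho> z"
    unfolding g_def using t assms by simp_all
  have v: "z \<Zsemi> chart_division i = \<langle>p, g\<rangle>" unfolding g_def p_def p'_def by (rule division_part_value[OF assms])
  note V = action_value[of i p g]
  have r: "\<langle>p, g\<rangle> \<Zsemi> r = p'"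
  proof (rule fibre_eqI[of i])
    have "\<langle>p, g\<rangle> \<Zsemi> r \<Zsemi> \<alpha> i \<Zsemi> Proj1 C M G = \<langle>p \<Zsemi> \<alpha> i \<Zsemi> Proj1 C M G, g\<rangle> \<Zsemi> m"
      using V t g assms by simp
    also have "\<dots> = p' \<Zsemi> \<alpha> i \<Zsemi> Proj1 C M G"
      unfolding g_def using t assms by simp
    finally show "\<langle>p, g\<rangle> \<Zsemi> r \<Zsemi> \<alpha> i \<Zsemi> Proj1 C M G = p' \<Zsemi> \<alpha> i \<Zsemi> Proj1 C M G" .
  qed (use V t g assms in simp_all)
  show ?thesis unfolding v
    by (rule pullback_eqI[OF pullback]) (use r t g assms d_apply[of "\<langle>p, g\<rangle>"] in \<open>simp_all add: p_def[symmetric] p'_def[symmetric]\<close>)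
qed

text \<open>The points \<open>p\<close> and \<open>p g\<close> have fibre coordinates \<open>h\<close> and \<open>h g\<close>, whose quotient is \<open>g\<close>.\<close>

lemma division_of_action:
  assumes "i \<in> I" "z \<in> Arr C" "Cod C z = P \<otimes> G" "\<rho> (z \<Zsemi> Proj0 C P G \<Zsemi> \<alpha> i) = \<rho> z"
  shows "z \<Zsemi> d \<Zsemi> chart_division i = z"
proof -
  define p where "p = z \<Zsemi> Proj0 C P G"
  define g where "g = z \<Zsemi> Proj1 C P G"
  have t: "p \<in> Arr C" "Dom C p = Dom C z" "Cod C p = P" "\<rho> p = \<rho> z" "\<rho> (p \<Zsemi> \<alpha> i) = \<rho> z"
    "g \<in> Arr C" "Dom C g = Dom C z" "Cod C g = G" "\<rho> g = \<rho> z"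
    unfolding p_def g_def using assms by simp_all
  have z: "\<langle>p, g\<rangle> = z" unfolding p_def g_def using assms by (intro cpair_eta) simp_all
  have zd: "z \<Zsemi> d \<Zsemi> pr0 PP = p" "z \<Zsemi> d \<Zsemi> pr1 PP = \<langle>p, g\<rangle> \<Zsemi> r"
    using d_apply[of z] assms by (simp_all add: p_def z[unfolded p_def])
  have "z \<Zsemi> d \<Zsemi> chart_division i = \<langle>p, \<langle>p \<Zsemi> \<alpha> i \<Zsemi> Proj1 C M G \<Zsemi> \<iota>, \<langle>p, g\<rangle> \<Zsemi> r \<Zsemi> \<alpha> i \<Zsemi> Proj1 C M G\<rangle> \<Zsemi> m\<rangle>"
    using division_part_value[of i "z \<Zsemi> d"] zd assms t by simp
  also have "\<dots> = \<langle>p, g\<rangle>" using action_value(1)[of i p g] t assms by simp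
  finally show ?thesis unfolding z .
qed

text \<open>Compatibility comes from the injectivity of \<open>d\<close> rather than from the transition functions: at an
  element where both parts are defined, their values are preimages of it under \<open>d\<close>, and over a chart
  \<open>d\<close> is injective by \<open>division_of_action\<close>.\<close>

lemma division_parts_compatible:
  assumes "i \<in> I" "j \<in> I"
  shows "compatible C (chart_division i) (chart_division j)"
proof (rule compatible_by_elements)
  fix z assume z: "z \<in> Arr C" "Cod C z = Dom C (chart_division i)" "\<rho> (z \<Zsemi> chart_division i) = \<rho> z" "\<rho> (z \<Zsemi> chart_division j) = \<rho> z"
  have zt: "Cod C z = apex PP" using z assms by simp
  have d: "\<rho> (z \<Zsemi> pr0 PP \<Zsemi> \<alpha> i) = \<rho> z" "\<rho> (z \<Zsemi> pr0 PP \<Zsemi> \<alpha> j) = \<rho> z"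
    using division_part_defined z zt assms by simp_all
  note E = action_of_division[OF assms(1) z(1) zt d(1)] action_of_division[OF assms(2) z(1) zt d(2)]
  have p: "z \<Zsemi> chart_division j \<Zsemi> Proj0 C P G = z \<Zsemi> pr0 PP"
    using d_apply(1)[of "z \<Zsemi> chart_division j"] E assms z zt by simp
  have "z \<Zsemi> chart_division j \<Zsemi> d \<Zsemi> chart_division i = z \<Zsemi> chart_division j"
    by (rule division_of_action) (use assms z zt p d in simp_all)
  then show "z \<Zsemi> chart_division i = z \<Zsemi> chart_division j" using E by simp
qed (use assms in simp_all)

abbreviation dstar where "dstar \<equiv> bundle_division C G m \<iota> P M PP I \<alpha>"

lemma division_is_join: "is_join C (apex PP) (P \<otimes> G) (chart_division ` I) dstar"
  unfolding bundle_division_def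
  by (rule is_join_join) (auto simp: hom_def intro: division_parts_compatible)

lemma dstar_typing [simp]: "dstar \<in> Arr C" "Dom C dstar = apex PP" "Cod C dstar = P \<otimes> G"
  using division_is_join by (simp_all add: is_join_def hom_def)

lemma division_value:
  assumes "i \<in> I" "z \<in> Arr C" "Cod C z = apex PP" "\<rho> (z \<Zsemi> pr0 PP \<Zsemi> \<alpha> i) = \<rho> z"
  shows "z \<Zsemi> dstar = z \<Zsemi> chart_division i" "\<rho> (z \<Zsemi> chart_division i) = \<rho> z"
proof -
  show d: "\<rho> (z \<Zsemi> chart_division i) = \<rho> z"
    using rst_comp_total[of d "z \<Zsemi> chart_division i"] action_of_division[OF assms] assms by simp
  have "rle C (chart_division i) dstar" using division_is_join assms(1) by (simp add: is_join_def)
  then show "z \<Zsemi> dstar = z \<Zsemi> chart_division i" by (rule rle_apply) (use assms d in simp_all)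
qed

lemma division_inverse: "total_inverse C d dstar"
proof -
  have tot: "total C dstar"
    by (rule chartwise_total[where p = "pr0 PP"]) (use division_value in simp_all)
  have l: "dstar \<Zsemi> d = Id C (apex PP)"
  proof (rule chartwise_equality[where p = "pr0 PP"])
    fix i c assume c: "i \<in> I" "c \<in> Arr C" "Dom C c = Dom C (pr0 PP)" "Cod C c = Dom C (pr0 PP)"
      "\<rho> c = c" "\<rho> (c \<Zsemi> pr0 PP \<Zsemi> \<alpha> i) = c"
    then show "c \<Zsemi> (dstar \<Zsemi> d) = c \<Zsemi> Id C (apex PP)"
      using division_value(1)[of i c] action_of_division[of i c] by simp
  qed simp_all
  have r: "d \<Zsemi> dstar = Id C (P \<otimes> G)"
  proof (rule chartwise_equality[where p = "Proj0 C P G"])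
    fix i c assume c: "i \<in> I" "c \<in> Arr C" "Dom C c = Dom C (Proj0 C P G)" "Cod C c = Dom C (Proj0 C P G)"
      "\<rho> c = c" "\<rho> (c \<Zsemi> Proj0 C P G \<Zsemi> \<alpha> i) = c"
    then show "c \<Zsemi> (d \<Zsemi> dstar) = c \<Zsemi> Id C (P \<otimes> G)"
      using division_value(1)[of i "c \<Zsemi> d"] division_of_action[of i c] d_apply[of c] by simp
  qed simp_all
  show ?thesis using tot l r by (simp add: total_inverse_def hom_def)
qed

end

section \<open>Slice categories\<close>

context restriction_category
begin

lemma slice_sel [simp]:
  "x \<in> Obj (slice C M) \<longleftrightarrow> snd x \<in> hom C (fst x) M"
  "Dom (slice C M) (x, \<phi>, y) = x" "Cod (slice C M) (x, \<phi>, y) = y"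
  "Id (slice C M) x = (x, Id C (fst x), x)"
  "Comp (slice C M) (x, \<phi>, y) (y', \<psi>, z) = (x, \<phi> \<Zsemi> \<psi>, z)"
  "Rst (slice C M) (x, \<phi>, y) = (x, \<rho> \<phi>, x)"
  by (auto simp: slice_def)

lemma slice_Arr_iff:
  "(x, \<phi>, y) \<in> Arr (slice C M) \<longleftrightarrow> snd x \<in> hom C (fst x) M \<and> snd y \<in> hom C (fst y) M
     \<and> \<phi> \<in> hom C (fst x) (fst y) \<and> rle C (\<phi> \<Zsemi> snd y) (snd x)"
  by (cases x; cases y) (simp add: slice_def)

lemma slice_hom_iff:
  "F \<in> hom (slice C M) x y \<longleftrightarrow> (\<exists>\<phi>. F = (x, \<phi>, y) \<and> (x, \<phi>, y) \<in> Arr (slice C M))"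
  by (cases F) (auto simp: hom_def)

lemma slice_total_iff [simp]:
  "\<phi> \<in> hom C (fst x) (fst y) \<Longrightarrow> total (slice C M) (x, \<phi>, y) \<longleftrightarrow> total C \<phi>"
  by (auto simp: total_def hom_def)

text \<open>For a total structure map of the target the inequality defining morphisms of the slice is an
  equation.\<close>

lemma slice_ArrD_total:
  assumes "(x, \<phi>, y) \<in> Arr (slice C M)" "total C (snd y)"
  shows "\<phi> \<Zsemi> snd y = \<rho> \<phi> \<Zsemi> snd x"
  using assms by (auto simp: slice_Arr_iff rle_def hom_def)

lemma slice_ArrI_total:
  assumes "snd x \<in> hom C (fst x) M" "snd y \<in> hom C (fst y) M" "\<phi> \<in> hom C (fst x) (fst y)"
    "total C (snd y)" "\<phi> \<Zsemi> snd y = \<rho> \<phi> \<Zsemi> snd x"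
  shows "(x, \<phi>, y) \<in> Arr (slice C M)"
proof -
  have "\<rho> (\<phi> \<Zsemi> snd y) = \<rho> \<phi>" using assms by (intro rst_comp_total) (simp_all add: hom_def)
  then show ?thesis using assms by (simp add: slice_Arr_iff rle_def)
qed

lemma slice_comp:
  assumes "(x, \<phi>, y) \<in> Arr (slice C M)" "(y, \<psi>, z) \<in> Arr (slice C M)"
  shows "(x, \<phi> \<Zsemi> \<psi>, z) \<in> Arr (slice C M)"
proof -
  have t: "\<phi> \<in> Arr C" "Dom C \<phi> = fst x" "Cod C \<phi> = fst y" "\<psi> \<in> Arr C" "Dom C \<psi> = fst y" "Cod C \<psi> = fst z"
    "snd x \<in> Arr C" "Dom C (snd x) = fst x" "Cod C (snd x) = M"
    "snd y \<in> Arr C" "Dom C (snd y) = fst y" "Cod C (snd y) = M"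
    "snd z \<in> Arr C" "Dom C (snd z) = fst z" "Cod C (snd z) = M"
    "rle C (\<phi> \<Zsemi> snd y) (snd x)" "rle C (\<psi> \<Zsemi> snd z) (snd y)"
    using assms by (simp_all add: slice_Arr_iff hom_def)
  have "rle C (\<phi> \<Zsemi> (\<psi> \<Zsemi> snd z)) (\<phi> \<Zsemi> snd y)" by (rule rle_precomp) (use t in simp_all)
  then have "rle C (\<phi> \<Zsemi> (\<psi> \<Zsemi> snd z)) (snd x)" by (rule rle_trans) (use t in simp_all)
  then show ?thesis using t by (simp add: slice_Arr_iff hom_def)
qed

lemma rle_rst:
  assumes "f \<in> Arr C" "g \<in> Arr C" "Dom C f = Dom C g"
  shows "rle C (\<rho> f \<Zsemi> g) g"
proof -
  have "\<rho> (\<rho> f \<Zsemi> g) \<Zsemi> g = \<rho> f \<Zsemi> (\<rho> g \<Zsemi> g)"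
    using assms comp_left_nest[of "\<rho> f" "\<rho> g" g] by (simp del: rst_self comp_left_nest)
  then show ?thesis using assms by (simp add: rle_def)
qed

lemma slice_Rst:
  assumes "(x, \<phi>, y) \<in> Arr (slice C M)"
  shows "(x, \<rho> \<phi>, x) \<in> Arr (slice C M)"
  using assms rle_rst[of \<phi> "snd x"] by (simp add: slice_Arr_iff hom_def)

lemma slice_restriction_category: "restriction_category (slice C M)"
proof
  fix F assume "F \<in> Arr (slice C M)"
  then obtain x \<phi> y where F: "F = (x, \<phi>, y)" "(x, \<phi>, y) \<in> Arr (slice C M)" by (cases F) auto
  then show "Dom (slice C M) F \<in> Obj (slice C M)" "Cod (slice C M) F \<in> Obj (slice C M)"
    by (simp_all add: slice_Arr_iff)
next
  fix A assume "A \<in> Obj (slice C M)"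
  then show "Id (slice C M) A \<in> hom (slice C M) A A"
    using rst_self[of "snd A"] Dom_Obj[of "snd A"] by (auto simp: slice_hom_iff slice_Arr_iff hom_def rle_def)
next
  fix F A B D E K assume F: "F \<in> hom (slice C M) A B"
  then obtain \<phi> where f: "F = (A, \<phi>, B)" "(A, \<phi>, B) \<in> Arr (slice C M)" by (auto simp: slice_hom_iff)
  then have f': "\<phi> \<in> hom C (fst A) (fst B)" by (simp add: slice_Arr_iff)
  show "Comp (slice C M) (Id (slice C M) A) F = F" "Comp (slice C M) F (Id (slice C M) B) = F"
    "Comp (slice C M) (Rst (slice C M) F) F = F"
    using f f' by (simp_all add: id_left id_right R1)
  show "Rst (slice C M) F \<in> hom (slice C M) A A" using f slice_Rst by (simp add: slice_hom_iff)
  { assume "K \<in> hom (slice C M) B D"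
    then obtain \<psi> where k: "K = (B, \<psi>, D)" "(B, \<psi>, D) \<in> Arr (slice C M)" by (auto simp: slice_hom_iff)
    then have k': "\<psi> \<in> hom C (fst B) (fst D)" by (simp add: slice_Arr_iff)
    show "Comp (slice C M) F K \<in> hom (slice C M) A D"
      using f k slice_comp by (simp add: slice_hom_iff)
    show "Comp (slice C M) F (Rst (slice C M) K) = Comp (slice C M) (Rst (slice C M) (Comp (slice C M) F K)) F"
      using f k R4[OF f' k'] by simp
    fix L assume "L \<in> hom (slice C M) D E"
    then obtain \<chi> where l: "L = (D, \<chi>, E)" "(D, \<chi>, E) \<in> Arr (slice C M)" by (auto simp: slice_hom_iff)
    then have l': "\<chi> \<in> hom C (fst D) (fst E)" by (simp add: slice_Arr_iff)
    show "Comp (slice C M) (Comp (slice C M) F K) L = Comp (slice C M) F (Comp (slice C M) K L)"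
      using f k l comp_assoc[OF f' k' l'] by simp
  }
  { assume "K \<in> hom (slice C M) A D"
    then obtain \<psi> where k: "K = (A, \<psi>, D)" "(A, \<psi>, D) \<in> Arr (slice C M)" by (auto simp: slice_hom_iff)
    then have k': "\<psi> \<in> hom C (fst A) (fst D)" by (simp add: slice_Arr_iff)
    show "Comp (slice C M) (Rst (slice C M) K) (Rst (slice C M) F) = Comp (slice C M) (Rst (slice C M) F) (Rst (slice C M) K)"
      "Rst (slice C M) (Comp (slice C M) (Rst (slice C M) K) F) = Comp (slice C M) (Rst (slice C M) K) (Rst (slice C M) F)"
      using f k R2[OF f' k'] R3[OF f' k'] by simp_all
  }
qed

text \<open>Morphisms \<open>\<phi>\<close> and \<open>\<psi>\<close> of the slice from \<open>z\<close> to objects with total structure maps satisfy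
  \<open>\<phi> \<Zsemi> f = \<rho> \<phi> \<Zsemi> snd z\<close> and \<open>\<psi> \<Zsemi> g = \<rho> \<psi> \<Zsemi> snd z\<close>, so they agree over \<open>M\<close> wherever both are
  defined, and the pullback of \<open>f\<close> and \<open>g\<close> classifies exactly such pairs. Hence all products that
  enter the definition of a torsor in the slice are instances of one construction, and their pairings
  are computed in \<open>C\<close>.\<close>

lemma slice_product:
  assumes pb: "restriction_pullback C f g K" and M: "Cod C f = M"
  shows "restriction_product (slice C M) (Dom C f, f) (Dom C g, g) (slice_span C K (Dom C f, f) (Dom C g, g))"
      (is "restriction_product _ ?x ?y ?S")
    and "\<lbrakk>(z, \<phi>, (Dom C f, f)) \<in> Arr (slice C M); (z, \<psi>, (Dom C g, g)) \<in> Arr (slice C M)\<rbrakk> \<Longrightarrow>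
      pair (slice C M) (slice_span C K (Dom C f, f) (Dom C g, g)) (z, \<phi>, (Dom C f, f)) (z, \<psi>, (Dom C g, g)) =
        (z, pair C K \<phi> \<psi>, (apex K, pr0 K \<Zsemi> f))"
proof -
  note pt = pullback_typing[OF pb]
  note pt(1-14) [simp]
  let ?w = "(apex K, pr0 K \<Zsemi> f)"
  have S: "apex ?S = ?w" "pr0 ?S = (?w, pr0 K, ?x)" "pr1 ?S = (?w, pr1 K, ?y)"
    by (simp_all add: slice_span_def Let_def)
  have key: "(\<exists>!H. is_pairing (slice C M) ?S (z, \<phi>, ?x) (z, \<psi>, ?y) H) \<and>
      is_pairing (slice C M) ?S (z, \<phi>, ?x) (z, \<psi>, ?y) (z, pair C K \<phi> \<psi>, ?w)"
    if a: "(z, \<phi>, ?x) \<in> Arr (slice C M)" "(z, \<psi>, ?y) \<in> Arr (slice C M)" for z \<phi> \<psi>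
  proof -
    have t: "\<phi> \<in> Arr C" "Dom C \<phi> = fst z" "Cod C \<phi> = Dom C f" "\<psi> \<in> Arr C" "Dom C \<psi> = fst z" "Cod C \<psi> = Dom C g"
      "snd z \<in> Arr C" "Dom C (snd z) = fst z" "Cod C (snd z) = M"
      using a by (simp_all add: slice_Arr_iff hom_def)
    have b: "\<phi> \<Zsemi> f = \<rho> \<phi> \<Zsemi> snd z" "\<psi> \<Zsemi> g = \<rho> \<psi> \<Zsemi> snd z"
      using a slice_ArrD_total[of z \<phi> ?x M] slice_ArrD_total[of z \<psi> ?y M] by simp_all
    have l: "\<rho> \<psi> \<Zsemi> \<phi> \<Zsemi> f = \<rho> \<psi> \<Zsemi> \<rho> \<phi> \<Zsemi> snd z"
      using comp_left_nest[of "\<rho> \<psi>" \<phi> f] b(1) t by simp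
    have r: "\<rho> \<phi> \<Zsemi> \<psi> \<Zsemi> g = \<rho> \<phi> \<Zsemi> \<rho> \<psi> \<Zsemi> snd z"
      using comp_left_nest[of "\<rho> \<phi>" \<psi> g] b(2) t by simp
    have ex1: "\<exists>!h. is_pairing C K \<phi> \<psi> h"
      by (rule pullback_pairing_ex1[OF pb]) (use t l r rst_commute[of \<phi> \<psi>] in simp_all)
    have iff: "is_pairing (slice C M) ?S (z, \<phi>, ?x) (z, \<psi>, ?y) H \<longleftrightarrow>
        (\<exists>h. H = (z, h, ?w) \<and> is_pairing C K \<phi> \<psi> h)" for H
    proof -
      have "(z, h, ?w) \<in> Arr (slice C M)" if h: "is_pairing C K \<phi> \<psi> h" for h
      proof -
        have h': "h \<in> Arr C" "Dom C h = fst z" "Cod C h = apex K" "h \<Zsemi> pr0 K = \<rho> \<psi> \<Zsemi> \<phi>"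
          using h t by (simp_all add: is_pairing_def hom_def)
        have "\<rho> h = \<rho> (h \<Zsemi> pr0 K)" using h'(1-3) by simp
        also have "\<dots> = \<rho> \<psi> \<Zsemi> \<rho> \<phi>" unfolding h'(4) using t by simp
        finally have "h \<Zsemi> pr0 K \<Zsemi> f = \<rho> h \<Zsemi> snd z" unfolding h'(4) using l by simp
        then show ?thesis using t h' by (intro slice_ArrI_total) (simp_all add: hom_def M)
      qed
      then show ?thesis
        by (cases H) (auto simp: is_pairing_def S slice_hom_iff slice_Arr_iff t)
    qed
    have "is_pairing C K \<phi> \<psi> (pair C K \<phi> \<psi>)" unfolding pair_def by (rule theI'[OF ex1])
    then show ?thesis using ex1 unfolding iff by auto
  qed
  show "\<lbrakk>(z, \<phi>, ?x) \<in> Arr (slice C M); (z, \<psi>, ?y) \<in> Arr (slice C M)\<rbrakk> \<Longrightarrow>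
      pair (slice C M) ?S (z, \<phi>, ?x) (z, \<psi>, ?y) = (z, pair C K \<phi> \<psi>, ?w)"
    unfolding pair_def[of "slice C M"] using key[of z \<phi> \<psi>] by (intro the1_equality) simp_all
  have w: "(?w, pr0 K, ?x) \<in> Arr (slice C M)" "(?w, pr1 K, ?y) \<in> Arr (slice C M)"
    using pt(15) by (intro slice_ArrI_total; simp add: hom_def M rst_total)+
  show "restriction_product (slice C M) ?x ?y ?S"
    unfolding restriction_product_def S
  proof (intro conjI ballI)
    fix Z F L assume "F \<in> hom (slice C M) Z ?x" "L \<in> hom (slice C M) Z ?y"
    then obtain \<phi> \<psi> where "F = (Z, \<phi>, ?x)" "L = (Z, \<psi>, ?y)"
      and a: "(Z, \<phi>, ?x) \<in> Arr (slice C M)" "(Z, \<psi>, ?y) \<in> Arr (slice C M)"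
      unfolding slice_hom_iff by blast
    then show "\<exists>!H. is_pairing (slice C M) ?S F L H" using key[OF a] by simp
  qed (use w in \<open>simp_all add: slice_hom_iff hom_def M\<close>)
qed

end

section \<open>Trivial bundles in the slice\<close>

context cartesian_restriction_category
begin

lemma rst_proj [simp]:
  assumes "A \<in> Obj C" "B \<in> Obj C"
  shows "\<rho> (Proj0 C A B) = Id C (A \<otimes> B)" "\<rho> (Proj1 C A B) = Id C (A \<otimes> B)"
  using assms by (simp_all add: rst_total)

lemma comp_ctimes:
  assumes "x \<in> Arr C" "Cod C x = Dom C f \<otimes> Dom C g" "f \<in> Arr C" "g \<in> Arr C"
  shows "x \<Zsemi> (f \<times>\<times> g) = \<langle>x \<Zsemi> Proj0 C (Dom C f) (Dom C g) \<Zsemi> f, x \<Zsemi> Proj1 C (Dom C f) (Dom C g) \<Zsemi> g\<rangle>"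
  using assms by (simp add: ctimes_def)

lemma ctimes_total [simp]:
  "f \<in> Arr C \<Longrightarrow> g \<in> Arr C \<Longrightarrow> total C f \<Longrightarrow> total C g \<Longrightarrow> total C (f \<times>\<times> g)"
  by (simp add: ctimes_def)

lemma ctimes_proj [simp]:
  assumes "f \<in> Arr C" "g \<in> Arr C" "total C f" "total C g" "Cod C f = A" "Cod C g = B"
  shows "(f \<times>\<times> g) \<Zsemi> Proj0 C A B = Proj0 C (Dom C f) (Dom C g) \<Zsemi> f"
    "(f \<times>\<times> g) \<Zsemi> Proj1 C A B = Proj1 C (Dom C f) (Dom C g) \<Zsemi> g"
  using assms by (simp_all add: ctimes_def)

text \<open>The product of \<open>(M \<otimes> A, \<pi>\<^sub>0)\<close> and \<open>(M \<otimes> B, \<pi>\<^sub>0)\<close> in the slice is given by the span below, viewed as a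
  pullback over \<open>M\<close>.\<close>

definition triv_prod_span where
  "triv_prod_span M A B = \<lparr>apex = M \<otimes> A \<otimes> B, pr0 = Id C M \<times>\<times> Proj0 C A B, pr1 = Id C M \<times>\<times> Proj1 C A B\<rparr>"

definition times_triv_span where
  "times_triv_span G f = \<lparr>apex = Dom C f \<otimes> G, pr0 = Proj0 C (Dom C f) G, pr1 = f \<times>\<times> Id C G\<rparr>"

lemma triv_prod_span_pullback:
  assumes [simp]: "M \<in> Obj C" "A \<in> Obj C" "B \<in> Obj C"
  shows "restriction_pullback C (Proj0 C M A) (Proj0 C M B) (triv_prod_span M A B)"
proof -
  have "\<exists>!h. h \<in> hom C Z (M \<otimes> A \<otimes> B) \<and> h \<Zsemi> (Id C M \<times>\<times> Proj0 C A B) = r \<and> h \<Zsemi> (Id C M \<times>\<times> Proj1 C A B) = s"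
    if h: "r \<in> hom C Z (M \<otimes> A)" "s \<in> hom C Z (M \<otimes> B)" "r \<Zsemi> Proj0 C M A = s \<Zsemi> Proj0 C M B" for Z r s
  proof -
    have t: "r \<in> Arr C" "Dom C r = Z" "Cod C r = M \<otimes> A" "s \<in> Arr C" "Dom C s = Z" "Cod C s = M \<otimes> B"
      using h by (simp_all add: hom_def)
    have "\<rho> (r \<Zsemi> Proj0 C M A) = \<rho> r" "\<rho> (s \<Zsemi> Proj0 C M B) = \<rho> s" using t by simp_all
    then have rs: "\<rho> s = \<rho> r" using h(3) by simp
    show ?thesis
    proof (rule ex1I[of _ "\<langle>r \<Zsemi> Proj0 C M A, \<langle>r \<Zsemi> Proj1 C M A, s \<Zsemi> Proj1 C M B\<rangle>\<rangle>"])
      show "\<langle>r \<Zsemi> Proj0 C M A, \<langle>r \<Zsemi> Proj1 C M A, s \<Zsemi> Proj1 C M B\<rangle>\<rangle> \<in> hom C Z (M \<otimes> A \<otimes> B) \<and>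
        \<langle>r \<Zsemi> Proj0 C M A, \<langle>r \<Zsemi> Proj1 C M A, s \<Zsemi> Proj1 C M B\<rangle>\<rangle> \<Zsemi> (Id C M \<times>\<times> Proj0 C A B) = r \<and>
        \<langle>r \<Zsemi> Proj0 C M A, \<langle>r \<Zsemi> Proj1 C M A, s \<Zsemi> Proj1 C M B\<rangle>\<rangle> \<Zsemi> (Id C M \<times>\<times> Proj1 C A B) = s"
        using t rs cpair_eta[of r M A] cpair_eta[of s M B] h(3) by (simp add: pair_ctimes hom_def)
      fix h assume "h \<in> hom C Z (M \<otimes> A \<otimes> B) \<and> h \<Zsemi> (Id C M \<times>\<times> Proj0 C A B) = r \<and> h \<Zsemi> (Id C M \<times>\<times> Proj1 C A B) = s"
      then have h: "h \<in> Arr C" "Dom C h = Z" "Cod C h = M \<otimes> A \<otimes> B" and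
        r: "r = h \<Zsemi> (Id C M \<times>\<times> Proj0 C A B)" and s: "s = h \<Zsemi> (Id C M \<times>\<times> Proj1 C A B)"
        by (auto simp: hom_def)
      show "h = \<langle>r \<Zsemi> Proj0 C M A, \<langle>r \<Zsemi> Proj1 C M A, s \<Zsemi> Proj1 C M B\<rangle>\<rangle>"
        unfolding r s using h cpair_eta[of h M "A \<otimes> B"] cpair_eta[of "h \<Zsemi> Proj1 C M (A \<otimes> B)" A B]
        by (simp add: comp_ctimes)
    qed
  qed
  note ex1 = this
  show ?thesis unfolding restriction_pullback_def
  proof (intro conjI ballI impI)
    fix Z r s
    assume "r \<in> hom C Z (Dom C (Proj0 C M A))" "s \<in> hom C Z (Dom C (Proj0 C M B))" "r \<Zsemi> Proj0 C M A = s \<Zsemi> Proj0 C M B"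
    then show "\<exists>!h. h \<in> hom C Z (apex (triv_prod_span M A B)) \<and> h \<Zsemi> pr0 (triv_prod_span M A B) = r \<and> h \<Zsemi> pr1 (triv_prod_span M A B) = s"
      using ex1[of r Z s] by (simp add: triv_prod_span_def)
  qed (simp_all add: triv_prod_span_def hom_def)
qed

lemma triv_prod_span_pair:
  assumes [simp]: "M \<in> Obj C" "A \<in> Obj C" "B \<in> Obj C"
    and t: "r \<in> Arr C" "s \<in> Arr C" "Dom C r = Dom C s" "Cod C r = M \<otimes> A" "Cod C s = M \<otimes> B"
      "\<rho> r = \<rho> s" "r \<Zsemi> Proj0 C M A = s \<Zsemi> Proj0 C M B"
  shows "pair C (triv_prod_span M A B) r s = \<langle>r \<Zsemi> Proj0 C M A, \<langle>r \<Zsemi> Proj1 C M A, s \<Zsemi> Proj1 C M B\<rangle>\<rangle>"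
  by (rule pullback_pair_eq[OF triv_prod_span_pullback[of M A B]])
    (use t cpair_eta[of r M A] cpair_eta[of s M B] in \<open>simp_all add: triv_prod_span_def pair_ctimes hom_def\<close>)

lemma times_triv_span_pullback:
  assumes f: "f \<in> Arr C" "Cod C f = M" "total C f" and [simp]: "G \<in> Obj C"
  shows "restriction_pullback C f (Proj0 C M G) (times_triv_span G f)"
proof -
  note f [simp]
  have M [simp]: "M \<in> Obj C" using Cod_Obj[OF f(1)] by simp
  have "\<exists>!h. h \<in> hom C Z (Dom C f \<otimes> G) \<and> h \<Zsemi> Proj0 C (Dom C f) G = r \<and> h \<Zsemi> (f \<times>\<times> Id C G) = s"
    if h: "r \<in> hom C Z (Dom C f)" "s \<in> hom C Z (M \<otimes> G)" "r \<Zsemi> f = s \<Zsemi> Proj0 C M G" for Z r s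
  proof -
    have t: "r \<in> Arr C" "Dom C r = Z" "Cod C r = Dom C f" "s \<in> Arr C" "Dom C s = Z" "Cod C s = M \<otimes> G"
      using h by (simp_all add: hom_def)
    have "\<rho> (r \<Zsemi> f) = \<rho> r" "\<rho> (s \<Zsemi> Proj0 C M G) = \<rho> s" using t by simp_all
    then have rs: "\<rho> s = \<rho> r" using h(3) by simp
    show ?thesis
    proof (rule ex1I[of _ "\<langle>r, s \<Zsemi> Proj1 C M G\<rangle>"])
      show "\<langle>r, s \<Zsemi> Proj1 C M G\<rangle> \<in> hom C Z (Dom C f \<otimes> G) \<and> \<langle>r, s \<Zsemi> Proj1 C M G\<rangle> \<Zsemi> Proj0 C (Dom C f) G = r \<and>
        \<langle>r, s \<Zsemi> Proj1 C M G\<rangle> \<Zsemi> (f \<times>\<times> Id C G) = s"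
        using t rs cpair_eta[of s M G] h(3) by (simp add: pair_ctimes hom_def)
      fix h assume "h \<in> hom C Z (Dom C f \<otimes> G) \<and> h \<Zsemi> Proj0 C (Dom C f) G = r \<and> h \<Zsemi> (f \<times>\<times> Id C G) = s"
      then have h: "h \<in> Arr C" "Dom C h = Z" "Cod C h = Dom C f \<otimes> G" and
        r: "r = h \<Zsemi> Proj0 C (Dom C f) G" and s: "s = h \<Zsemi> (f \<times>\<times> Id C G)"
        by (auto simp: hom_def)
      show "h = \<langle>r, s \<Zsemi> Proj1 C M G\<rangle>"
        unfolding r s using h cpair_eta[of h "Dom C f" G] by (simp add: comp_ctimes)
    qed
  qed
  note ex1 = this
  show ?thesis unfolding restriction_pullback_def
  proof (intro conjI ballI impI)
    fix Z r s
    assume "r \<in> hom C Z (Dom C f)" "s \<in> hom C Z (Dom C (Proj0 C M G))" "r \<Zsemi> f = s \<Zsemi> Proj0 C M G"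
    then show "\<exists>!h. h \<in> hom C Z (apex (times_triv_span G f)) \<and> h \<Zsemi> pr0 (times_triv_span G f) = r \<and> h \<Zsemi> pr1 (times_triv_span G f) = s"
      using ex1[of r Z s] by (simp add: times_triv_span_def)
  qed (simp_all add: times_triv_span_def hom_def)
qed

lemma times_triv_span_pair:
  assumes f: "f \<in> Arr C" "Cod C f = M" "total C f" and [simp]: "G \<in> Obj C"
    and t: "r \<in> Arr C" "s \<in> Arr C" "Dom C r = Dom C s" "Cod C r = Dom C f" "Cod C s = M \<otimes> G"
      "\<rho> r = \<rho> s" "r \<Zsemi> f = s \<Zsemi> Proj0 C M G"
  shows "pair C (times_triv_span G f) r s = \<langle>r, s \<Zsemi> Proj1 C M G\<rangle>"
proof -
  have M [simp]: "M \<in> Obj C" using Cod_Obj[OF f(1)] f by simp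
  show ?thesis
  by (rule pullback_pair_eq[OF times_triv_span_pullback[OF f assms(4)]])
    (use f t cpair_eta[of s M G] in \<open>simp_all add: times_triv_span_def pair_ctimes hom_def\<close>)
qed

lemma triv_span_eq:
  assumes "M \<in> Obj C" "A \<in> Obj C" "B \<in> Obj C"
  shows "triv_span C M A B = slice_span C (triv_prod_span M A B) (triv C M A) (triv C M B)"
  using assms by (simp add: triv_span_def slice_span_def triv_prod_span_def triv_def triv_map_def Let_def)

lemma times_triv_eq:
  "times_triv C M G (Dom C f, f) = slice_span C (times_triv_span G f) (Dom C f, f) (triv C M G)"
  by (simp add: times_triv_def times_triv_span_def)

lemma triv_product:
  assumes "M \<in> Obj C" "A \<in> Obj C" "B \<in> Obj C"
  shows "restriction_product (slice C M) (triv C M A) (triv C M B) (triv_span C M A B)"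
  using slice_product(1)[OF triv_prod_span_pullback[OF assms], of M] assms
  by (simp add: triv_span_eq triv_def)

lemma times_triv_product:
  assumes "f \<in> Arr C" "Cod C f = M" "total C f" "G \<in> Obj C"
  shows "restriction_product (slice C M) (Dom C f, f) (triv C M G) (times_triv C M G (Dom C f, f))"
proof -
  have "M \<in> Obj C" using Cod_Obj assms by blast
  then show ?thesis using slice_product(1)[OF times_triv_span_pullback[OF assms], of M] assms
    by (simp add: times_triv_eq triv_def)
qed

lemma triv_slice_pair:
  assumes M: "M \<in> Obj C" "A \<in> Obj C" "B \<in> Obj C"
    and a: "(z, r, triv C M A) \<in> Arr (slice C M)" "(z, s, triv C M B) \<in> Arr (slice C M)"
    and t: "total C r" "total C s"
  shows "pair (slice C M) (triv_span C M A B) (z, r, triv C M A) (z, s, triv C M B) =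
    (z, \<langle>r \<Zsemi> Proj0 C M A, \<langle>r \<Zsemi> Proj1 C M A, s \<Zsemi> Proj1 C M B\<rangle>\<rangle>, triv C M (A \<otimes> B))"
proof -
  have ty: "r \<in> Arr C" "Dom C r = fst z" "Cod C r = M \<otimes> A" "s \<in> Arr C" "Dom C s = fst z" "Cod C s = M \<otimes> B"
    "snd z \<in> Arr C" "Dom C (snd z) = fst z"
    using a by (simp_all add: slice_Arr_iff triv_def hom_def)
  have b: "r \<Zsemi> Proj0 C M A = snd z" "s \<Zsemi> Proj0 C M B = snd z"
    using a[THEN slice_ArrD_total] t ty M by (simp_all add: triv_def rst_total)
  have "apex (triv_prod_span M A B) = M \<otimes> A \<otimes> B" "pr0 (triv_prod_span M A B) \<Zsemi> Proj0 C M A = Proj0 C M (A \<otimes> B)"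
    using M by (simp_all add: triv_prod_span_def)
  then show ?thesis
    using slice_product(2)[OF triv_prod_span_pullback[OF M], of M z r s] a M triv_prod_span_pair[OF M, of r s] ty b t
    by (simp add: triv_span_eq triv_def rst_total)
qed

lemma times_triv_slice_pair:
  assumes f: "f \<in> Arr C" "Cod C f = M" "total C f" "G \<in> Obj C"
    and a: "(z, r, (Dom C f, f)) \<in> Arr (slice C M)" "(z, s, triv C M G) \<in> Arr (slice C M)"
    and t: "total C r" "total C s"
  shows "pair (slice C M) (times_triv C M G (Dom C f, f)) (z, r, (Dom C f, f)) (z, s, triv C M G) =
    (z, \<langle>r, s \<Zsemi> Proj1 C M G\<rangle>, (Dom C f \<otimes> G, Proj0 C (Dom C f) G \<Zsemi> f))"
proof -
  have M: "M \<in> Obj C" using Cod_Obj f by blast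
  have ty: "r \<in> Arr C" "Dom C r = fst z" "Cod C r = Dom C f" "s \<in> Arr C" "Dom C s = fst z" "Cod C s = M \<otimes> G"
    "snd z \<in> Arr C" "Dom C (snd z) = fst z"
    using a by (simp_all add: slice_Arr_iff triv_def hom_def)
  have b: "r \<Zsemi> f = snd z" "s \<Zsemi> Proj0 C M G = snd z"
    using a[THEN slice_ArrD_total] t ty M f by (simp_all add: triv_def rst_total)
  have "apex (times_triv_span G f) = Dom C f \<otimes> G" "pr0 (times_triv_span G f) = Proj0 C (Dom C f) G"
    by (simp_all add: times_triv_span_def)
  then show ?thesis
    using slice_product(2)[OF times_triv_span_pullback[OF f], of M z r s] a M f times_triv_span_pair[OF f, of r s] ty b t
    by (simp add: times_triv_eq triv_def rst_total)
qed

text \<open>A total map to \<open>(M \<otimes> One, \<pi>\<^sub>0)\<close> has the structure map as its first component, which must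
  therefore be total as well.\<close>

lemma slice_to_terminal:
  assumes M: "M \<in> Obj C" and x: "snd x \<in> hom C (fst x) M"
  shows "t \<in> hom (slice C M) x (triv C M (One C)) \<and> total (slice C M) t \<longleftrightarrow>
    total C (snd x) \<and> t = (x, \<langle>snd x, bang C (One C) (fst x)\<rangle>, triv C M (One C))"
proof -
  have xt: "snd x \<in> Arr C" "Dom C (snd x) = fst x" "Cod C (snd x) = M" using x by (simp_all add: hom_def)
  then have X: "fst x \<in> Obj C" using Dom_Obj by metis
  show ?thesis
  proof
    assume "t \<in> hom (slice C M) x (triv C M (One C)) \<and> total (slice C M) t"
    then obtain \<phi> where t: "t = (x, \<phi>, triv C M (One C))" and a: "(x, \<phi>, triv C M (One C)) \<in> Arr (slice C M)"
      and tt: "total (slice C M) (x, \<phi>, triv C M (One C))" by (auto simp: slice_hom_iff)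
    have p: "\<phi> \<in> Arr C" "Dom C \<phi> = fst x" "Cod C \<phi> = M \<otimes> One C"
      using a by (simp_all add: slice_Arr_iff triv_def hom_def)
    have tot: "total C \<phi>" using tt p by (simp add: triv_def hom_def)
    have b: "\<phi> \<Zsemi> Proj0 C M (One C) = snd x"
      using slice_ArrD_total[OF a] tot p xt M by (simp add: triv_def rst_total)
    have "\<phi> \<Zsemi> Proj1 C M (One C) = bang C (One C) (fst x)"
      by (rule to_One_eq) (use p tot M X in \<open>simp_all add: rst_total\<close>)
    then have "\<phi> = \<langle>snd x, bang C (One C) (fst x)\<rangle>"
      using cpair_eta[of \<phi> M "One C"] p M b by simp
    moreover have "total C (snd x)" unfolding b[symmetric] using p tot M by simp
    ultimately show "total C (snd x) \<and> t = (x, \<langle>snd x, bang C (One C) (fst x)\<rangle>, triv C M (One C))"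
      using t by simp
  next
    assume "total C (snd x) \<and> t = (x, \<langle>snd x, bang C (One C) (fst x)\<rangle>, triv C M (One C))"
    then have tot: "total C (snd x)" and t: "t = (x, \<langle>snd x, bang C (One C) (fst x)\<rangle>, triv C M (One C))" by auto
    have "(x, \<langle>snd x, bang C (One C) (fst x)\<rangle>, triv C M (One C)) \<in> Arr (slice C M)"
      by (rule slice_ArrI_total) (use x xt X M tot in \<open>simp_all add: triv_def hom_def rst_total\<close>)
    then show "t \<in> hom (slice C M) x (triv C M (One C)) \<and> total (slice C M) t"
      unfolding t using xt X tot by (simp add: slice_hom_iff triv_def hom_def)
  qed
qed

lemma slice_bang:
  assumes "M \<in> Obj C" "snd x \<in> hom C (fst x) M" "total C (snd x)"
  shows "bang (slice C M) (triv C M (One C)) x = (x, \<langle>snd x, bang C (One C) (fst x)\<rangle>, triv C M (One C))"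
  unfolding bang_def[of "slice C M"] slice_to_terminal[OF assms(1,2)] using assms(3) by simp

lemma slice_supported_iff:
  assumes "M \<in> Obj C"
  shows "x \<in> supported (slice C M) (triv C M (One C)) \<longleftrightarrow> snd x \<in> hom C (fst x) M \<and> total C (snd x)"
proof (cases "snd x \<in> hom C (fst x) M")
  case True
  then show ?thesis
    unfolding supported_def Bex_def mem_Collect_eq slice_to_terminal[OF assms True] by simp
qed (simp add: supported_def)

lemma triv_supported:
  assumes "M \<in> Obj C" "A \<in> Obj C"
  shows "triv C M A \<in> supported (slice C M) (triv C M (One C))"
  unfolding slice_supported_iff[OF assms(1)] using assms by (simp add: triv_def hom_def)

lemma slice_terminal:
  assumes M: "M \<in> Obj C"
  shows "restriction_terminal_on (slice C M) (supported (slice C M) (triv C M (One C))) (triv C M (One C))"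
  unfolding restriction_terminal_on_def
proof (intro conjI ballI)
  show "supported (slice C M) (triv C M (One C)) \<subseteq> Obj (slice C M)" by (auto simp: supported_def)
  show "triv C M (One C) \<in> supported (slice C M) (triv C M (One C))" using M by (simp add: triv_supported)
next
  fix x assume "x \<in> supported (slice C M) (triv C M (One C))"
  then show "\<exists>!t. t \<in> hom (slice C M) x (triv C M (One C)) \<and> total (slice C M) t"
    using slice_to_terminal[OF M] by (simp add: slice_supported_iff[OF M])
next
  fix x y F
  assume "x \<in> supported (slice C M) (triv C M (One C))" "y \<in> supported (slice C M) (triv C M (One C))"
    and F: "F \<in> hom (slice C M) x y"
  then have x: "snd x \<in> hom C (fst x) M" "total C (snd x)" and y: "snd y \<in> hom C (fst y) M" "total C (snd y)"
    by (simp_all add: slice_supported_iff[OF M])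
  obtain \<phi> where f: "F = (x, \<phi>, y)" and a: "(x, \<phi>, y) \<in> Arr (slice C M)" using F by (auto simp: slice_hom_iff)
  have t: "\<phi> \<in> Arr C" "Dom C \<phi> = fst x" "Cod C \<phi> = fst y"
    "snd x \<in> Arr C" "Dom C (snd x) = fst x" "Cod C (snd x) = M"
    "snd y \<in> Arr C" "Dom C (snd y) = fst y" "Cod C (snd y) = M"
    using a by (simp_all add: slice_Arr_iff hom_def)
  then have X: "fst x \<in> Obj C" "fst y \<in> Obj C" using Dom_Obj by metis+
  have "\<phi> \<Zsemi> \<langle>snd y, bang C (One C) (fst y)\<rangle> = \<rho> \<phi> \<Zsemi> \<langle>snd x, bang C (One C) (fst x)\<rangle>"
    using t X slice_ArrD_total[OF a y(2)] comp_bang[of \<phi> "fst y"] by simp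
  then show "Comp (slice C M) F (bang (slice C M) (triv C M (One C)) y) =
      Comp (slice C M) (Rst (slice C M) F) (bang (slice C M) (triv C M (One C)) x)"
    unfolding f slice_bang[OF M x] slice_bang[OF M y] by simp
qed

lemma slice_ArrI:
  assumes "\<phi> \<in> Arr C" "f \<in> Arr C" "g \<in> Arr C" "Dom C \<phi> = Dom C f" "Cod C \<phi> = Dom C g" "Cod C f = M" "Cod C g = M"
    "total C \<phi>" "\<phi> \<Zsemi> g = f" "fst x = Dom C f" "snd x = f" "fst y = Dom C g" "snd y = g"
  shows "(x, \<phi>, y) \<in> Arr (slice C M)"
  using assms rst_self[of f] by (simp add: slice_Arr_iff hom_def rle_def)

lemma triv_map_Arr:
  assumes "M \<in> Obj C" "f \<in> Arr C" "total C f" "Dom C f = A" "Cod C f = B"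
  shows "(triv C M A, Id C M \<times>\<times> f, triv C M B) \<in> Arr (slice C M)"
  using assms by (intro slice_ArrI[where f = "Proj0 C M A" and g = "Proj0 C M B"]) (auto simp: triv_def)

lemma triv_pair_apply:
  assumes M: "M \<in> Obj C" "A \<in> Obj C" "B \<in> Obj C" "Z \<in> Obj C"
    and a: "x \<in> Arr C" "y \<in> Arr C" "Dom C x = M \<otimes> Z" "Dom C y = M \<otimes> Z" "Cod C x = A" "Cod C y = B"
      "total C x" "total C y"
    and z: "z = triv C M Z"
    and rs: "r = \<langle>Proj0 C M Z, x\<rangle>" "s = \<langle>Proj0 C M Z, y\<rangle>"
  shows "pair (slice C M) (triv_span C M A B) (z, r, triv C M A) (z, s, triv C M B) =
    (z, \<langle>Proj0 C M Z, \<langle>x, y\<rangle>\<rangle>, triv C M (A \<otimes> B))"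
proof -
  have rx: "\<rho> x = Id C (M \<otimes> Z)" "\<rho> y = Id C (M \<otimes> Z)" using a rst_total by metis+
  have m1: "(z, r, triv C M A) \<in> Arr (slice C M)"
    unfolding z rs using M a rx
    by (intro slice_ArrI[where f = "Proj0 C M Z" and g = "Proj0 C M A"]) (simp_all add: triv_def)
  have m2: "(z, s, triv C M B) \<in> Arr (slice C M)"
    unfolding z rs using M a rx
    by (intro slice_ArrI[where f = "Proj0 C M Z" and g = "Proj0 C M B"]) (simp_all add: triv_def)
  have tot: "total C r" "total C s" unfolding rs using M a by simp_all
  have p: "r \<Zsemi> Proj0 C M A = Proj0 C M Z" "r \<Zsemi> Proj1 C M A = x" "s \<Zsemi> Proj1 C M B = y"
    unfolding rs using M a rx by simp_all
  show ?thesis unfolding triv_slice_pair[OF M(1-3) m1 m2 tot] p ..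
qed

text \<open>The morphism \<open>1 \<times> f\<close> keeps the base coordinate and applies \<open>f\<close> to the other one. With
  \<open>triv_pair_apply\<close> it turns the group equations of \<open>M \<otimes> G\<close> in the slice into those of \<open>G\<close>, for
  total elements.\<close>

lemma triv_map_value:
  assumes "M \<in> Obj C" "A \<in> Obj C" "f \<in> Arr C" "x \<in> Arr C" "Cod C x = Dom C f" "Dom C x = M \<otimes> A" "total C x"
  shows "\<langle>Proj0 C M A, x\<rangle> \<Zsemi> (Id C M \<times>\<times> f) = \<langle>Proj0 C M A, x \<Zsemi> f\<rangle>"
  using assms rst_total[of x] by (simp add: pair_ctimes)

end

context total_group_object
begin

lemma slice_group_object:
  assumes M [simp]: "M \<in> Obj C"
  shows "group_object (slice C M) (triv C M (One C)) (triv C M G) (triv_span C M G G) (triv_span C M (G \<otimes> G) G)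
    (triv_map C M m) (triv_map C M u) (triv_map C M \<iota>)"
proof -
  interpret S: restriction_category "slice C M" by (rule slice_restriction_category)
  let ?Z = "(G \<otimes> G) \<otimes> G" and ?S = "slice C M"
  let ?HH = "triv_span C M G G" and ?HHH = "triv_span C M (G \<otimes> G) G"
  let ?J = "triv C M (One C)" and ?H = "triv C M G"
  have ops: "triv_map C M m = (triv C M (G \<otimes> G), Id C M \<times>\<times> m, ?H)"
    "triv_map C M u = (?J, Id C M \<times>\<times> u, ?H)" "triv_map C M \<iota> = (?H, Id C M \<times>\<times> \<iota>, ?H)"
    by (simp_all add: triv_map_def)
  have spans: "pr0 ?HH = (triv C M (G \<otimes> G), Id C M \<times>\<times> Proj0 C G G, ?H)"
    "pr1 ?HH = (triv C M (G \<otimes> G), Id C M \<times>\<times> Proj1 C G G, ?H)"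
    "pr0 ?HHH = (triv C M ?Z, Id C M \<times>\<times> Proj0 C (G \<otimes> G) G, triv C M (G \<otimes> G))"
    "pr1 ?HHH = (triv C M ?Z, Id C M \<times>\<times> Proj1 C (G \<otimes> G) G, ?H)"
    "apex ?HH = triv C M (G \<otimes> G)" "apex ?HHH = triv C M ?Z"
    by (simp_all add: triv_span_def triv_map_def)
  have bang: "bang ?S ?J ?H = (?H, \<langle>Proj0 C M G, bang C (One C) (M \<otimes> G)\<rangle>, ?J)"
    by (subst slice_bang) (simp_all add: triv_def hom_def)
  let ?p = "Proj1 C M G"
  have unit: "Comp ?S (bang ?S ?J ?H) (triv_map C M u) =
      (?H, \<langle>Proj0 C M G, ?p \<Zsemi> bang C (One C) G \<Zsemi> u\<rangle>, ?H)"
    unfolding bang ops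
    using unit_element_eq[of "Id C (M \<otimes> G)" "M \<otimes> G" ?p G] by (simp add: triv_map_value)
  have idH: "Id ?S ?H = (?H, \<langle>Proj0 C M G, ?p\<rangle>, ?H)"
    using cpair_eta[of "Id C (M \<otimes> G)" M G] by (simp add: triv_def)
  have inv: "triv_map C M \<iota> = (?H, \<langle>Proj0 C M G, ?p \<Zsemi> \<iota>\<rangle>, ?H)"
    by (simp add: ops ctimes_def)
  have pair: "pair ?S ?HH (?H, \<langle>Proj0 C M G, x\<rangle>, ?H) (?H, \<langle>Proj0 C M G, y\<rangle>, ?H) =
      (?H, \<langle>Proj0 C M G, \<langle>x, y\<rangle>\<rangle>, triv C M (G \<otimes> G))"
    if "x \<in> Arr C" "y \<in> Arr C" "Dom C x = M \<otimes> G" "Dom C y = M \<otimes> G" "Cod C x = G" "Cod C y = G"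
      "total C x" "total C y" for x y
    by (rule triv_pair_apply[where Z = G]) (use that in simp_all)
  show ?thesis
  proof
    show "restriction_terminal_on ?S (supported ?S ?J) ?J" by (rule slice_terminal[OF M])
    show "?H \<in> supported ?S ?J" by (rule triv_supported) simp_all
    show "restriction_product ?S ?H ?H ?HH" by (rule triv_product) simp_all
    show "restriction_product ?S (apex ?HH) ?H ?HHH" unfolding spans by (rule triv_product) simp_all
    show "triv_map C M m \<in> hom ?S (apex ?HH) ?H" "triv_map C M u \<in> hom ?S ?J ?H" "triv_map C M \<iota> \<in> hom ?S ?H ?H"
      unfolding ops spans slice_hom_iff by (simp_all add: triv_map_Arr)
    show "Comp ?S (pair ?S ?HH (Comp ?S (bang ?S ?J ?H) (triv_map C M u)) (Id ?S ?H)) (triv_map C M m) = Id ?S ?H"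
      unfolding unit idH by (simp add: pair ops triv_map_value mult_unit_left)
    show "Comp ?S (pair ?S ?HH (Id ?S ?H) (Comp ?S (bang ?S ?J ?H) (triv_map C M u))) (triv_map C M m) = Id ?S ?H"
      unfolding unit idH by (simp add: pair ops triv_map_value mult_unit_right)
    show "Comp ?S (pair ?S ?HH (triv_map C M \<iota>) (Id ?S ?H)) (triv_map C M m) = Comp ?S (bang ?S ?J ?H) (triv_map C M u)"
      unfolding unit idH inv by (simp add: pair ops(1) triv_map_value mult_inv_left)
    show "Comp ?S (pair ?S ?HH (Id ?S ?H) (triv_map C M \<iota>)) (triv_map C M m) = Comp ?S (bang ?S ?J ?H) (triv_map C M u)"
      unfolding unit idH inv by (simp add: pair ops(1) triv_map_value mult_inv_right)
    show "Comp ?S (pair ?S ?HH (Comp ?S (pr0 ?HHH) (triv_map C M m)) (pr1 ?HHH)) (triv_map C M m) =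
      Comp ?S (pair ?S ?HH (Comp ?S (pr0 ?HHH) (pr0 ?HH))
         (Comp ?S (pair ?S ?HH (Comp ?S (pr0 ?HHH) (pr1 ?HH)) (pr1 ?HHH)) (triv_map C M m))) (triv_map C M m)"
    proof -
      \<comment> \<open>The generic element \<open>(x, y, z)\<close> of \<open>G\<^sup>3\<close>, with \<open>w = (x, y)\<close>, at which associativity is evaluated.\<close>
      define w where "w = Proj1 C M ?Z \<Zsemi> Proj0 C (G \<otimes> G) G"
      define x where "x = w \<Zsemi> Proj0 C G G"
      define y where "y = w \<Zsemi> Proj1 C G G"
      define z where "z = Proj1 C M ?Z \<Zsemi> Proj1 C (G \<otimes> G) G"
      have w: "w \<in> Arr C" "Dom C w = M \<otimes> ?Z" "Cod C w = G \<otimes> G" "total C w" unfolding w_def by simp_all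
      have t: "x \<in> Arr C" "Dom C x = M \<otimes> ?Z" "Cod C x = G" "total C x"
        "y \<in> Arr C" "Dom C y = M \<otimes> ?Z" "Cod C y = G" "total C y"
        "z \<in> Arr C" "Dom C z = M \<otimes> ?Z" "Cod C z = G" "total C z"
        unfolding x_def y_def z_def using w by simp_all
      have r: "\<rho> x = Id C (M \<otimes> ?Z)" "\<rho> y = Id C (M \<otimes> ?Z)" "\<rho> z = Id C (M \<otimes> ?Z)"
        using t rst_total by metis+
      have wxy: "w = \<langle>x, y\<rangle>" unfolding x_def y_def using w by (intro cpair_eta[symmetric]) simp_all
      have p0: "pr0 ?HHH = (triv C M ?Z, \<langle>Proj0 C M ?Z, w\<rangle>, triv C M (G \<otimes> G))"
        and p1: "pr1 ?HHH = (triv C M ?Z, \<langle>Proj0 C M ?Z, z\<rangle>, ?H)"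
        unfolding spans by (simp_all add: ctimes_def w_def z_def)
      have PAIR: "pair ?S ?HH (triv C M ?Z, \<langle>Proj0 C M ?Z, a\<rangle>, ?H) (triv C M ?Z, \<langle>Proj0 C M ?Z, b\<rangle>, ?H) =
          (triv C M ?Z, \<langle>Proj0 C M ?Z, \<langle>a, b\<rangle>\<rangle>, triv C M (G \<otimes> G))"
        if "a \<in> Arr C" "b \<in> Arr C" "Dom C a = M \<otimes> ?Z" "Dom C b = M \<otimes> ?Z" "Cod C a = G" "Cod C b = G"
          "total C a" "total C b" for a b
        by (rule triv_pair_apply[where Z = ?Z]) (use that in simp_all)
      have e0: "Comp ?S (pr0 ?HHH) (triv_map C M m) = (triv C M ?Z, \<langle>Proj0 C M ?Z, w \<Zsemi> m\<rangle>, ?H)"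
        and e1: "Comp ?S (pr0 ?HHH) (pr0 ?HH) = (triv C M ?Z, \<langle>Proj0 C M ?Z, x\<rangle>, ?H)"
        and e2: "Comp ?S (pr0 ?HHH) (pr1 ?HH) = (triv C M ?Z, \<langle>Proj0 C M ?Z, y\<rangle>, ?H)"
        unfolding p0 ops spans(1,2) using w by (simp_all add: triv_map_value x_def y_def)
      show ?thesis
        unfolding e0 e1 e2 p1
        using w t r mult_assoc[of x y z] by (simp add: PAIR ops triv_map_value wxy[symmetric])
    qed
  qed
qed

end

context principal_bundle_pullback
begin

lemma slice_torsor:
  "total_right_torsor (slice C M)
     (triv C M (One C)) (triv C M G) (triv_span C M G G) (triv_span C M (G \<otimes> G) G)
     (triv_map C M m) (triv_map C M u) (triv_map C M \<iota>)
     (P, q) (times_triv C M G (P, q)) (times_triv C M G (apex (times_triv C M G (P, q))))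
     ((P \<otimes> G, Proj0 C P G \<Zsemi> q), r, (P, q))
     (slice_span C PP (P, q) (P, q))"
proof -
  interpret S: group_object "slice C M" "triv C M (One C)" "triv C M G" "triv_span C M G G"
    "triv_span C M (G \<otimes> G) G" "triv_map C M m" "triv_map C M u" "triv_map C M \<iota>"
    by (rule slice_group_object) simp
  let ?S = "slice C M" and ?J = "triv C M (One C)" and ?H = "triv C M G" and ?HH = "triv_span C M G G"
  let ?w = "(P \<otimes> G, Proj0 C P G \<Zsemi> q)" and ?v = "((P \<otimes> G) \<otimes> G, Proj0 C (P \<otimes> G) G \<Zsemi> (Proj0 C P G \<Zsemi> q))"
  let ?TH = "times_triv C M G (P, q)" and ?THH = "times_triv C M G ?w"
  let ?a = "(?w, r, (P, q))"
  let ?X = "Proj0 C (P \<otimes> G) G" and ?k = "Proj1 C (P \<otimes> G) G"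
  note action_total [simp]
  have TH: "apex ?TH = ?w" "pr0 ?TH = (?w, Proj0 C P G, (P, q))"
      "pr1 ?TH = (?w, \<langle>Proj0 C P G \<Zsemi> q, Proj1 C P G\<rangle>, ?H)"
    by (simp_all add: times_triv_def slice_span_def Let_def ctimes_def)
  have THH: "apex ?THH = ?v" "pr0 ?THH = (?v, ?X, ?w)"
      "pr1 ?THH = (?v, \<langle>?X \<Zsemi> Proj0 C P G \<Zsemi> q, ?k\<rangle>, ?H)"
    by (simp_all add: times_triv_def slice_span_def Let_def ctimes_def)
  have a: "?a \<in> Arr ?S"
    by (rule slice_ArrI[where f = "Proj0 C P G \<Zsemi> q" and g = q]) (simp_all add: action_over_base)
  have TP: "pair ?S ?TH (z, x, (P, q)) (z, y, ?H) = (z, \<langle>x, y \<Zsemi> Proj1 C M G\<rangle>, ?w)"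
    if "(z, x, (P, q)) \<in> Arr ?S" "(z, y, ?H) \<in> Arr ?S" "total C x" "total C y" for z x y
    using times_triv_slice_pair[of q M G z x y] that by simp
  have "right_action_axioms ?S ?J ?H ?HH (triv_map C M m) (triv_map C M u) (P, q) ?TH ?THH ?a"
  proof
    show "(P, q) \<in> supported ?S ?J" by (simp add: slice_supported_iff hom_def)
    show "restriction_product ?S (P, q) ?H ?TH" using times_triv_product[of q M G] by simp
    show "restriction_product ?S (apex ?TH) ?H ?THH" unfolding TH(1)
      using times_triv_product[of "Proj0 C P G \<Zsemi> q" M G] by simp
    show "?a \<in> hom ?S (apex ?TH) (P, q)" unfolding TH(1) using a by (simp add: slice_hom_iff)
    show "Comp ?S (pair ?S ?TH (Id ?S (P, q)) (Comp ?S (bang ?S ?J (P, q)) (triv_map C M u))) ?a = Id ?S (P, q)"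
    proof -
      have "bang ?S ?J (P, q) = ((P, q), \<langle>q, bang C (One C) P\<rangle>, ?J)"
        by (subst slice_bang) (simp_all add: hom_def)
      then have u: "Comp ?S (bang ?S ?J (P, q)) (triv_map C M u) = ((P, q), \<langle>q, bang C (One C) P \<Zsemi> u\<rangle>, ?H)"
        by (simp add: triv_map_def pair_ctimes rst_total)
      have "((P, q), \<langle>q, bang C (One C) P \<Zsemi> u\<rangle>, ?H) \<in> Arr ?S"
        by (rule slice_ArrI[where f = q and g = "Proj0 C M G"]) (simp_all add: triv_def rst_total)
      moreover have "((P, q), Id C P, (P, q)) \<in> Arr ?S"
        by (rule slice_ArrI[where f = q and g = q]) simp_all
      ultimately show ?thesis unfolding u using TP action_unit by (simp add: rst_total)
    qed
    show "Comp ?S (pair ?S ?TH (Comp ?S (pr0 ?THH) ?a) (pr1 ?THH)) ?a =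
      Comp ?S (pair ?S ?TH (Comp ?S (pr0 ?THH) (pr0 ?TH))
         (Comp ?S (pair ?S ?HH (Comp ?S (pr0 ?THH) (pr1 ?TH)) (pr1 ?THH)) (triv_map C M m))) ?a"
    proof -
      \<comment> \<open>The generic element \<open>((p, g), k)\<close> of \<open>(P \<otimes> G) \<otimes> G\<close>; here \<open>b\<close> is the base point of \<open>p\<close>.\<close>
      define b where "b = ?X \<Zsemi> Proj0 C P G \<Zsemi> q"
      define g where "g = ?X \<Zsemi> Proj1 C P G"
      let ?Z = "(P \<otimes> G) \<otimes> G"
      have t: "b \<in> Arr C" "Dom C b = ?Z" "Cod C b = M" "total C b"
        "g \<in> Arr C" "Dom C g = ?Z" "Cod C g = G" "total C g" unfolding b_def g_def by simp_all
      have rr: "\<rho> b = Id C ?Z" "\<rho> g = Id C ?Z" using t rst_total by metis+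
      have v: "?v = (?Z, b)" by (simp add: b_def)
      have el: "(?v, \<langle>b, y\<rangle>, triv C M A) \<in> Arr ?S"
        if "y \<in> Arr C" "Dom C y = ?Z" "Cod C y = A" "total C y" "A \<in> Obj C" for y A
        unfolding v using that t rr
        by (intro slice_ArrI[where f = b and g = "Proj0 C M A"]) (simp_all add: triv_def rst_total)
      have gk: "pair ?S ?HH (Comp ?S (pr0 ?THH) (pr1 ?TH)) (pr1 ?THH) = (?v, \<langle>b, \<langle>g, ?k\<rangle>\<rangle>, triv C M (G \<otimes> G))"
      proof -
        have "Comp ?S (pr0 ?THH) (pr1 ?TH) = (?v, \<langle>b, g\<rangle>, ?H)" "pr1 ?THH = (?v, \<langle>b, ?k\<rangle>, ?H)"
          unfolding TH THH b_def g_def by simp_all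
        then show ?thesis using triv_slice_pair[of M G G ?v "\<langle>b, g\<rangle>" "\<langle>b, ?k\<rangle>"] el[of g G] el[of ?k G] t rr
          by simp
      qed
      have gkm: "Comp ?S (?v, \<langle>b, \<langle>g, ?k\<rangle>\<rangle>, triv C M (G \<otimes> G)) (triv_map C M m) = (?v, \<langle>b, \<langle>g, ?k\<rangle> \<Zsemi> m\<rangle>, ?H)"
        using t rr by (simp add: triv_map_def pair_ctimes)
      have s1: "Comp ?S (pr0 ?THH) ?a = (?v, ?X \<Zsemi> r, (P, q))"
        and s2: "Comp ?S (pr0 ?THH) (pr0 ?TH) = (?v, ?X \<Zsemi> Proj0 C P G, (P, q))"
        and s3: "pr1 ?THH = (?v, \<langle>b, ?k\<rangle>, ?H)"
        unfolding TH THH b_def by simp_all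
      have "?X \<Zsemi> (r \<Zsemi> q) = b" unfolding action_over_base b_def by simp
      then have m1: "(?v, ?X \<Zsemi> r, (P, q)) \<in> Arr ?S" unfolding v
        using t by (intro slice_ArrI[where f = b and g = q]) simp_all
      have m2: "(?v, ?X \<Zsemi> Proj0 C P G, (P, q)) \<in> Arr ?S" unfolding v
        using t by (intro slice_ArrI[where f = b and g = q]) (simp_all add: b_def)
      have q1: "pair ?S ?TH (?v, ?X \<Zsemi> r, (P, q)) (?v, \<langle>b, ?k\<rangle>, ?H) = (?v, \<langle>?X \<Zsemi> r, ?k\<rangle>, ?w)"
        using TP[OF m1 el[of ?k G]] t rr by simp
      have q2: "pair ?S ?TH (?v, ?X \<Zsemi> Proj0 C P G, (P, q)) (?v, \<langle>b, \<langle>g, ?k\<rangle> \<Zsemi> m\<rangle>, ?H) =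
          (?v, \<langle>?X \<Zsemi> Proj0 C P G, \<langle>g, ?k\<rangle> \<Zsemi> m\<rangle>, ?w)"
        using TP[OF m2 el[of "\<langle>g, ?k\<rangle> \<Zsemi> m" G]] t rr by simp
      show ?thesis unfolding gk gkm s1 s2 unfolding s3 q1 q2 using action_mult by (simp add: g_def)
    qed
  qed
  then have act: "right_action ?S ?J ?H ?HH (triv_span C M (G \<otimes> G) G) (triv_map C M m) (triv_map C M u) (triv_map C M \<iota>)
      (P, q) ?TH ?THH ?a"
    using S.group_object_axioms by (simp add: right_action_def)
  let ?pb = "(apex PP, pr0 PP \<Zsemi> q)"
  have "total_right_torsor_axioms ?S (P, q) ?TH ?a (slice_span C PP (P, q) (P, q))"
  proof
    show "restriction_product ?S (P, q) (P, q) (slice_span C PP (P, q) (P, q))"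
      using slice_product(1)[OF pullback, of M] by simp
    have p0: "(?w, Proj0 C P G, (P, q)) \<in> Arr ?S"
      by (rule slice_ArrI[where f = "Proj0 C P G \<Zsemi> q" and g = q]) simp_all
    have "pair ?S (slice_span C PP (P, q) (P, q)) (pr0 ?TH) ?a = (?w, d, ?pb)"
      unfolding TH using slice_product(2)[OF pullback, of M ?w "Proj0 C P G" r] p0 a by simp
    moreover have "total_inverse ?S (?w, d, ?pb) (?pb, dstar, ?w)"
    proof -
      have inv: "total C dstar" "d \<Zsemi> dstar = Id C (P \<otimes> G)" "dstar \<Zsemi> d = Id C (apex PP)"
        using division_inverse by (simp_all add: total_inverse_def)
      have d0: "d \<Zsemi> (pr0 PP \<Zsemi> q) = Proj0 C P G \<Zsemi> q" using d_proj by simp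
      \<comment> \<open>\<open>dstar\<close> is a morphism of the slice since its inverse \<open>d\<close> is one.\<close>
      have d1: "dstar \<Zsemi> (Proj0 C P G \<Zsemi> q) = pr0 PP \<Zsemi> q"
      proof -
        have "dstar \<Zsemi> (Proj0 C P G \<Zsemi> q) = dstar \<Zsemi> d \<Zsemi> (pr0 PP \<Zsemi> q)"
          unfolding d0[symmetric] by (rule comp_left_nest) simp_all
        then show ?thesis unfolding inv by simp
      qed
      have A: "(?w, d, ?pb) \<in> Arr ?S"
        by (rule slice_ArrI[where f = "Proj0 C P G \<Zsemi> q" and g = "pr0 PP \<Zsemi> q"]) (use d0 in simp_all)
      have B: "(?pb, dstar, ?w) \<in> Arr ?S"
        by (rule slice_ArrI[where f = "pr0 PP \<Zsemi> q" and g = "Proj0 C P G \<Zsemi> q"]) (use d1 inv in simp_all)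
      show ?thesis using A B inv by (simp add: total_inverse_def slice_hom_iff hom_def)
    qed
    ultimately show "\<exists>d'. total_inverse ?S (pair ?S (slice_span C PP (P, q) (P, q)) (pr0 ?TH) ?a) d'"
      by metis
  qed
  then show ?thesis unfolding TH(1) using act by (simp add: total_right_torsor_def)
qed

end

theorem theorem10:
  fixes X :: "('o, 'a) crcat" (structure)
    and G P M :: 'o and m u \<iota> q :: 'a
    and I :: "'i set" and \<alpha> e :: "'i \<Rightarrow> 'a" and \<tau> :: "'i \<Rightarrow> 'i \<Rightarrow> 'a"
    and PP :: "('o, 'a) span"
  assumes "cartesian_join_restriction_category X"
    and "cgroup_object X G m u \<iota>"
    and "total X m" and "total X u" and "total X \<iota>"
    and "principal_bundle X G m u \<iota> P M q I \<alpha> e \<tau>"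
    and "totally_fibred X G P M q I \<alpha> e"
    and "restriction_pullback X q q PP"
  defines "r \<equiv> bundle_action X G m P M I \<alpha>"
    and "d \<equiv> pair X PP (Proj0 X P G) (bundle_action X G m P M I \<alpha>)"
    and "dstar \<equiv> bundle_division X G m \<iota> P M PP I \<alpha>"
  shows "total_right_torsor (slice X M)
           (triv X M (One X)) (triv X M G) (triv_span X M G G) (triv_span X M (G \<otimes> G) G)
           (triv_map X M m) (triv_map X M u) (triv_map X M \<iota>)
           (P, q) (times_triv X M G (P, q)) (times_triv X M G (apex (times_triv X M G (P, q))))
           ((P \<otimes> G, Proj0 X P G \<Zsemi> q), r, (P, q))
           (slice_span X PP (P, q) (P, q))
       \<and> is_join X (P \<otimes> G) P ((\<lambda>i. action_part X G m M (\<alpha> i)) ` I) r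
       \<and> is_join X (apex PP) (P \<otimes> G) ((\<lambda>i. division_part X G m \<iota> M PP (\<alpha> i)) ` I) dstar
       \<and> d \<in> hom X (P \<otimes> G) (apex PP)
       \<and> total_inverse X d dstar"
proof -
  interpret cartesian_join_restriction_category X by fact
  interpret G: group_object X "One X" G "prod_span X G G" "prod_span X (G \<otimes> G) G" m u \<iota> by fact
  interpret B: principal_bundle X G m u \<iota> P M q I \<alpha> e \<tau> by fact
  interpret F: totally_fibred X G P M q I \<alpha> e by fact
  interpret T: total_group_object X G m u \<iota> by unfold_locales fact+
  interpret principal_bundle_pullback X G m u \<iota> P M q I \<alpha> e \<tau> PP by unfold_locales fact
  show ?thesis unfolding r_def d_def dstar_def
    using slice_torsor action_is_join division_is_join division_inverse by (simp add: hom_def)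
qed

end
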